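(* Let $\mathfrak{K}:[0,\infty)^2\to[0,\infty)$ be a coagulation kernel of the form $$0\le \mathfrak{K}(\varsigma,\varrho)=\mathfrak{K}(\varrho,\varsigma)=r(\varsigma)r(\varrho)+\alpha(\varsigma,\varrho),$$ where $r:[0,\infty)\to[0,\infty)$ and $\alpha:[0,\infty)^2\to[0,\infty)$ are continuous, $\alpha$ is symmetric, and there is a real number $A>0$ such that $0\le\alpha(\varsigma,\varrho)\le A\,r(\varsigma)r(\varrho)$ for all $(\varsigma,\varrho)\in[1,\infty)^2$. Assume moreover that for every $R\ge 1$ $$\sup_{\varsigma\in[0,R]}\frac{\mathfrak{K}(\varsigma,\varrho)}{\varrho}\longrightarrow 0\quad\text{as }\varrho\to+\infty .$$ Then for every $\mathfrak{f}_0\in X_{0,1}^+$ there is at least one mild solution $\mathfrak{f}$ on $[0,\infty)$ of the continuous Redner--Ben-Avraham--Kahng coagulation equation with kernel $\mathfrak{K}$ and initial datum $\mathfrak{f}_0$ which satisfies $$\int_0^\infty \varsigma\,\mathfrak{f}(\varsigma,\tau)\,d\varsigma\le\int_0^\infty\varsigma\,\mathfrak{f}_0(\varsigma)\,d\varsigma\qquad\text{for all }\tau\in[0,\infty).$$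
   Context: Space: $X_{0,1}=L^1((0,\infty);(1+\varsigma)\,d\varsigma)$ with norm $\|x\|_{0,1}=\int_0^\infty(1+\varsigma)|x(\varsigma)|\,d\varsigma$, and $X_{0,1}^+=\{x\in X_{0,1}: x\ge 0 \text{ a.e.}\}$. Equation: the continuous Redner--Ben-Avraham--Kahng (RBK) coagulation equation is $$\frac{\partial\mathfrak{f}}{\partial\tau}(\varsigma,\tau)=\int_0^\infty\mathfrak{K}(\varsigma+\varrho,\varrho)\mathfrak{f}(\varsigma+\varrho,\tau)\mathfrak{f}(\varrho,\tau)\,d\varrho-\int_0^\infty\mathfrak{K}(\varsigma,\varrho)\mathfrak{f}(\varsigma,\tau)\mathfrak{f}(\varrho,\tau)\,d\varrho,\qquad \mathfrak{f}(\varsigma,0)=\mathfrak{f}_0(\varsigma)\ge0 .$$ Mild solution: let $T\in(0,\infty]$. A mild solution on $[0,T)$ is a non-negative function $\mathfrak{f}:[0,T)\to X_{0,1}^+$ (written $\mathfrak{f}(\varsigma,\tau)=\mathfrak{f}(\tau)(\varsigma)$) such that (i) $\mathfrak{f}\in\mathcal{C}([0,T);L^1(0,\infty))\cap L^\infty(0,T;X_{0,1})$; and, for every $\tau\in[0,T)$ and almost every $\varsigma\in(0,\infty)$, (ii) $(\varrho,\mathfrak{s})\mapsto\mathfrak{K}(\varsigma,\varrho)\mathfrak{f}(\varsigma,\mathfrak{s})\mathfrak{f}(\varrho,\mathfrak{s})$ belongs to $L^1((0,\infty)\times(0,\tau))$; (iii) $$\mathfrak{f}(\varsigma,\tau)=\mathfrak{f}_0(\varsigma)+\int_0^\tau\int_0^\infty\mathfrak{K}(\varsigma+\varrho,\varrho)\mathfrak{f}(\varsigma+\varrho,\mathfrak{s})\mathfrak{f}(\varrho,\mathfrak{s})\,d\varrho\,d\mathfrak{s}-\int_0^\tau\int_0^\infty\mathfrak{K}(\varsigma,\varrho)\mathfrak{f}(\varsigma,\mathfrak{s})\mathfrak{f}(\varrho,\mathfrak{s})\,d\varrho\,d\mathfrak{s}.$$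 *)

theory Defs
  imports "HOL-Analysis.Analysis"
begin

text \<open>
  Elements of the Lebesgue spaces on the half line are represented by functions; they are only
  looked at on \<open>{0<..}\<close>, and up to null sets. Measures are \<open>lborel\<close>, so that a class in
  \<open>L\<^sup>1\<close> is given by a Borel representative. Throughout, \<open>f \<tau> \<sigma>\<close> is the value at time \<open>\<tau>\<close> and
  size \<open>\<sigma>\<close>.
\<close>

definition L1 :: "(real \<Rightarrow> real) set" where
  "L1 = {x. set_integrable lborel {0<..} x}"

definition L1_norm :: "(real \<Rightarrow> real) \<Rightarrow> real" where
  "L1_norm x = (LBINT \<sigma>:{0<..}. \<bar>x \<sigma>\<bar>)"

definition X01 :: "(real \<Rightarrow> real) set" where
  "X01 = {x. set_integrable lborel {0<..} (\<lambda>\<sigma>. (1 + \<sigma>) * x \<sigma>)}"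

definition X01_norm :: "(real \<Rightarrow> real) \<Rightarrow> real" where
  "X01_norm x = (LBINT \<sigma>:{0<..}. (1 + \<sigma>) * \<bar>x \<sigma>\<bar>)"

definition X01_pos :: "(real \<Rightarrow> real) set" where
  "X01_pos = {x \<in> X01. AE \<sigma> in lborel. 0 < \<sigma> \<longrightarrow> 0 \<le> x \<sigma>}"

definition time_interval :: "ereal \<Rightarrow> real set" where
  "time_interval T = {t. 0 \<le> t \<and> ereal t < T}"

definition open_time_interval :: "ereal \<Rightarrow> real set" where
  "open_time_interval T = {t. 0 < t \<and> ereal t < T}"

definition continuous_L1 :: "ereal \<Rightarrow> (real \<Rightarrow> real \<Rightarrow> real) \<Rightarrow> bool" where
  "continuous_L1 T f \<longleftrightarrow>
     (\<forall>t \<in> time_interval T. f t \<in> L1 \<and>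
        ((\<lambda>s. L1_norm (\<lambda>\<sigma>. f s \<sigma> - f t \<sigma>)) \<longlongrightarrow> 0) (at t within time_interval T))"

text \<open>Bochner (strong) measurability: almost everywhere limit of simple functions.\<close>

definition strongly_measurable_X01 :: "ereal \<Rightarrow> (real \<Rightarrow> real \<Rightarrow> real) \<Rightarrow> bool" where
  "strongly_measurable_X01 T f \<longleftrightarrow>
     (\<exists>g :: nat \<Rightarrow> real \<Rightarrow> real \<Rightarrow> real.
        (\<forall>n. simple_function (restrict_space lborel (open_time_interval T)) (g n)) \<and>
        (\<forall>n. \<forall>t \<in> open_time_interval T. g n t \<in> X01) \<and>
        (AE t in lborel. t \<in> open_time_interval T \<longrightarrow>
           (\<lambda>n. X01_norm (\<lambda>\<sigma>. g n t \<sigma> - f t \<sigma>)) \<longlonglongrightarrow> 0))"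

definition Linfty_X01 :: "ereal \<Rightarrow> (real \<Rightarrow> real \<Rightarrow> real) \<Rightarrow> bool" where
  "Linfty_X01 T f \<longleftrightarrow>
     (AE t in lborel. t \<in> open_time_interval T \<longrightarrow> f t \<in> X01) \<and>
     strongly_measurable_X01 T f \<and>
     (\<exists>C. AE t in lborel. t \<in> open_time_interval T \<longrightarrow> X01_norm (f t) \<le> C)"

definition RBK_gain ::
    "(real \<Rightarrow> real \<Rightarrow> real) \<Rightarrow> (real \<Rightarrow> real \<Rightarrow> real) \<Rightarrow> real \<Rightarrow> real \<Rightarrow> real \<Rightarrow> real" where
  "RBK_gain K f \<sigma> \<rho> s = K (\<sigma> + \<rho>) \<rho> * f s (\<sigma> + \<rho>) * f s \<rho>"

definition RBK_loss ::
    "(real \<Rightarrow> real \<Rightarrow> real) \<Rightarrow> (real \<Rightarrow> real \<Rightarrow> real) \<Rightarrow> real \<Rightarrow> real \<Rightarrow> real \<Rightarrow> real" where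
  "RBK_loss K f \<sigma> \<rho> s = K \<sigma> \<rho> * f s \<sigma> * f s \<rho>"

text \<open>
  The integral equation is an identity between real numbers, so its nonnegative gain term has to
  be finite. Since the Bochner integral of a non-integrable function is \<open>0\<close>, integrability of the
  gain term is required explicitly, next to that of the loss term.
\<close>

definition mild_solution ::
    "(real \<Rightarrow> real \<Rightarrow> real) \<Rightarrow> (real \<Rightarrow> real) \<Rightarrow> ereal \<Rightarrow> (real \<Rightarrow> real \<Rightarrow> real) \<Rightarrow> bool" where
  "mild_solution K f0 T f \<longleftrightarrow>
     (\<forall>\<tau> \<in> time_interval T. f \<tau> \<in> X01_pos) \<and>
     continuous_L1 T f \<and> Linfty_X01 T f \<and>
     (\<forall>\<tau> \<in> time_interval T. AE \<sigma> in lborel. 0 < \<sigma> \<longrightarrow>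
        set_integrable lborel ({0<..} \<times> {0<..<\<tau>}) (\<lambda>(\<rho>, s). RBK_loss K f \<sigma> \<rho> s) \<and>
        set_integrable lborel ({0<..} \<times> {0<..<\<tau>}) (\<lambda>(\<rho>, s). RBK_gain K f \<sigma> \<rho> s) \<and>
        f \<tau> \<sigma> = f0 \<sigma>
          + (LBINT s:{0<..<\<tau>}. LBINT \<rho>:{0<..}. RBK_gain K f \<sigma> \<rho> s)
          - (LBINT s:{0<..<\<tau>}. LBINT \<rho>:{0<..}. RBK_loss K f \<sigma> \<rho> s))"

end

theory Submission
  imports Defs "HOL-Library.Diagonal_Subsequence" "HOL-Real_Asymp.Real_Asymp"
begin

text \<open>
  A collision replaces two particles of sizes \<open>a > b\<close> by one of size \<open>a - b\<close>. Hence every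
  \<open>\<integral> \<phi> f\<close> with \<open>\<phi>\<close> monotone decreases, at a rate of at least \<open>\<phi> b\<close> per collision. With
  \<open>\<phi> = 1\<close> and \<open>\<phi> \<sigma> = \<sigma>\<close> this bounds number and mass; with \<open>\<phi>\<close> the indicator of \<open>{S<..}\<close>
  the total number of collisions between two particles larger than \<open>S\<close> is at most the tail of the
  initial datum. Since \<open>K x y / y \<longlongrightarrow> 0\<close> controls collisions of a small with a large particle,
  collisions outside a large square are uniformly negligible.

  Approximate solutions come from the explicit Euler scheme with truncated kernels. In the evolution
  of \<open>\<bar>f (x + h) - f x\<bar>\<close> the gain is absorbed by the loss, so the translation modulus in \<open>L\<^sup>1\<close>
  grows only by the modulus of continuity of the truncated kernel and by the negligible collisions.
  This gives compactness in the strong topology of \<open>C([0, T]; L\<^sup>1)\<close>, under which the bilinear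
  collision terms converge.
\<close>

section \<open>One Euler step\<close>

text \<open>The decay of \<open>K x y / y\<close> is uniform only for bounded \<open>x\<close>, so
  it says nothing about two large particles. Their collisions are controlled here only after
  summation over time, which is why tails appear as sums over steps or as time integrals and not as
  rates at a fixed time. The bounds \<open>cap n\<close> of the truncated kernels need not stay
  bounded in \<open>n\<close>, so a Gronwall argument with the Lipschitz constant of the truncated
  equation would give nothing uniform. The translation estimate therefore splits the
  \<open>n\<close>-th kernel at a fixed coarser level \<open>R\<close>: the part proportional to the
  modulus itself cancels, and only constants belonging to \<open>R\<close> and collisions beyond
  \<open>R\<close> survive, added once per step and never compounded. The order of choices is
  accuracy of the tail, then \<open>R\<close>, then the shift or time increment, then
  \<open>n\<close>. Balance laws live in \<open>ennreal\<close> and stay additive, loss on one side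
  and gain on the other; a term is cancelled only once it is known to be finite.\<close>

definition kernel :: "(real \<Rightarrow> real \<Rightarrow> real) \<Rightarrow> bool" where
  "kernel k \<longleftrightarrow> case_prod k \<in> borel_measurable (borel \<Otimes>\<^sub>M borel)
     \<and> (\<forall>x y. 0 \<le> k x y) \<and> (\<forall>x y. k x y = k y x)"

definition density_fun :: "(real \<Rightarrow> real) \<Rightarrow> bool" where
  "density_fun f \<longleftrightarrow> f \<in> borel_measurable borel \<and> (\<forall>x. 0 \<le> f x) \<and> (\<forall>x\<le>0. f x = 0)"

definition total :: "(real \<Rightarrow> real) \<Rightarrow> ennreal" where
  "total f = (\<integral>\<^sup>+x. ennreal (f x) \<partial>lborel)"

definition moment :: "(real \<Rightarrow> real) \<Rightarrow> ennreal" where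
  "moment f = (\<integral>\<^sup>+x. ennreal (x * f x) \<partial>lborel)"

text \<open>Ordered pairs are counted, so one physical collision is seen as \<open>(a, b)\<close>
  and as \<open>(b, a)\<close>. The weight \<open>\<psi>\<close> records what a pair removes or
  produces; with values in \<open>ennreal\<close> it needs no integrability assumption.\<close>

definition collisions ::
    "(real \<Rightarrow> real \<Rightarrow> ennreal) \<Rightarrow> (real \<Rightarrow> real \<Rightarrow> real) \<Rightarrow> (real \<Rightarrow> real) \<Rightarrow> ennreal" where
  "collisions \<psi> k f = (\<integral>\<^sup>+a. \<integral>\<^sup>+b. \<psi> a b * ennreal (k a b * f a * f b) \<partial>lborel \<partial>lborel)"

definition loss_rate :: "(real \<Rightarrow> real \<Rightarrow> real) \<Rightarrow> (real \<Rightarrow> real) \<Rightarrow> real \<Rightarrow> ennreal" where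
  "loss_rate k f x = (\<integral>\<^sup>+y. ennreal (k x y * f x * f y) \<partial>lborel)"

text \<open>For \<open>x \<le> 0\<close> the integral need not vanish, since \<open>x + y\<close>
  may still be positive. The indicator discards pairs whose first member is the smaller one, so that
  each unordered pair produces its difference once.\<close>

definition gain_rate :: "(real \<Rightarrow> real \<Rightarrow> real) \<Rightarrow> (real \<Rightarrow> real) \<Rightarrow> real \<Rightarrow> ennreal" where
  "gain_rate k f x = indicator {0<..} x * (\<integral>\<^sup>+y. ennreal (k (x + y) y * f (x + y) * f y) \<partial>lborel)"

text \<open>\<open>enn2real\<close> sends an infinite gain to 0. For a bounded kernel and a finite
  total this can happen only on a null set, so the balance laws survive almost everywhere.\<close>

definition euler :: "real \<Rightarrow> (real \<Rightarrow> real \<Rightarrow> real) \<Rightarrow> (real \<Rightarrow> real) \<Rightarrow> real \<Rightarrow> real" where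
  "euler \<delta> k f x = f x + \<delta> * enn2real (gain_rate k f x) - \<delta> * enn2real (loss_rate k f x)"

text \<open>Only points \<open>x > 0\<close> are compared: for \<open>h \<ge> 0\<close> the jump at
  0 created by the extension by zero is never seen, and no separate bound on the mass in
  \<open>(0, h]\<close> enters.\<close>

definition shift_dist :: "real \<Rightarrow> (real \<Rightarrow> real) \<Rightarrow> ennreal" where
  "shift_dist h f = (\<integral>\<^sup>+x. ennreal (indicator {0<..} x * \<bar>f (x + h) - f x\<bar>) \<partial>lborel)"

lemma kernelD:
  assumes "kernel k"
  shows kernel_measurable[measurable_dest]: "case_prod k \<in> borel_measurable (borel \<Otimes>\<^sub>M borel)"
    and kernel_nonneg: "0 \<le> k x y" and kernel_sym: "k x y = k y x"
  using assms by (auto simp: kernel_def)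

lemma density_funD:
  assumes "density_fun f"
  shows density_fun_measurable: "f \<in> borel_measurable borel"
    and density_fun_nonneg: "0 \<le> f x" and density_fun_zero: "x \<le> 0 \<Longrightarrow> f x = 0"
  using assms by (auto simp: density_fun_def)

lemma loss_rate_measurable[measurable]:
  assumes [measurable]: "kernel k" and f: "density_fun f"
  shows "loss_rate k f \<in> borel_measurable borel"
  supply [measurable] = density_fun_measurable[OF f] f
  unfolding loss_rate_def by measurable

lemma gain_rate_measurable[measurable]:
  assumes [measurable]: "kernel k" and f: "density_fun f"
  shows "gain_rate k f \<in> borel_measurable borel"
  supply [measurable] = density_fun_measurable[OF f] f
  unfolding gain_rate_def by measurable

lemma euler_measurable[measurable]:
  assumes [measurable]: "kernel k" and f: "density_fun f"
  shows "euler \<delta> k f \<in> borel_measurable borel"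
  supply [measurable] = density_fun_measurable[OF f] f
  unfolding euler_def by measurable

section \<open>Weak formulation of gain and loss\<close>

lemma loss_weak:
  assumes [measurable]: "kernel k" and f: "density_fun f" and [measurable]: "\<phi> \<in> borel_measurable borel"
  shows "(\<integral>\<^sup>+x. \<phi> x * loss_rate k f x \<partial>lborel) = collisions (\<lambda>a b. \<phi> a) k f"
  supply [measurable] = density_fun_measurable[OF f] f
  unfolding loss_rate_def collisions_def
  by (intro nn_integral_cong nn_integral_cmult[symmetric]) measurable

lemma nn_integral_shift:
  fixes c :: real
  assumes [measurable]: "g \<in> borel_measurable borel"
  shows "(\<integral>\<^sup>+x. g (x + c) \<partial>lborel) = (\<integral>\<^sup>+x. g x \<partial>lborel)"
  using nn_integral_real_affine[of g 1 c] by (simp add: add.commute)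

text \<open>The map from \<open>(x, y)\<close> to \<open>(x + y, y)\<close> preserves area: after
  Tonelli it is a translation in \<open>x\<close> for fixed \<open>y\<close>. In the gain term it
  recovers the colliding pair \<open>(a, b)\<close> from the produced size
  \<open>x = a - b\<close>.\<close>

lemma nn_integral_shear:
  fixes F :: "real \<Rightarrow> real \<Rightarrow> ennreal"
  assumes [measurable]: "case_prod F \<in> borel_measurable (borel \<Otimes>\<^sub>M borel)"
  shows "(\<integral>\<^sup>+x. \<integral>\<^sup>+y. F (x + y) y \<partial>lborel \<partial>lborel) = (\<integral>\<^sup>+a. \<integral>\<^sup>+b. F a b \<partial>lborel \<partial>lborel)"
proof -
  have "(\<integral>\<^sup>+x. \<integral>\<^sup>+y. F (x + y) y \<partial>lborel \<partial>lborel) = (\<integral>\<^sup>+y. \<integral>\<^sup>+x. F (x + y) y \<partial>lborel \<partial>lborel)"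
    by (rule lborel_pair.Fubini') measurable
  also have "\<dots> = (\<integral>\<^sup>+b. \<integral>\<^sup>+a. F a b \<partial>lborel \<partial>lborel)"
    by (intro nn_integral_cong nn_integral_shift) measurable
  also have "\<dots> = (\<integral>\<^sup>+a. \<integral>\<^sup>+b. F a b \<partial>lborel \<partial>lborel)"
    by (rule lborel_pair.Fubini') measurable
  finally show ?thesis .
qed

lemma gain_weak:
  assumes [measurable]: "kernel k" and f: "density_fun f" and [measurable]: "\<phi> \<in> borel_measurable borel"
  shows "(\<integral>\<^sup>+x. \<phi> x * gain_rate k f x \<partial>lborel)
    = collisions (\<lambda>a b. \<phi> (a - b) * indicator {0<..} (a - b)) k f"
proof -
  note [measurable] = density_fun_measurable[OF f] f
  let ?F = "\<lambda>a b. \<phi> (a - b) * indicator {0<..} (a - b) * ennreal (k a b * f a * f b)"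
  have "(\<integral>\<^sup>+x. \<phi> x * gain_rate k f x \<partial>lborel) = (\<integral>\<^sup>+x. \<integral>\<^sup>+y. ?F (x + y) y \<partial>lborel \<partial>lborel)"
    unfolding gain_rate_def mult.assoc[symmetric]
    by (intro nn_integral_cong, simp, subst nn_integral_cmult) auto
  also have "\<dots> = (\<integral>\<^sup>+a. \<integral>\<^sup>+b. ?F a b \<partial>lborel \<partial>lborel)"
    by (rule nn_integral_shear) measurable
  finally show ?thesis unfolding collisions_def .
qed

lemma collisions_mono:
  assumes "\<And>a b. 0 < a \<Longrightarrow> 0 < b \<Longrightarrow> \<psi> a b * ennreal (k a b * f a * f b) \<le> \<psi>' a b * ennreal (k' a b * f a * f b)"
    and "density_fun f"
  shows "collisions \<psi> k f \<le> collisions \<psi>' k' f"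
  unfolding collisions_def
proof (intro nn_integral_mono)
  fix a b
  show "\<psi> a b * ennreal (k a b * f a * f b) \<le> \<psi>' a b * ennreal (k' a b * f a * f b)"
    using assms(1)[of a b] density_fun_zero[OF assms(2)] by (cases "0 < a \<and> 0 < b") auto
qed

lemma collisions_add:
  assumes [measurable]: "kernel k" and f: "density_fun f" and [measurable]: "case_prod \<psi> \<in> borel_measurable (borel \<Otimes>\<^sub>M borel)"
     "case_prod \<psi>' \<in> borel_measurable (borel \<Otimes>\<^sub>M borel)"
  shows "collisions (\<lambda>a b. \<psi> a b + \<psi>' a b) k f = collisions \<psi> k f + collisions \<psi>' k f"
proof -
  note [measurable] = density_fun_measurable[OF f] f
  have "collisions (\<lambda>a b. \<psi> a b + \<psi>' a b) k f = (\<integral>\<^sup>+a. (\<integral>\<^sup>+b. \<psi> a b * ennreal (k a b * f a * f b) \<partial>lborel)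
     + (\<integral>\<^sup>+b. \<psi>' a b * ennreal (k a b * f a * f b) \<partial>lborel) \<partial>lborel)"
    unfolding collisions_def
  proof (rule nn_integral_cong, goal_cases)
    case (1 a)
    show ?case
      unfolding distrib_right by (rule nn_integral_add) measurable
  qed
  also have "\<dots> = collisions \<psi> k f + collisions \<psi>' k f"
    unfolding collisions_def by (rule nn_integral_add) measurable
  finally show ?thesis .
qed

lemma collisions_swap:
  assumes [measurable]: "kernel k" and f: "density_fun f" and [measurable]: "case_prod \<psi> \<in> borel_measurable (borel \<Otimes>\<^sub>M borel)"
  shows "collisions (\<lambda>a b. \<psi> b a) k f = collisions \<psi> k f"
proof -
  note [measurable] = density_fun_measurable[OF f] f
  have "collisions (\<lambda>a b. \<psi> b a) k f
      = (\<integral>\<^sup>+b. \<integral>\<^sup>+a. \<psi> b a * ennreal (k a b * f a * f b) \<partial>lborel \<partial>lborel)"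
    unfolding collisions_def by (rule lborel_pair.Fubini') measurable
  also have "\<dots> = collisions \<psi> k f"
    unfolding collisions_def using kernel_sym[OF assms(1)]
    by (intro nn_integral_cong) (metis mult.assoc mult.commute)
  finally show ?thesis .
qed

text \<open>The diagonal is a null set and the kernel is symmetric, so the part \<open>a < b\<close>
  can be reflected onto \<open>a > b\<close>. Afterwards \<open>a\<close> is always the larger
  particle.\<close>

lemma collisions_diagonal:
  assumes [measurable]: "kernel k" and f: "density_fun f" and [measurable]: "case_prod \<psi> \<in> borel_measurable (borel \<Otimes>\<^sub>M borel)"
  shows "collisions \<psi> k f
    = collisions (\<lambda>a b. (\<psi> a b + \<psi> b a) * indicator {0<..} (a - b)) k f"
proof -
  note [measurable] = density_fun_measurable[OF f] f
  have "collisions \<psi> k f = collisions (\<lambda>a b. \<psi> a b * indicator {0<..} (a - b) + \<psi> a b * indicator {0<..} (b - a)) k f"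
    unfolding collisions_def
  proof (rule nn_integral_cong, rule nn_integral_cong_AE)
    fix a :: real
    show "AE b in lborel. \<psi> a b * ennreal (k a b * f a * f b)
        = (\<psi> a b * indicator {0<..} (a - b) + \<psi> a b * indicator {0<..} (b - a)) * ennreal (k a b * f a * f b)"
      using AE_lborel_singleton[of a] by eventually_elim (auto simp: indicator_def)
  qed
  also have "\<dots> = collisions (\<lambda>a b. \<psi> a b * indicator {0<..} (a - b)) k f + collisions (\<lambda>a b. \<psi> a b * indicator {0<..} (b - a)) k f"
    by (rule collisions_add) measurable
  also have "collisions (\<lambda>a b. \<psi> a b * indicator {0<..} (b - a)) k f = collisions (\<lambda>a b. \<psi> b a * indicator {0<..} (a - b)) k f"
    by (rule collisions_swap[where \<psi> = "\<lambda>a b. \<psi> b a * indicator {0<..} (a - b)", simplified]) measurable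
  also have "collisions (\<lambda>a b. \<psi> a b * indicator {0<..} (a - b)) k f + \<dots>
     = collisions (\<lambda>a b. \<psi> a b * indicator {0<..} (a - b) + \<psi> b a * indicator {0<..} (a - b)) k f"
    by (rule collisions_add[symmetric]) measurable
  finally show ?thesis by (simp add: distrib_right)
qed

lemma collisions_le:
  assumes f: "density_fun f" and [measurable]: "\<phi> \<in> borel_measurable borel"
    and C: "\<And>a b. 0 < a \<Longrightarrow> 0 < b \<Longrightarrow> k a b \<le> C" "0 \<le> C"
  shows "collisions (\<lambda>a b. \<phi> a) k f \<le> ennreal C * (\<integral>\<^sup>+x. \<phi> x * ennreal (f x) \<partial>lborel) * total f"
proof -
  note [measurable] = density_fun_measurable[OF f] f
  have "collisions (\<lambda>a b. \<phi> a) k f \<le> collisions (\<lambda>a b. \<phi> a) (\<lambda>a b. C) f"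
    using C density_fun_nonneg[OF f] 
    by (intro collisions_mono assms mult_left_mono ennreal_leI mult_right_mono) auto
  also have "\<dots> = (\<integral>\<^sup>+a. \<integral>\<^sup>+b. (ennreal C * \<phi> a * ennreal (f a)) * ennreal (f b) \<partial>lborel \<partial>lborel)"
    unfolding collisions_def using density_fun_nonneg[OF f] C
    by (intro nn_integral_cong) (auto simp: ennreal_mult mult_ac)
  also have "\<dots> = (\<integral>\<^sup>+a. (ennreal C * (\<phi> a * ennreal (f a))) * total f \<partial>lborel)"
    unfolding total_def mult.assoc by (intro nn_integral_cong) (simp add: nn_integral_cmult mult.assoc)
  also have "\<dots> = ennreal C * (\<integral>\<^sup>+x. \<phi> x * ennreal (f x) \<partial>lborel) * total f"
    by (subst nn_integral_multc, measurable, subst nn_integral_cmult, measurable)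
  finally show ?thesis .
qed


section \<open>One step for a bounded kernel\<close>

locale euler_step =
  fixes k :: "real \<Rightarrow> real \<Rightarrow> real" and C \<delta> :: real and f :: "real \<Rightarrow> real"
  assumes k[measurable]: "kernel k" and k_le: "k x y \<le> C"
    and f[measurable]: "density_fun f" and total_f: "total f < \<infinity>" and \<delta>: "0 \<le> \<delta>"
begin

lemma f_measurable[measurable]: "f \<in> borel_measurable borel"
  by (rule density_fun_measurable[OF f])

lemma C_nonneg: "0 \<le> C"
  using k_le[of 0 0] kernel_nonneg[OF k, of 0 0] by simp

lemma loss_rate_eq: "loss_rate k f x = ennreal (f x) * (\<integral>\<^sup>+y. ennreal (k x y * f y) \<partial>lborel)"
  unfolding loss_rate_def
  by (subst nn_integral_cmult[symmetric], measurable)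
     (auto intro!: nn_integral_cong simp: ennreal_mult''[symmetric] kernel_nonneg[OF k] density_fun_nonneg[OF f] mult_ac)

lemma rate_le: "(\<integral>\<^sup>+y. ennreal (k x y * f y) \<partial>lborel) \<le> ennreal C * total f"
  unfolding total_def
  by (subst nn_integral_cmult[symmetric], measurable)
     (auto intro!: nn_integral_mono mult_right_mono simp: ennreal_mult''[symmetric] kernel_nonneg[OF k] density_fun_nonneg[OF f]
        k_le C_nonneg ennreal_leI)

lemma loss_rate_le: "loss_rate k f x \<le> ennreal (f x) * (ennreal C * total f)"
  unfolding loss_rate_eq by (intro mult_left_mono rate_le) simp

lemma loss_rate_finite: "loss_rate k f x < \<infinity>"
  by (rule le_less_trans[OF loss_rate_le]) (use total_f in \<open>simp add: ennreal_mult_less_top\<close>)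

lemma collisions_bound: "collisions (\<lambda>a b. 1) k f \<le> ennreal C * total f * total f"
  using collisions_le[OF f, of "\<lambda>_. 1" k C] k_le C_nonneg by (simp add: total_def)

lemma collisions_finite: "collisions (\<lambda>a b. 1) k f < \<infinity>"
  by (rule le_less_trans[OF collisions_bound]) (use total_f in \<open>simp add: ennreal_mult_less_top\<close>)

lemma gain_total: "(\<integral>\<^sup>+x. gain_rate k f x \<partial>lborel) \<le> collisions (\<lambda>a b. 1) k f"
  using gain_weak[OF k f, of "\<lambda>_. 1"]
  by (auto intro!: collisions_mono[OF _ f] mult_right_mono simp: indicator_def)

lemma gain_rate_finite: "AE x in lborel. gain_rate k f x < \<infinity>"
proof -
  have "(\<integral>\<^sup>+x. gain_rate k f x \<partial>lborel) \<noteq> \<infinity>"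
    using gain_total collisions_finite by (auto simp: top_unique)
  then show ?thesis
    using nn_integral_PInf_AE[of "gain_rate k f" lborel] by (simp add: top.not_eq_extremum)
qed

text \<open>The loss at \<open>x\<close> is proportional to \<open>f x\<close> with factor at most
  \<open>C * total f\<close>; under the smallness condition a step never removes more than is
  present at \<open>x\<close>.\<close>

lemma density_fun_euler:
  assumes small: "\<delta> * C * enn2real (total f) \<le> 1"
  shows "density_fun (euler \<delta> k f)"
proof -
  have "0 \<le> euler \<delta> k f x" for x
  proof -
    have "ennreal (f x) * (ennreal C * total f) = ennreal (f x * (C * enn2real (total f)))"
      using total_f C_nonneg density_fun_nonneg[OF f]
      by (simp add: ennreal_mult less_top)
    then have "enn2real (loss_rate k f x) \<le> f x * (C * enn2real (total f))"
      using loss_rate_le[of x] C_nonneg density_fun_nonneg[OF f]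
      by (intro enn2real_leI) auto
    then have "\<delta> * enn2real (loss_rate k f x) \<le> f x * (\<delta> * C * enn2real (total f))"
      using \<delta> by (metis mult.assoc mult.left_commute mult_left_mono)
    also have "\<dots> \<le> f x * 1"
      using small density_fun_nonneg[OF f] by (intro mult_left_mono) auto
    finally have "\<delta> * enn2real (loss_rate k f x) \<le> f x" by simp
    moreover have "0 \<le> \<delta> * enn2real (gain_rate k f x)" using \<delta> by simp
    ultimately show ?thesis unfolding euler_def by linarith
  qed
  moreover have "euler \<delta> k f x = 0" if "x \<le> 0" for x
    using that density_fun_zero[OF f that] by (simp add: euler_def gain_rate_def loss_rate_def)
  ultimately show ?thesis by (auto simp: density_fun_def)
qed

text \<open>Moving the loss to the left avoids subtraction in \<open>ennreal\<close>. Nonnegativity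
  of the new iterate is what allows the real identity to be read there.\<close>

lemma euler_balance:
  assumes "density_fun (euler \<delta> k f)"
  shows "AE x in lborel. ennreal (euler \<delta> k f x) + ennreal \<delta> * loss_rate k f x
     = ennreal (f x) + ennreal \<delta> * gain_rate k f x"
  using gain_rate_finite
proof eventually_elim
  case (elim x)
  have "ennreal (euler \<delta> k f x) + ennreal \<delta> * ennreal (enn2real (loss_rate k f x))
     = ennreal (f x) + ennreal \<delta> * ennreal (enn2real (gain_rate k f x))"
    using \<delta> density_fun_nonneg[OF assms, of x] density_fun_nonneg[OF f, of x]
    by (simp add: ennreal_mult[symmetric] ennreal_plus[symmetric] euler_def del: ennreal_plus)
  then show ?case using elim loss_rate_finite[of x] by (simp add: less_top)
qed

lemma euler_weak:
  assumes e: "density_fun (euler \<delta> k f)" and [measurable]: "\<phi> \<in> borel_measurable borel"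
  shows "(\<integral>\<^sup>+x. \<phi> x * ennreal (euler \<delta> k f x) \<partial>lborel) + ennreal \<delta> * collisions (\<lambda>a b. \<phi> a) k f
    = (\<integral>\<^sup>+x. \<phi> x * ennreal (f x) \<partial>lborel)
      + ennreal \<delta> * collisions (\<lambda>a b. \<phi> (a - b) * indicator {0<..} (a - b)) k f"
proof -
  have "(\<integral>\<^sup>+x. \<phi> x * ennreal (euler \<delta> k f x) + ennreal \<delta> * (\<phi> x * loss_rate k f x) \<partial>lborel)
     = (\<integral>\<^sup>+x. \<phi> x * ennreal (f x) + ennreal \<delta> * (\<phi> x * gain_rate k f x) \<partial>lborel)"
    using euler_balance[OF e]
    by (intro nn_integral_cong_AE, eventually_elim) (metis distrib_left mult.left_commute)
  then show ?thesis
    by (simp add: nn_integral_add nn_integral_cmult loss_weak[OF k f] gain_weak[OF k f])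
qed

text \<open>The gain \<open>\<phi> (a - b)\<close> is dominated by the loss \<open>\<phi> a\<close>
  of the larger particle, so the loss \<open>\<phi> b\<close> of the smaller one is left
  over.\<close>

lemma euler_monotone:
  assumes e: "density_fun (euler \<delta> k f)" and [measurable]: "\<phi> \<in> borel_measurable borel"
    and mono: "\<And>x y. 0 < x \<Longrightarrow> x \<le> y \<Longrightarrow> \<phi> x \<le> \<phi> y"
    and fin: "(\<integral>\<^sup>+x. \<phi> x * ennreal (f x) \<partial>lborel) < \<infinity>"
  shows "(\<integral>\<^sup>+x. \<phi> x * ennreal (euler \<delta> k f x) \<partial>lborel)
      + ennreal \<delta> * collisions (\<lambda>a b. \<phi> b * indicator {0<..} (a - b)) k f
    \<le> (\<integral>\<^sup>+x. \<phi> x * ennreal (f x) \<partial>lborel)"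
proof -
  let ?P = "\<lambda>g. \<integral>\<^sup>+x. \<phi> x * ennreal (g x) \<partial>lborel"
  let ?A = "collisions (\<lambda>a b. \<phi> a * indicator {0<..} (a - b)) k f"
  let ?B = "collisions (\<lambda>a b. \<phi> b * indicator {0<..} (a - b)) k f"
  have split: "collisions (\<lambda>a b. \<phi> a) k f = ?A + ?B"
    using collisions_diagonal[OF k f, of "\<lambda>a b. \<phi> a"]
    by (simp add: distrib_right collisions_add[OF k f])
  \<comment> \<open>The contribution \<open>?A\<close> of the larger particle occurs on both sides
    and may be cancelled only if it is finite; this is where the bound on the kernel enters.\<close>
  have "collisions (\<lambda>a b. \<phi> a) k f \<le> ennreal C * ?P f * total f"
    by (rule collisions_le[OF f]) (auto simp: k_le C_nonneg)
  also have "\<dots> < \<infinity>" using fin total_f by (simp add: ennreal_mult_less_top)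
  finally have A: "?A < \<infinity>" unfolding split by simp
  have "collisions (\<lambda>a b. \<phi> (a - b) * indicator {0<..} (a - b)) k f \<le> ?A"
    by (rule collisions_mono[OF mult_right_mono f]) (auto simp: indicator_def intro!: mono)
  then have "?P (euler \<delta> k f) + ennreal \<delta> * (?A + ?B) \<le> ?P f + ennreal \<delta> * ?A"
    using euler_weak[OF e, of \<phi>] unfolding split by (simp add: add_left_mono mult_left_mono)
  then have "ennreal \<delta> * ?A + (?P (euler \<delta> k f) + ennreal \<delta> * ?B) \<le> ennreal \<delta> * ?A + ?P f"
    by (simp add: distrib_left ac_simps)
  then show ?thesis
    using A by (subst (asm) ennreal_add_left_cancel_le) (auto simp: ennreal_mult_eq_top_iff)
qed

lemma euler_distance:
  "(\<integral>\<^sup>+x. ennreal \<bar>euler \<delta> k f x - f x\<bar> \<partial>lborel) \<le> ennreal (2 * \<delta>) * collisions (\<lambda>a b. 1) k f"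
proof -
  have "(\<integral>\<^sup>+x. ennreal \<bar>euler \<delta> k f x - f x\<bar> \<partial>lborel)
     \<le> (\<integral>\<^sup>+x. ennreal \<delta> * gain_rate k f x + ennreal \<delta> * loss_rate k f x \<partial>lborel)"
  proof (rule nn_integral_mono_AE, use gain_rate_finite in eventually_elim)
    case (elim x)
    have "ennreal \<bar>euler \<delta> k f x - f x\<bar>
       \<le> ennreal (\<delta> * enn2real (gain_rate k f x) + \<delta> * enn2real (loss_rate k f x))"
    proof (rule ennreal_leI)
      have "0 \<le> \<delta> * enn2real (gain_rate k f x)" "0 \<le> \<delta> * enn2real (loss_rate k f x)"
        using \<delta> by simp_all
      then show "\<bar>euler \<delta> k f x - f x\<bar> \<le> \<delta> * enn2real (gain_rate k f x) + \<delta> * enn2real (loss_rate k f x)"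
        unfolding euler_def by linarith
    qed
    also have "\<dots> = ennreal \<delta> * gain_rate k f x + ennreal \<delta> * loss_rate k f x"
      using \<delta> elim loss_rate_finite[of x] by (simp add: ennreal_mult less_top)
    finally show ?case .
  qed
  also have "\<dots> = ennreal \<delta> * (\<integral>\<^sup>+x. gain_rate k f x \<partial>lborel) + ennreal \<delta> * collisions (\<lambda>a b. 1) k f"
    using loss_weak[OF k f, of "\<lambda>_. 1"] by (simp add: nn_integral_add nn_integral_cmult)
  also have "\<dots> \<le> ennreal \<delta> * collisions (\<lambda>a b. 1) k f + ennreal \<delta> * collisions (\<lambda>a b. 1) k f"
    by (intro add_mono mult_left_mono gain_total) auto
  also have "\<dots> = ennreal (2 * \<delta>) * collisions (\<lambda>a b. 1) k f"
    using \<delta> by (simp only: mult_2 ennreal_plus distrib_right)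
  finally show ?thesis .
qed

text \<open>
  The gain of \<open>\<bar>f (x + h) - f x\<bar>\<close> through \<open>k1\<close> is absorbed exactly by its loss, so that the
  translation modulus grows only through the modulus of continuity of \<open>k1\<close> and through \<open>k - k1\<close>.
\<close>

lemma euler_shift:
  assumes small: "\<delta> * C * enn2real (total f) \<le> 1"
    and k1[measurable]: "kernel k1" and k1_le: "\<And>a b. k1 a b \<le> k a b"
    and h: "0 \<le> h" and mod: "\<And>a b. 0 \<le> a \<Longrightarrow> 0 \<le> b \<Longrightarrow> \<bar>k1 (a + h) b - k1 a b\<bar> \<le> \<epsilon>"
  shows "shift_dist h (euler \<delta> k f) \<le> shift_dist h f
    + ennreal \<delta> * (ennreal (2 * \<epsilon>) * total f * total f + 4 * collisions (\<lambda>a b. 1) (\<lambda>a b. k a b - k1 a b) f)"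
proof -
  note [measurable] = f
  let ?k2 = "\<lambda>a b. k a b - k1 a b" and ?M = "enn2real (total f)"
  have k2[measurable]: "kernel ?k2"
    using k1_le kernel_sym[OF k] kernel_sym[OF k1] by (auto simp: kernel_def)
  interpret k1: euler_step k1 C \<delta> f
    by unfold_locales (auto simp: k1 f \<delta> less_top total_f[unfolded infinity_ennreal_def] intro: order.trans[OF k1_le k_le])
  interpret k2: euler_step ?k2 C \<delta> f
  proof unfold_locales
    show "k x y - k1 x y \<le> C" for x y using k_le[of x y] kernel_nonneg[OF k1, of x y] by simp
  qed (auto simp: k2 f \<delta> total_f[unfolded infinity_ennreal_def])
  have fin: "total f < top" using total_f by simp
  have \<epsilon>: "0 \<le> \<epsilon>" using mod[of 0 0] by simp
  have f0: "0 \<le> f x" for x by (rule density_fun_nonneg[OF f])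
  \<comment> \<open>\<open>w\<close> is the quantity to be propagated. \<open>L1 x\<close> is the
    frequency at which \<open>k1\<close> removes a particle of size \<open>x\<close>,
    \<open>Gw\<close> is the gain operator with \<open>w\<close> in place of the larger particle,
    and \<open>c\<close> collects the error made by moving the kernel argument by
    \<open>h\<close>.\<close>
  define w where "w x = (if 0 < x then \<bar>f (x + h) - f x\<bar> else 0)" for x
  have [measurable]: "w \<in> borel_measurable borel" unfolding w_def by measurable
  have w0: "0 \<le> w x" for x by (simp add: w_def)
  define L1 where "L1 x = (\<integral>\<^sup>+y. ennreal (k1 x y * f y) \<partial>lborel)" for x
  define Gw where "Gw x = (\<integral>\<^sup>+y. ennreal (k1 (x + y) y * w (x + y) * f y) \<partial>lborel)" for x
  define c where "c x = (\<integral>\<^sup>+y. ennreal (f (x + h + y) * f y) \<partial>lborel)" for x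
  have [measurable]: "L1 \<in> borel_measurable borel" "Gw \<in> borel_measurable borel" "c \<in> borel_measurable borel"
    unfolding L1_def Gw_def c_def by measurable
  define g where "g j x = enn2real (gain_rate j f x)" for j x
  define l where "l j x = enn2real (loss_rate j f x)" for j x
  have L1_fin: "L1 x < top" for x
    using k1.rate_le[of x] fin unfolding L1_def by (auto simp: ennreal_mult_less_top intro: le_less_trans)
  have k_split: "ennreal (k a b * f u * f v) = ennreal (k1 a b * f u * f v) + ennreal (?k2 a b * f u * f v)" for a b u v
  proof -
    have "0 \<le> k1 a b * f u * f v" "0 \<le> ?k2 a b * f u * f v"
      by (intro mult_nonneg_nonneg kernel_nonneg[OF k1] kernel_nonneg[OF k2] f0)+
    then show ?thesis
      by (subst ennreal_plus[symmetric]) (simp_all add: left_diff_distrib)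
  qed
  have sum_gain: "gain_rate k f x = gain_rate k1 f x + gain_rate ?k2 f x" for x
  proof -
    have "(\<integral>\<^sup>+y. ennreal (k (x + y) y * f (x + y) * f y) \<partial>lborel)
       = (\<integral>\<^sup>+y. ennreal (k1 (x + y) y * f (x + y) * f y) + ennreal (?k2 (x + y) y * f (x + y) * f y) \<partial>lborel)"
      by (simp only: k_split)
    also have "\<dots> = (\<integral>\<^sup>+y. ennreal (k1 (x + y) y * f (x + y) * f y) \<partial>lborel)
        + (\<integral>\<^sup>+y. ennreal (?k2 (x + y) y * f (x + y) * f y) \<partial>lborel)"
      by (rule nn_integral_add) measurable
    finally show ?thesis unfolding gain_rate_def by (simp add: distrib_left)
  qed
  have sum_loss: "loss_rate k f x = loss_rate k1 f x + loss_rate ?k2 f x" for x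
  proof -
    have "loss_rate k f x
       = (\<integral>\<^sup>+y. ennreal (k1 x y * f x * f y) + ennreal (?k2 x y * f x * f y) \<partial>lborel)"
      unfolding loss_rate_def
      by (simp only: k_split)
    also have "\<dots> = loss_rate k1 f x + loss_rate ?k2 f x"
      unfolding loss_rate_def by (rule nn_integral_add) measurable
    finally show ?thesis .
  qed
  have l_sum: "l k x = l k1 x + l ?k2 x" for x
    unfolding l_def sum_loss using k1.loss_rate_finite[of x] k2.loss_rate_finite[of x] by (simp add: enn2real_plus)
  have l1: "l k1 x = f x * enn2real (L1 x)" for x
    unfolding l_def k1.loss_rate_eq L1_def by (simp add: enn2real_mult f0)
  have L1_le: "L1 x \<le> L1 y + ennreal (\<epsilon> * ?M)" if "\<And>b. 0 \<le> b \<Longrightarrow> \<bar>k1 x b - k1 y b\<bar> \<le> \<epsilon>" for x y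
  proof -
    have "L1 x \<le> (\<integral>\<^sup>+b. ennreal (k1 y b * f b) + ennreal \<epsilon> * ennreal (f b) \<partial>lborel)"
      unfolding L1_def
    proof (rule nn_integral_mono)
      fix b :: real
      have "k1 x b * f b \<le> k1 y b * f b + \<epsilon> * f b"
        using that[of b] density_fun_zero[OF f, of b] f0[of b]
        by (cases "b \<le> 0") (auto simp: distrib_right[symmetric] abs_le_iff intro!: mult_right_mono)
      then show "ennreal (k1 x b * f b) \<le> ennreal (k1 y b * f b) + ennreal \<epsilon> * ennreal (f b)"
        using f0[of b] \<epsilon> kernel_nonneg[OF k1, of y b]
        by (simp add: ennreal_mult[symmetric] ennreal_plus[symmetric] ennreal_leI del: ennreal_plus)
    qed
    also have "\<dots> = L1 y + ennreal \<epsilon> * total f"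
      unfolding L1_def total_def by (simp add: nn_integral_add nn_integral_cmult)
    also have "ennreal \<epsilon> * total f = ennreal (\<epsilon> * ?M)"
      using fin \<epsilon> by (simp add: ennreal_mult)
    finally show ?thesis .
  qed
  have L1_diff: "\<bar>enn2real (L1 (x + h)) - enn2real (L1 x)\<bar> \<le> \<epsilon> * ?M" if "0 < x" for x
  proof -
    have *: "enn2real (L1 u) \<le> enn2real (L1 v) + \<epsilon> * ?M" if "L1 u \<le> L1 v + ennreal (\<epsilon> * ?M)" for u v
    proof -
      have "enn2real (L1 u) \<le> enn2real (L1 v + ennreal (\<epsilon> * ?M))"
        using that L1_fin[of v] by (intro enn2real_mono) auto
      also have "\<dots> = enn2real (L1 v) + \<epsilon> * ?M"
        using L1_fin[of v] \<epsilon> by (simp add: enn2real_plus)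
      finally show ?thesis .
    qed
    show ?thesis
      using *[OF L1_le[of "x + h" x]] *[OF L1_le[of x "x + h"]] mod[of x] \<open>0 < x\<close>
      by (simp add: abs_le_iff abs_minus_commute)
  qed
  \<comment> \<open>Both orders of the points \<open>x\<close> and \<open>x + h\<close> are treated
    at once, so that the two one-sided bounds combine into one for the absolute difference of the
    gains. The kernel next to \<open>w\<close> is taken at \<open>x + y\<close>; the cost of moving
    it falls on \<open>f (x + h + y)\<close>.\<close>
  have G1_le: "ennreal (k1 (x' + y) y * f (x' + y) * f y)
     \<le> ennreal (k1 (x'' + y) y * f (x'' + y) * f y) + ennreal (k1 (x + y) y * w (x + y) * f y)
        + ennreal \<epsilon> * ennreal (f (x + h + y) * f y)"
    if "0 < x" "x' = x + h \<and> x'' = x \<or> x' = x \<and> x'' = x + h" for x x' x'' y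
  proof (cases "y \<le> 0")
    case True
    then show ?thesis using density_fun_zero[OF f, of y] by simp
  next
    case False
    have w: "\<bar>f (x + h + y) - f (x + y)\<bar> = w (x + y)" using \<open>0 < x\<close> False by (simp add: w_def add_ac)
    have kk: "\<bar>k1 (x + h + y) y - k1 (x + y) y\<bar> \<le> \<epsilon>" using mod[of "x + y" y] \<open>0 < x\<close> False by (simp add: add_ac)
    have a: "k1 (x + y) y * f (x + h + y) \<le> k1 (x + y) y * (f (x + y) + w (x + y))"
      using w by (intro mult_left_mono kernel_nonneg[OF k1]) auto
    have b: "k1 (x + y) y * f (x + y) \<le> k1 (x + y) y * (f (x + h + y) + w (x + y))"
      using w by (intro mult_left_mono kernel_nonneg[OF k1]) auto
    have c: "k1 (x + h + y) y * f (x + h + y) \<le> (k1 (x + y) y + \<epsilon>) * f (x + h + y)"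
      using kk by (intro mult_right_mono f0) auto
    have d: "k1 (x + y) y * f (x + h + y) \<le> (k1 (x + h + y) y + \<epsilon>) * f (x + h + y)"
      using kk by (intro mult_right_mono f0) auto
    have "k1 (x' + y) y * f (x' + y) \<le> k1 (x'' + y) y * f (x'' + y) + k1 (x + y) y * w (x + y) + \<epsilon> * f (x + h + y)"
      using a b c d that(2) by (elim disjE) (auto simp: algebra_simps)
    then have "(k1 (x' + y) y * f (x' + y)) * f y
      \<le> (k1 (x'' + y) y * f (x'' + y) + k1 (x + y) y * w (x + y) + \<epsilon> * f (x + h + y)) * f y"
      by (intro mult_right_mono f0)
    then show ?thesis
      using f0 \<epsilon> kernel_nonneg[OF k1] w0
      by (simp add: ennreal_mult[symmetric] ennreal_plus[symmetric] ennreal_leI distrib_right mult.assoc del: ennreal_plus)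
  qed
  have G1: "gain_rate k1 f x' \<le> gain_rate k1 f x'' + (Gw x + ennreal \<epsilon> * c x)"
    if x: "0 < x" "x' = x + h \<and> x'' = x \<or> x' = x \<and> x'' = x + h" for x x' x''
  proof -
    have p: "0 < x'" "0 < x''" using x h by auto
    have "gain_rate k1 f x' \<le> (\<integral>\<^sup>+y. ennreal (k1 (x'' + y) y * f (x'' + y) * f y) + ennreal (k1 (x + y) y * w (x + y) * f y)
        + ennreal \<epsilon> * ennreal (f (x + h + y) * f y) \<partial>lborel)"
      using p unfolding gain_rate_def by (simp add: nn_integral_mono G1_le[OF x])
    also have "\<dots> = gain_rate k1 f x'' + (Gw x + ennreal \<epsilon> * c x)"
      using p unfolding gain_rate_def Gw_def c_def by (simp add: nn_integral_add nn_integral_cmult add.assoc)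
    finally show ?thesis .
  qed
  have gain_shift: "AE x in lborel. gain_rate k f (x + h) < top"
  proof -
    have "(\<integral>\<^sup>+x. gain_rate k f (x + h) \<partial>lborel) = (\<integral>\<^sup>+x. gain_rate k f x \<partial>lborel)"
      by (rule nn_integral_shift) measurable
    also have "\<dots> < \<infinity>" using gain_total collisions_finite by (rule le_less_trans)
    finally have "(\<integral>\<^sup>+x. gain_rate k f (x + h) \<partial>lborel) \<noteq> \<infinity>" by simp
    then show ?thesis
      using nn_integral_PInf_AE[of "\<lambda>x. gain_rate k f (x + h)" lborel] by (simp add: less_top)
  qed
  \<comment> \<open>The damping \<open>w x * L1 x\<close> is kept on the left and not dropped,
    because the gain puts \<open>Gw x\<close> on the right and the two have equal integrals.\<close>
  have point: "AE x in lborel. ennreal (indicator {0<..} x * \<bar>euler \<delta> k f (x + h) - euler \<delta> k f x\<bar>) + ennreal \<delta> * (ennreal (w x) * L1 x)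
    \<le> ennreal (w x) + ennreal \<delta> * (ennreal (\<epsilon> * ?M) * ennreal (f (x + h)) + Gw x + ennreal \<epsilon> * c x
       + (gain_rate ?k2 f (x + h) + gain_rate ?k2 f x + loss_rate ?k2 f (x + h) + loss_rate ?k2 f x))"
    using gain_rate_finite gain_shift
  proof eventually_elim
    case (elim x)
    show ?case
    proof (cases "0 < x")
      case False
      then show ?thesis by (simp add: w_def)
    next
      case True
      have fin_g: "gain_rate k1 f y < top" "gain_rate ?k2 f y < top" if "y = x \<or> y = x + h" for y
        using elim that unfolding sum_gain by auto
      have g_sum: "g k y = g k1 y + g ?k2 y" if "y = x \<or> y = x + h" for y
        unfolding g_def sum_gain using fin_g[OF that] by (simp add: enn2real_plus)
      define B where "B = Gw x + ennreal \<epsilon> * c x"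
      have dG: "ennreal \<bar>g k1 (x + h) - g k1 x\<bar> \<le> B"
      proof (cases "B = top")
        case False
        have *: "g k1 u \<le> g k1 v + enn2real B" if "gain_rate k1 f u \<le> gain_rate k1 f v + B" "v = x \<or> v = x + h" for u v
        proof -
          have "g k1 u \<le> enn2real (gain_rate k1 f v + B)"
            unfolding g_def using that fin_g(1)[OF that(2)] False by (intro enn2real_mono) (auto simp: less_top)
          also have "\<dots> = g k1 v + enn2real B"
            unfolding g_def using fin_g(1)[OF that(2)] False by (simp add: enn2real_plus less_top)
          finally show ?thesis .
        qed
        have "\<bar>g k1 (x + h) - g k1 x\<bar> \<le> enn2real B"
          using *[OF G1[OF True, of "x + h" x, folded B_def]] *[OF G1[OF True, of x "x + h", folded B_def]]
          by (simp add: abs_le_iff)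
        then show ?thesis using False by (metis ennreal_enn2real ennreal_leI less_top)
      qed simp
      define a where "a = f (x + h) - f x - \<delta> * (l k1 (x + h) - l k1 x)"
      define D where "D = g ?k2 (x + h) + g ?k2 x + l ?k2 (x + h) + l ?k2 x"
      have D0: "0 \<le> g ?k2 (x + h)" "0 \<le> g ?k2 x" "0 \<le> l ?k2 (x + h)" "0 \<le> l ?k2 x"
        by (simp_all add: g_def l_def)
      have "euler \<delta> k f (x + h) - euler \<delta> k f x
         = a + \<delta> * (g k1 (x + h) - g k1 x) + \<delta> * (g ?k2 (x + h) - g ?k2 x - l ?k2 (x + h) + l ?k2 x)"
        unfolding euler_def a_def g_def[symmetric] l_def[symmetric] l_sum using g_sum by (simp add: algebra_simps)
      moreover have "\<bar>\<delta> * (g k1 (x + h) - g k1 x)\<bar> = \<delta> * \<bar>g k1 (x + h) - g k1 x\<bar>"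
        using \<delta> by (simp add: abs_mult)
      moreover have "\<bar>\<delta> * (g ?k2 (x + h) - g ?k2 x - l ?k2 (x + h) + l ?k2 x)\<bar> \<le> \<delta> * D"
        unfolding abs_mult D_def using \<delta> D0 by (intro mult_mono) auto
      ultimately have tri: "\<bar>euler \<delta> k f (x + h) - euler \<delta> k f x\<bar> \<le> \<bar>a\<bar> + \<delta> * \<bar>g k1 (x + h) - g k1 x\<bar> + \<delta> * D"
        by linarith
      \<comment> \<open>The smallness condition makes the factor \<open>1 - \<delta> * L1 x\<close>
        in front of \<open>f (x + h) - f x\<close> nonnegative; only then does the loss act as a
        damping of \<open>w\<close>.\<close>
      have L1s: "\<delta> * enn2real (L1 x) \<le> 1"
      proof -
        have "L1 x \<le> ennreal (C * ?M)"
          using k1.rate_le[of x] fin C_nonneg unfolding L1_def by (simp add: ennreal_mult)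
        then have "enn2real (L1 x) \<le> C * ?M" using C_nonneg by (intro enn2real_leI) auto
        then have "\<delta> * enn2real (L1 x) \<le> \<delta> * (C * ?M)" using \<delta> by (rule mult_left_mono)
        then show ?thesis using small by (simp add: mult.assoc)
      qed
      have "a = (f (x + h) - f x) * (1 - \<delta> * enn2real (L1 x)) - \<delta> * (f (x + h) * (enn2real (L1 (x + h)) - enn2real (L1 x)))"
        unfolding a_def l1 by (simp add: algebra_simps)
      moreover have "\<bar>(f (x + h) - f x) * (1 - \<delta> * enn2real (L1 x))\<bar> = w x * (1 - \<delta> * enn2real (L1 x))"
        using L1s True by (simp add: abs_mult w_def)
      moreover have "\<bar>\<delta> * (f (x + h) * (enn2real (L1 (x + h)) - enn2real (L1 x)))\<bar> \<le> \<delta> * (f (x + h) * (\<epsilon> * ?M))"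
        unfolding abs_mult using \<delta> f0[of "x + h"] L1_diff[OF True] by (simp add: mult_left_mono)
      ultimately have "\<bar>a\<bar> + \<delta> * (w x * enn2real (L1 x)) \<le> w x + \<delta> * (f (x + h) * (\<epsilon> * ?M))"
        by (simp add: algebra_simps)
      with tri have r: "\<bar>euler \<delta> k f (x + h) - euler \<delta> k f x\<bar> + \<delta> * (w x * enn2real (L1 x))
          \<le> w x + (\<delta> * ((\<epsilon> * ?M) * f (x + h)) + \<delta> * \<bar>g k1 (x + h) - g k1 x\<bar> + \<delta> * D)"
        by (simp add: algebra_simps)
      have eD: "ennreal D = gain_rate ?k2 f (x + h) + gain_rate ?k2 f x + loss_rate ?k2 f (x + h) + loss_rate ?k2 f x"
        unfolding D_def using D0 fin_g k2.loss_rate_finite by (simp add: g_def l_def less_top)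
      have "ennreal \<bar>euler \<delta> k f (x + h) - euler \<delta> k f x\<bar> + ennreal \<delta> * (ennreal (w x) * L1 x)
         = ennreal (\<bar>euler \<delta> k f (x + h) - euler \<delta> k f x\<bar> + \<delta> * (w x * enn2real (L1 x)))"
        using \<delta> w0[of x] L1_fin[of x] by (simp add: ennreal_mult)
      also have "\<dots> \<le> ennreal (w x + (\<delta> * ((\<epsilon> * ?M) * f (x + h)) + \<delta> * \<bar>g k1 (x + h) - g k1 x\<bar> + \<delta> * D))"
        using r by (rule ennreal_leI)
      also have "\<dots> = ennreal (w x) + ennreal \<delta> * (ennreal (\<epsilon> * ?M) * ennreal (f (x + h)) + ennreal \<bar>g k1 (x + h) - g k1 x\<bar> + ennreal D)"
        using \<delta> w0[of x] \<epsilon> f0[of "x + h"] D0 by (simp add: ennreal_mult[symmetric] ennreal_plus[symmetric] D_def distrib_left del: ennreal_plus)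
      also have "\<dots> \<le> ennreal (w x) + ennreal \<delta> * (ennreal (\<epsilon> * ?M) * ennreal (f (x + h)) + B + ennreal D)"
        by (intro add_mono mult_left_mono dG order.refl) auto
      finally show ?thesis using True unfolding eD B_def by (simp add: add.assoc)
    qed
  qed
  have wL1: "(\<integral>\<^sup>+x. ennreal (w x) * L1 x \<partial>lborel) = (\<integral>\<^sup>+a. \<integral>\<^sup>+b. ennreal (k1 a b * w a * f b) \<partial>lborel \<partial>lborel)"
    unfolding L1_def
    by (subst nn_integral_cmult[symmetric], measurable)
       (auto intro!: nn_integral_cong simp: ennreal_mult'[symmetric] w0 mult_ac)
  \<comment> \<open>\<open>Gw\<close> is not restricted to \<open>x > 0\<close>, so the shear gives
    an equality: over all sizes, what \<open>w\<close> gains is what \<open>w\<close> loses.\<close>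
  have Gw_int: "(\<integral>\<^sup>+x. Gw x \<partial>lborel) = (\<integral>\<^sup>+x. ennreal (w x) * L1 x \<partial>lborel)"
    unfolding wL1 Gw_def by (rule nn_integral_shear[of "\<lambda>a b. ennreal (k1 a b * w a * f b)"]) measurable
  have shift_f: "(\<integral>\<^sup>+x. ennreal (f (x + h)) \<partial>lborel) = total f"
    unfolding total_def by (rule nn_integral_shift) measurable
  have w_int: "(\<integral>\<^sup>+x. ennreal (w x) \<partial>lborel) = shift_dist h f"
    unfolding shift_dist_def by (intro nn_integral_cong) (simp add: w_def)
  have "(\<integral>\<^sup>+x. ennreal (w x) \<partial>lborel) \<le> (\<integral>\<^sup>+x. ennreal (f (x + h)) + ennreal (f x) \<partial>lborel)"
  proof (rule nn_integral_mono)
    fix x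
    have "w x \<le> f (x + h) + f x"
      using f0[of x] f0[of "x + h"] by (auto simp: w_def abs_le_iff)
    then show "ennreal (w x) \<le> ennreal (f (x + h)) + ennreal (f x)"
      using f0 by (simp add: ennreal_plus[symmetric] ennreal_leI del: ennreal_plus)
  qed
  also have "\<dots> = total f + total f"
    using shift_f by (simp add: nn_integral_add total_def)
  finally have w_fin: "(\<integral>\<^sup>+x. ennreal (w x) \<partial>lborel) < top"
    using fin by (auto intro: le_less_trans)
  have "(\<integral>\<^sup>+x. ennreal (w x) * L1 x \<partial>lborel) \<le> (\<integral>\<^sup>+x. ennreal (w x) * (ennreal C * total f) \<partial>lborel)"
    unfolding L1_def by (intro nn_integral_mono mult_left_mono k1.rate_le) auto
  also have "\<dots> = (\<integral>\<^sup>+x. ennreal (w x) \<partial>lborel) * (ennreal C * total f)"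
    by (rule nn_integral_multc) measurable
  also have "\<dots> < top" using w_fin fin by (simp add: ennreal_mult_less_top)
  finally have wL1_fin: "(\<integral>\<^sup>+x. ennreal (w x) * L1 x \<partial>lborel) < top" .
  have c_int: "(\<integral>\<^sup>+x. c x \<partial>lborel) = total f * total f"
  proof -
    have "(\<integral>\<^sup>+x. c x \<partial>lborel) = (\<integral>\<^sup>+x. \<integral>\<^sup>+y. ennreal (f (x + y + h) * f y) \<partial>lborel \<partial>lborel)"
      unfolding c_def by (simp add: add_ac)
    also have "\<dots> = (\<integral>\<^sup>+a. \<integral>\<^sup>+b. ennreal (f (a + h) * f b) \<partial>lborel \<partial>lborel)"
      by (rule nn_integral_shear[of "\<lambda>a b. ennreal (f (a + h) * f b)"]) measurable
    also have "\<dots> = (\<integral>\<^sup>+a. ennreal (f (a + h)) * total f \<partial>lborel)"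
      unfolding total_def
      by (intro nn_integral_cong, subst nn_integral_cmult[symmetric]) (auto simp: ennreal_mult f0)
    also have "\<dots> = total f * total f" by (simp add: nn_integral_multc shift_f)
    finally show ?thesis .
  qed
  have k2_gain: "(\<integral>\<^sup>+x. gain_rate ?k2 f x \<partial>lborel) \<le> collisions (\<lambda>a b. 1) ?k2 f"
    by (rule k2.gain_total)
  have k2_loss: "(\<integral>\<^sup>+x. loss_rate ?k2 f x \<partial>lborel) = collisions (\<lambda>a b. 1) ?k2 f"
    using loss_weak[OF k2 f, of "\<lambda>_. 1"] by simp
  have k2_shift: "(\<integral>\<^sup>+x. gain_rate ?k2 f (x + h) \<partial>lborel) = (\<integral>\<^sup>+x. gain_rate ?k2 f x \<partial>lborel)"
     "(\<integral>\<^sup>+x. loss_rate ?k2 f (x + h) \<partial>lborel) = (\<integral>\<^sup>+x. loss_rate ?k2 f x \<partial>lborel)"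
    by (rule nn_integral_shift, measurable)+
  have [measurable]: "(\<lambda>x. euler \<delta> k f x) \<in> borel_measurable borel" by measurable
  let ?Z = "\<integral>\<^sup>+x. ennreal (w x) * L1 x \<partial>lborel"
  have "shift_dist h (euler \<delta> k f) + ennreal \<delta> * ?Z
     = (\<integral>\<^sup>+x. ennreal (indicator {0<..} x * \<bar>euler \<delta> k f (x + h) - euler \<delta> k f x\<bar>) + ennreal \<delta> * (ennreal (w x) * L1 x) \<partial>lborel)"
    unfolding shift_dist_def by (simp add: nn_integral_add nn_integral_cmult)
  also have "\<dots> \<le> (\<integral>\<^sup>+x. ennreal (w x) + ennreal \<delta> * (ennreal (\<epsilon> * ?M) * ennreal (f (x + h)) + Gw x + ennreal \<epsilon> * c x
       + (gain_rate ?k2 f (x + h) + gain_rate ?k2 f x + loss_rate ?k2 f (x + h) + loss_rate ?k2 f x)) \<partial>lborel)"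
    by (rule nn_integral_mono_AE[OF point])
  also have "\<dots> = shift_dist h f + ennreal \<delta> * (ennreal (\<epsilon> * ?M) * total f + ?Z + ennreal \<epsilon> * (total f * total f)
       + ((\<integral>\<^sup>+x. gain_rate ?k2 f x \<partial>lborel) + (\<integral>\<^sup>+x. gain_rate ?k2 f x \<partial>lborel) + collisions (\<lambda>a b. 1) ?k2 f + collisions (\<lambda>a b. 1) ?k2 f))"
    by (simp add: nn_integral_add nn_integral_cmult w_int shift_f Gw_int c_int k2_shift k2_loss)
  \<comment> \<open>Gain and loss of \<open>k - k1\<close>, each at \<open>x\<close> and at
    \<open>x + h\<close>, account for the four copies.\<close>
  also have "\<dots> \<le> shift_dist h f + ennreal \<delta> * (ennreal (\<epsilon> * ?M) * total f + ?Z + ennreal \<epsilon> * (total f * total f)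
       + (collisions (\<lambda>a b. 1) ?k2 f + collisions (\<lambda>a b. 1) ?k2 f + collisions (\<lambda>a b. 1) ?k2 f + collisions (\<lambda>a b. 1) ?k2 f))"
    by (intro add_mono mult_left_mono k2_gain order.refl) auto
  also have "\<dots> = ennreal \<delta> * ?Z + (shift_dist h f
    + ennreal \<delta> * (ennreal (2 * \<epsilon>) * total f * total f + 4 * collisions (\<lambda>a b. 1) ?k2 f))"
  proof -
    have a: "ennreal (\<epsilon> * ?M) * total f = ennreal \<epsilon> * total f * total f"
      using fin \<epsilon> by (simp add: ennreal_mult)
    have b: "ennreal (2 * \<epsilon>) = ennreal \<epsilon> + ennreal \<epsilon>"
      using \<epsilon> by (simp only: mult_2 ennreal_plus)
    have d: "4 * x = x + x + x + x" for x :: ennreal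
    proof -
      have "(4 :: ennreal) = 1 + 1 + 1 + 1" by simp
      then show ?thesis by (metis distrib_right mult_1)
    qed
    show ?thesis unfolding a b d by (simp add: distrib_left distrib_right ac_simps)
  qed
  \<comment> \<open>\<open>?Z\<close> stands on both sides and is finite, since \<open>w\<close> is
    integrable and the kernel is bounded.\<close>
  finally show ?thesis
    using wL1_fin by (subst (asm) add.commute, subst (asm) ennreal_add_left_cancel_le)
      (auto simp: ennreal_mult_eq_top_iff)
qed

end

section \<open>Compactness in \<open>L\<^sup>1\<close>\<close>

definition L1_dist :: "(real \<Rightarrow> real) \<Rightarrow> (real \<Rightarrow> real) \<Rightarrow> ennreal" where
  "L1_dist f g = (\<integral>\<^sup>+x. ennreal \<bar>f x - g x\<bar> \<partial>lborel)"

lemma L1_dist_commute: "L1_dist f g = L1_dist g f"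
  by (simp add: L1_dist_def abs_minus_commute)

lemma L1_dist_triangle:
  assumes [measurable]: "f \<in> borel_measurable borel" "g \<in> borel_measurable borel" "h \<in> borel_measurable borel"
  shows "L1_dist f h \<le> L1_dist f g + L1_dist g h"
proof -
  have "L1_dist f h \<le> (\<integral>\<^sup>+x. ennreal \<bar>f x - g x\<bar> + ennreal \<bar>g x - h x\<bar> \<partial>lborel)"
    unfolding L1_dist_def
    by (intro nn_integral_mono) (auto simp: ennreal_plus[symmetric] simp del: ennreal_plus intro!: ennreal_leI)
  then show ?thesis by (simp add: L1_dist_def nn_integral_add)
qed

lemma shift_dist_diff:
  assumes [measurable]: "f \<in> borel_measurable borel" "g \<in> borel_measurable borel"
  shows "shift_dist h (\<lambda>x. f x - g x) \<le> shift_dist h f + shift_dist h g"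
proof -
  have "shift_dist h (\<lambda>x. f x - g x)
     \<le> (\<integral>\<^sup>+x. ennreal (indicator {0<..} x * \<bar>f (x + h) - f x\<bar>) + ennreal (indicator {0<..} x * \<bar>g (x + h) - g x\<bar>) \<partial>lborel)"
    unfolding shift_dist_def
    by (intro nn_integral_mono)
       (auto simp: ennreal_plus[symmetric] indicator_def simp del: ennreal_plus intro!: ennreal_leI)
  then show ?thesis by (simp add: shift_dist_def nn_integral_add)
qed

text \<open>Writing \<open>y = x + s\<close> turns the half strip \<open>x \<le> y < x + h\<close>
  into translation moduli integrated over \<open>0 \<le> s < h\<close>; the other half strip is its
  reflection.\<close>

lemma nn_integral_near_diagonal:
  fixes u :: "real \<Rightarrow> real"
  assumes [measurable]: "u \<in> borel_measurable borel" and h: "0 < h"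
    and E: "\<And>s. 0 \<le> s \<Longrightarrow> s \<le> h \<Longrightarrow> shift_dist s u \<le> E"
  shows "(\<integral>\<^sup>+x. \<integral>\<^sup>+y. indicator {0<..} x * indicator {0<..} y * indicator {..<h} \<bar>x - y\<bar> * ennreal \<bar>u x - u y\<bar> \<partial>lborel \<partial>lborel)
    \<le> 2 * (ennreal h * E)"
proof -
  let ?U = "\<lambda>x y. indicator {0<..} x * indicator {0..<h} (y - x) * ennreal \<bar>u y - u x\<bar> :: ennreal"
  let ?I = "\<integral>\<^sup>+x. \<integral>\<^sup>+y. ?U x y \<partial>lborel \<partial>lborel"
  have I: "?I \<le> ennreal h * E"
  proof -
    have "?I = (\<integral>\<^sup>+x. \<integral>\<^sup>+s. ?U x (s + x) \<partial>lborel \<partial>lborel)"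
      by (intro nn_integral_cong nn_integral_shift[symmetric]) measurable
    also have "\<dots> = (\<integral>\<^sup>+s. \<integral>\<^sup>+x. ?U x (s + x) \<partial>lborel \<partial>lborel)"
      by (rule lborel_pair.Fubini') measurable
    also have "\<dots> \<le> (\<integral>\<^sup>+s. E * indicator {0..h} s \<partial>lborel)"
    proof (rule nn_integral_mono)
      fix s :: real
      show "(\<integral>\<^sup>+x. ?U x (s + x) \<partial>lborel) \<le> E * indicator {0..h} s"
      proof (cases "0 \<le> s \<and> s < h")
        case True
        have "(\<integral>\<^sup>+x. ?U x (s + x) \<partial>lborel) = shift_dist s u"
          unfolding shift_dist_def using True by (intro nn_integral_cong) (auto simp: indicator_def add.commute)
        then show ?thesis using E[of s] True by simp
      qed (auto simp: indicator_def)
    qed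
    also have "\<dots> = E * ennreal h"
      by (subst nn_integral_cmult_indicator) (use h in auto)
    finally show ?thesis by (simp add: mult.commute)
  qed
  have "(\<integral>\<^sup>+x. \<integral>\<^sup>+y. indicator {0<..} x * indicator {0<..} y * indicator {..<h} \<bar>x - y\<bar> * ennreal \<bar>u x - u y\<bar> \<partial>lborel \<partial>lborel)
     \<le> (\<integral>\<^sup>+x. \<integral>\<^sup>+y. ?U x y + ?U y x \<partial>lborel \<partial>lborel)"
    by (intro nn_integral_mono) (auto simp: indicator_def abs_minus_commute)
  also have "\<dots> = (\<integral>\<^sup>+x. (\<integral>\<^sup>+y. ?U x y \<partial>lborel) + (\<integral>\<^sup>+y. ?U y x \<partial>lborel) \<partial>lborel)"
    by (intro nn_integral_cong nn_integral_add) measurable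
  also have "\<dots> = ?I + (\<integral>\<^sup>+x. \<integral>\<^sup>+y. ?U y x \<partial>lborel \<partial>lborel)"
    by (rule nn_integral_add) measurable
  also have "(\<integral>\<^sup>+x. \<integral>\<^sup>+y. ?U y x \<partial>lborel \<partial>lborel) = ?I"
    by (rule lborel_pair.Fubini') measurable
  also have "?I + ?I \<le> ennreal h * E + ennreal h * E"
    by (intro add_mono I)
  finally show ?thesis by (simp add: mult_2)
qed

text \<open>Open on the left, so that the cells tile \<open>(0, J * h]\<close> without overlap,
  starting exactly at the origin.\<close>

definition cell :: "real \<Rightarrow> nat \<Rightarrow> real set" where
  "cell h j = {real j * h<..real (Suc j) * h}"

lemma cell_measurable[measurable]: "cell h j \<in> sets borel"
  unfolding cell_def by measurable

lemma cell_measurable': "cell h j \<in> sets lborel"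
  by measurable

lemma cell_sum:
  assumes h: "0 < h"
  shows "(\<Sum>j<J. indicator (cell h j) x :: ennreal) = indicator {0<..real J * h} x"
proof (induction J)
  case 0
  then show ?case by (simp add: indicator_def)
next
  case (Suc J)
  have "0 \<le> real J * h" "real J * h \<le> real (Suc J) * h" using h by (simp_all add: distrib_right)
  then show ?case unfolding sum.lessThan_Suc Suc.IH by (auto simp: indicator_def cell_def)
qed

lemma cell_distance:
  assumes "x \<in> cell h j" "y \<in> cell h j" shows "\<bar>x - y\<bar> < h"
  using assms by (auto simp: cell_def distrib_right abs_less_iff)

text \<open>A Poincare inequality in the integral norm: on each cell \<open>u x\<close> differs from
  the mean by an average of \<open>u x - u y\<close>, and two points of a cell are closer than
  \<open>h\<close>. Finitely many cell integrals and the translation modulus thus control the norm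
  on a bounded interval, a quantitative form of the Kolmogorov-Riesz criterion.\<close>

lemma cell_estimate:
  fixes u :: "real \<Rightarrow> real"
  assumes int: "integrable lborel u" and h: "0 < h"
    and E: "\<And>s. 0 \<le> s \<Longrightarrow> s \<le> h \<Longrightarrow> shift_dist s u \<le> E"
  shows "(\<integral>\<^sup>+x. indicator {0<..real J * h} x * ennreal \<bar>u x\<bar> \<partial>lborel)
    \<le> ennreal (\<Sum>j<J. \<bar>LBINT x:cell h j. u x\<bar>) + 2 * E"
proof -
  have [measurable]: "u \<in> borel_measurable borel" using borel_measurable_integrable[OF int] by simp
  let ?m = "\<lambda>j. LBINT x:cell h j. u x"
  have emeas: "emeasure lborel (cell h j) = ennreal h" for j
    unfolding cell_def using h by (subst emeasure_lborel_Ioc) (auto simp: distrib_right)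
  have meas: "measure lborel (cell h j) = h" for j
    using emeas[of j] h by (simp add: measure_def)
  have point: "indicator (cell h j) x * ennreal \<bar>u x\<bar> \<le> indicator (cell h j) x * (ennreal (\<bar>?m j\<bar> / h)
     + ennreal (1 / h) * (\<integral>\<^sup>+y. indicator (cell h j) y * ennreal \<bar>u x - u y\<bar> \<partial>lborel))" for x j
  proof -
    have iu: "set_integrable lborel (cell h j) u"
      by (rule set_integrable_subset[of _ UNIV]) (use int in \<open>auto simp: set_integrable_def cell_measurable\<close>)
    have ic: "set_integrable lborel (cell h j) (\<lambda>y. u x)"
      unfolding set_integrable_def using emeas[of j] by simp
    have "h * u x = ?m j + (LBINT y:cell h j. u x - u y)"
      using set_integral_diff(2)[OF ic iu] meas[of j] h
      by (simp add: set_lebesgue_integral_def)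
    then have "h * \<bar>u x\<bar> \<le> \<bar>?m j\<bar> + \<bar>LBINT y:cell h j. u x - u y\<bar>"
      using h by (metis abs_mult abs_of_pos abs_triangle_ineq)
    then have "\<bar>u x\<bar> \<le> \<bar>?m j\<bar> / h + (1 / h) * \<bar>LBINT y:cell h j. u x - u y\<bar>"
      using h by (simp add: field_simps)
    then have "ennreal \<bar>u x\<bar> \<le> ennreal (\<bar>?m j\<bar> / h + (1 / h) * \<bar>LBINT y:cell h j. u x - u y\<bar>)"
      by (rule ennreal_leI)
    also have "\<dots> = ennreal (\<bar>?m j\<bar> / h) + ennreal (1 / h) * ennreal \<bar>LBINT y:cell h j. u x - u y\<bar>"
      using h by (simp add: ennreal_mult[symmetric])
    also have "ennreal \<bar>LBINT y:cell h j. u x - u y\<bar> \<le> (\<integral>\<^sup>+y. indicator (cell h j) y * ennreal \<bar>u x - u y\<bar> \<partial>lborel)"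
    proof -
      have "integrable lborel (\<lambda>y. indicator (cell h j) y *\<^sub>R (u x - u y))"
        using set_integral_diff(1)[OF ic iu] by (simp add: set_integrable_def)
      from integral_norm_bound_ennreal[OF this]
      have "ennreal \<bar>LBINT y:cell h j. u x - u y\<bar> \<le> (\<integral>\<^sup>+y. ennreal (norm (indicator (cell h j) y *\<^sub>R (u x - u y))) \<partial>lborel)"
        by (simp add: set_lebesgue_integral_def)
      also have "\<dots> = (\<integral>\<^sup>+y. indicator (cell h j) y * ennreal \<bar>u x - u y\<bar> \<partial>lborel)"
        by (intro nn_integral_cong) (auto simp: indicator_def)
      finally show ?thesis .
    qed
    finally show ?thesis by (auto simp: indicator_def add_left_mono mult_left_mono)
  qed
  have "(\<integral>\<^sup>+x. indicator {0<..real J * h} x * ennreal \<bar>u x\<bar> \<partial>lborel)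
     = (\<integral>\<^sup>+x. (\<Sum>j<J. indicator (cell h j) x * ennreal \<bar>u x\<bar>) \<partial>lborel)"
    by (simp add: cell_sum[OF h, symmetric] sum_distrib_right)
  also have "\<dots> \<le> (\<integral>\<^sup>+x. (\<Sum>j<J. indicator (cell h j) x * (ennreal (\<bar>?m j\<bar> / h)
     + ennreal (1 / h) * (\<integral>\<^sup>+y. indicator (cell h j) y * ennreal \<bar>u x - u y\<bar> \<partial>lborel))) \<partial>lborel)"
    by (intro nn_integral_mono sum_mono point)
  also have "\<dots> = (\<integral>\<^sup>+x. (\<Sum>j<J. ennreal (\<bar>?m j\<bar> / h) * indicator (cell h j) x) + ennreal (1 / h) *
     (\<Sum>j<J. \<integral>\<^sup>+y. indicator (cell h j) x * indicator (cell h j) y * ennreal \<bar>u x - u y\<bar> \<partial>lborel) \<partial>lborel)"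
  proof (intro nn_integral_cong)
    fix x :: real
    have "indicator (cell h j) x * (ennreal (\<bar>?m j\<bar> / h)
        + ennreal (1 / h) * (\<integral>\<^sup>+y. indicator (cell h j) y * ennreal \<bar>u x - u y\<bar> \<partial>lborel))
      = ennreal (\<bar>?m j\<bar> / h) * indicator (cell h j) x + ennreal (1 / h) *
        (\<integral>\<^sup>+y. indicator (cell h j) x * indicator (cell h j) y * ennreal \<bar>u x - u y\<bar> \<partial>lborel)" for j
      by (cases "x \<in> cell h j") simp_all
    then show "(\<Sum>j<J. indicator (cell h j) x * (ennreal (\<bar>?m j\<bar> / h)
        + ennreal (1 / h) * (\<integral>\<^sup>+y. indicator (cell h j) y * ennreal \<bar>u x - u y\<bar> \<partial>lborel)))
      = (\<Sum>j<J. ennreal (\<bar>?m j\<bar> / h) * indicator (cell h j) x) + ennreal (1 / h) *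
        (\<Sum>j<J. \<integral>\<^sup>+y. indicator (cell h j) x * indicator (cell h j) y * ennreal \<bar>u x - u y\<bar> \<partial>lborel)"
      by (simp only: sum.distrib sum_distrib_left)
  qed
  also have "\<dots> = (\<Sum>j<J. ennreal (\<bar>?m j\<bar> / h) * ennreal h) + ennreal (1 / h) *
     (\<integral>\<^sup>+x. (\<Sum>j<J. \<integral>\<^sup>+y. indicator (cell h j) x * indicator (cell h j) y * ennreal \<bar>u x - u y\<bar> \<partial>lborel) \<partial>lborel)"
    by (subst nn_integral_add, measurable, subst nn_integral_sum, measurable, subst nn_integral_cmult, measurable)
       (simp only: nn_integral_cmult_indicator[OF cell_measurable'] emeas)
  also have "(\<Sum>j<J. ennreal (\<bar>?m j\<bar> / h) * ennreal h) = ennreal (\<Sum>j<J. \<bar>?m j\<bar>)"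
    using h by (simp add: ennreal_mult[symmetric] sum_ennreal)
  also have "(\<integral>\<^sup>+x. (\<Sum>j<J. \<integral>\<^sup>+y. indicator (cell h j) x * indicator (cell h j) y * ennreal \<bar>u x - u y\<bar> \<partial>lborel) \<partial>lborel)
     \<le> (\<integral>\<^sup>+x. \<integral>\<^sup>+y. indicator {0<..} x * indicator {0<..} y * indicator {..<h} \<bar>x - y\<bar> * ennreal \<bar>u x - u y\<bar> \<partial>lborel \<partial>lborel)"
  proof (rule nn_integral_mono)
    fix x :: real
    have "(\<Sum>j<J. \<integral>\<^sup>+y. indicator (cell h j) x * indicator (cell h j) y * ennreal \<bar>u x - u y\<bar> \<partial>lborel)
       = (\<integral>\<^sup>+y. (\<Sum>j<J. indicator (cell h j) x * indicator (cell h j) y) * ennreal \<bar>u x - u y\<bar> \<partial>lborel)"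
      unfolding sum_distrib_right by (rule nn_integral_sum[symmetric]) measurable
    also have "\<dots> \<le> (\<integral>\<^sup>+y. indicator {0<..} x * indicator {0<..} y * indicator {..<h} \<bar>x - y\<bar> * ennreal \<bar>u x - u y\<bar> \<partial>lborel)"
    proof (intro nn_integral_mono mult_right_mono)
      fix y :: real
      have "(\<Sum>j<J. indicator (cell h j) x * indicator (cell h j) y :: ennreal)
         \<le> (\<Sum>j<J. indicator (cell h j) x * (indicator {0<..} y * indicator {..<h} \<bar>x - y\<bar>))"
      proof (intro sum_mono)
        fix j
        show "indicator (cell h j) x * indicator (cell h j) y
            \<le> (indicator (cell h j) x * (indicator {0<..} y * indicator {..<h} \<bar>x - y\<bar>) :: ennreal)"
        proof (cases "x \<in> cell h j \<and> y \<in> cell h j")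
          case True
          moreover have "0 < y" using True h by (auto simp: cell_def intro: le_less_trans[of 0 "real j * h"])
          ultimately show ?thesis using cell_distance[of x h j y] by simp
        qed (auto simp: indicator_def)
      qed
      also have "\<dots> \<le> indicator {0<..} x * indicator {0<..} y * indicator {..<h} \<bar>x - y\<bar>"
        unfolding sum_distrib_right[symmetric] cell_sum[OF h] by (auto simp: indicator_def)
      finally show "(\<Sum>j<J. indicator (cell h j) x * indicator (cell h j) y :: ennreal)
         \<le> indicator {0<..} x * indicator {0<..} y * indicator {..<h} \<bar>x - y\<bar>" .
    qed simp
    finally show "(\<Sum>j<J. \<integral>\<^sup>+y. indicator (cell h j) x * indicator (cell h j) y * ennreal \<bar>u x - u y\<bar> \<partial>lborel)
      \<le> (\<integral>\<^sup>+y. indicator {0<..} x * indicator {0<..} y * indicator {..<h} \<bar>x - y\<bar> * ennreal \<bar>u x - u y\<bar> \<partial>lborel)" .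
  qed
  also have "\<dots> \<le> 2 * (ennreal h * E)"
    by (rule nn_integral_near_diagonal[OF _ h E]) auto
  finally have "(\<integral>\<^sup>+x. indicator {0<..real J * h} x * ennreal \<bar>u x\<bar> \<partial>lborel)
     \<le> ennreal (\<Sum>j<J. \<bar>?m j\<bar>) + ennreal (1 / h) * (2 * (ennreal h * E))"
    by (simp add: add_left_mono mult_left_mono)
  \<comment> \<open>The averaging factor \<open>1 / h\<close> cancels the width \<open>h\<close> of
    the diagonal strip, so the bound does not deteriorate when the mesh is refined.\<close>
  also have "ennreal (1 / h) * (2 * (ennreal h * E)) = 2 * E"
  proof -
    have "ennreal (1 / h) * ennreal h = 1" using h by (simp add: ennreal_mult[symmetric])
    then show ?thesis by (metis mult.assoc mult.commute mult_1)
  qed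
  finally show ?thesis .
qed

lemma diagonal_convergent_subsequence:
  fixes c :: "nat \<Rightarrow> nat \<Rightarrow> real"
  assumes bnd: "\<And>i n. \<bar>c i n\<bar> \<le> B"
  obtains \<phi> where "strict_mono \<phi>" "\<And>i. convergent (\<lambda>n. c i (\<phi> n))"
proof -
  interpret subseqs "\<lambda>i s. convergent (\<lambda>n. c i (s n))"
  proof
    fix i and s :: "nat \<Rightarrow> nat" assume "strict_mono s"
    have "bounded (range (\<lambda>n. c i (s n)))"
      by (rule boundedI[of _ B]) (use bnd in auto)
    from bounded_imp_convergent_subsequence[OF this]
    obtain l r where "strict_mono r" "((\<lambda>n. c i (s n)) \<circ> r) \<longlonglongrightarrow> l" by auto
    then show "\<exists>r'. strict_mono r' \<and> convergent (\<lambda>n. c i ((s \<circ> r') n))"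
      by (auto simp: convergent_def o_def)
  qed
  have "convergent (\<lambda>n. c i (diagseq n))" for i
  proof -
    have "convergent (\<lambda>n. c i ((diagseq \<circ> ((+) (Suc i))) n))"
    proof (rule diagseq_holds)
      fix r s :: "nat \<Rightarrow> nat" and n
      assume "strict_mono r" "convergent (\<lambda>m. c n (s m))"
      then show "convergent (\<lambda>m. c n ((s \<circ> r) m))"
        using convergent_subseq_convergent[of "\<lambda>m. c n (s m)" r] by (simp add: o_def)
    qed
    then have "convergent (\<lambda>n. c i (diagseq (n + Suc i)))" by (simp add: add.commute)
    then show ?thesis
      using convergent_ignore_initial_segment[of "\<lambda>n. c i (diagseq n)" "Suc i"] by simp
  qed
  then show ?thesis using that subseq_diagseq by blast
qed

lemma density_fun_integrable:
  assumes f: "density_fun f" and "total f < \<infinity>"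
  shows "integrable lborel f"
  using assms density_fun_nonneg[OF f] density_fun_measurable[OF f]
  unfolding total_def by (intro integrableI_bounded) auto

lemma tail_le_moment:
  assumes f: "density_fun f" and X: "0 < X" and m: "moment f \<le> ennreal m" "0 \<le> m" "m / X \<le> e"
  shows "(\<integral>\<^sup>+x. indicator {X<..} x * ennreal (f x) \<partial>lborel) \<le> ennreal e"
proof -
  note [measurable] = density_fun_measurable[OF f]
  have "(\<integral>\<^sup>+x. indicator {X<..} x * ennreal (f x) \<partial>lborel) \<le> (\<integral>\<^sup>+x. ennreal (1 / X) * ennreal (x * f x) \<partial>lborel)"
  proof (rule nn_integral_mono)
    fix x
    have "f x \<le> 1 / X * (x * f x)" if "X < x"
      using that X density_fun_nonneg[OF f, of x] by (simp add: pos_le_divide_eq mult.commute mult_right_mono)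
    then show "indicator {X<..} x * ennreal (f x) \<le> ennreal (1 / X) * ennreal (x * f x)"
      using X density_fun_nonneg[OF f, of x] by (auto simp: indicator_def ennreal_mult'[symmetric] intro!: ennreal_leI)
  qed
  also have "\<dots> = ennreal (1 / X) * moment f"
    unfolding moment_def by (rule nn_integral_cmult) measurable
  also have "\<dots> \<le> ennreal (1 / X) * ennreal m"
    using m by (intro mult_left_mono) auto
  also have "\<dots> \<le> ennreal e" using X m by (simp add: ennreal_mult[symmetric] ennreal_leI)
  finally show ?thesis .
qed

text \<open>Summable distances make the series of increments absolutely convergent at almost every
  point, and its partial sums telescope.\<close>

lemma L1_AE_convergent:
  fixes G :: "nat \<Rightarrow> real \<Rightarrow> real"
  assumes [measurable]: "\<And>n. G n \<in> borel_measurable borel"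
    and fast: "\<And>n. N \<le> n \<Longrightarrow> L1_dist (G n) (G (Suc n)) \<le> ennreal ((1 / 2) ^ n)"
  shows "AE x in lborel. convergent (\<lambda>n. G n x)"
proof -
  have "(\<integral>\<^sup>+x. (\<Sum>i. ennreal \<bar>G (i + N) x - G (Suc (i + N)) x\<bar>) \<partial>lborel)
     = (\<Sum>i. L1_dist (G (i + N)) (G (Suc (i + N))))"
    unfolding L1_dist_def by (rule nn_integral_suminf) measurable
  also have "\<dots> \<le> (\<Sum>i. ennreal ((1 / 2) ^ i))"
  proof (intro suminf_le summableI)
    fix i
    show "L1_dist (G (i + N)) (G (Suc (i + N))) \<le> ennreal ((1 / 2) ^ i)"
      using fast[of "i + N"] by (rule order.trans) (auto intro!: ennreal_leI power_decreasing)
  qed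
  also have "\<dots> = ennreal (\<Sum>i. (1 / 2) ^ i)"
    by (rule suminf_ennreal2) (auto intro: summable_geometric)
  also have "\<dots> < \<infinity>" by simp
  finally have "AE x in lborel. (\<Sum>i. ennreal \<bar>G (i + N) x - G (Suc (i + N)) x\<bar>) \<noteq> \<infinity>"
    by (intro nn_integral_PInf_AE) auto
  then show ?thesis
  proof eventually_elim
    case (elim x)
    have "summable (\<lambda>i. \<bar>G (i + N) x - G (Suc (i + N)) x\<bar>)"
      using elim by (intro summable_suminf_not_top) auto
    then have "summable (\<lambda>i. G (i + N) x - G (Suc (i + N)) x)"
      by (rule summable_rabs_cancel)
    then have "convergent (\<lambda>m. \<Sum>i<m. G (i + N) x - G (Suc (i + N)) x)"
      by (simp add: summable_iff_convergent)
    moreover have "(\<Sum>i<m. G (i + N) x - G (Suc (i + N)) x) = G N x - G (m + N) x" for m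
      by (induction m) auto
    ultimately have "convergent (\<lambda>m. G N x - G (m + N) x)" by simp
    from convergent_diff[OF convergent_const[of "G N x"] this] show ?case
      using convergent_ignore_initial_segment[of "\<lambda>n. G n x" N] by simp
  qed
qed

text \<open>Both equicontinuity conditions are asked only from some index on: a piecewise constant
  approximant jumps in time, with jumps below a given accuracy only for late indices, and the kernel
  at level \<open>R\<close> is compared with the \<open>n\<close>-th one only for
  \<open>n \<ge> R\<close>.\<close>

locale compact_family =
  fixes F :: "nat \<Rightarrow> real \<Rightarrow> real \<Rightarrow> real" and M M1 :: real
  assumes F_meas[measurable]: "\<And>n. case_prod (F n) \<in> borel_measurable (borel \<Otimes>\<^sub>M borel)"
    and F_density: "\<And>n t. density_fun (F n t)"
    and F_total: "\<And>n t. total (F n t) \<le> ennreal M" and M: "0 \<le> M"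
    and F_moment: "\<And>n t. moment (F n t) \<le> ennreal M1" and M1: "0 \<le> M1"
    and F_shift: "\<And>T \<epsilon>. 0 < \<epsilon> \<Longrightarrow> \<exists>h0>0. \<exists>N. \<forall>n\<ge>N. \<forall>t\<in>{0..T}. \<forall>h\<in>{0..h0}. shift_dist h (F n t) \<le> ennreal \<epsilon>"
    and F_time: "\<And>T \<epsilon>. 0 < \<epsilon> \<Longrightarrow> \<exists>\<eta>>0. \<exists>N. \<forall>n\<ge>N. \<forall>s\<in>{0..T}. \<forall>t\<in>{0..T}. \<bar>s - t\<bar> \<le> \<eta> \<longrightarrow> L1_dist (F n s) (F n t) \<le> ennreal \<epsilon>"
begin

lemma F_measurable[measurable]: "F n t \<in> borel_measurable borel"
  by (rule density_fun_measurable[OF F_density])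

lemma F_integrable: "integrable lborel (F n t)"
  by (rule density_fun_integrable[OF F_density]) (rule le_less_trans[OF F_total], simp)

lemma F_set_integrable: "A \<in> sets borel \<Longrightarrow> set_integrable lborel A (F n t)"
  unfolding set_integrable_def by (intro integrable_mult_indicator F_integrable) simp

lemma F_integral_bound: "A \<in> sets borel \<Longrightarrow> \<bar>LBINT x:A. F n t x\<bar> \<le> M"
proof -
  assume A[measurable]: "A \<in> sets borel"
  have "ennreal \<bar>LBINT x:A. F n t x\<bar> \<le> (\<integral>\<^sup>+x. ennreal (norm (indicator A x *\<^sub>R F n t x)) \<partial>lborel)"
    unfolding set_lebesgue_integral_def real_norm_def[symmetric]
    by (rule integral_norm_bound_ennreal[OF F_set_integrable[OF A, unfolded set_integrable_def]])
  also have "\<dots> \<le> total (F n t)"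
    unfolding total_def using density_fun_nonneg[OF F_density]
    by (intro nn_integral_mono ennreal_leI) (auto simp: indicator_def)
  also have "\<dots> \<le> ennreal M" by (rule F_total)
  finally show ?thesis using M by simp
qed

text \<open>The index \<open>i\<close> enumerates the rational times \<open>p / (q + 1)\<close>, the mesh sizes \<open>1 / (k + 1)\<close> and the cells \<open>j\<close>.\<close>

definition cell_mass :: "nat \<Rightarrow> nat \<Rightarrow> real" where
  "cell_mass i n = (case from_nat i :: nat \<times> nat \<times> nat \<times> nat of (p, q, k, j) \<Rightarrow>
     LBINT x:cell (1 / real (Suc k)) j. F n (real p / real (Suc q)) x)"

text \<open>Convergent cell masses let \<open>cell_estimate\<close> compare two densities at the
  finitely many grid times; equicontinuity in time transfers the comparison to all of
  \<open>[0, T]\<close>.\<close>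

lemma uniform_cauchy:
  assumes \<phi>: "strict_mono \<phi>" and conv: "\<And>i. convergent (\<lambda>n. cell_mass i (\<phi> n))"
    and \<epsilon>: "0 < \<epsilon>"
  shows "\<exists>N. \<forall>m\<ge>N. \<forall>n\<ge>N. \<forall>t\<in>{0..T}. L1_dist (F (\<phi> m) t) (F (\<phi> n) t) \<le> ennreal \<epsilon>"
proof -
  \<comment> \<open>At a grid time the budget is one \<open>e\<close> for the cell masses, four for
    twice the translation modulus of a difference, and two for the tails. Passing from an arbitrary
    time to the grid and back costs two more.\<close>
  define e where "e = \<epsilon> / 9"
  have e: "0 < e" using \<epsilon> by (simp add: e_def)
  obtain h0 N1 where h0: "0 < h0" and N1: "\<And>n t h. n \<ge> N1 \<Longrightarrow> t \<in> {0..T} \<Longrightarrow> h \<in> {0..h0} \<Longrightarrow> shift_dist h (F n t) \<le> ennreal e"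
    using F_shift[OF e, of T] by metis
  obtain \<eta> N2 where \<eta>: "0 < \<eta>" and N2: "\<And>n s t. n \<ge> N2 \<Longrightarrow> s \<in> {0..T} \<Longrightarrow> t \<in> {0..T} \<Longrightarrow> \<bar>s - t\<bar> \<le> \<eta> \<Longrightarrow> L1_dist (F n s) (F n t) \<le> ennreal e"
    using F_time[OF e, of T] by metis
  obtain k where k: "1 / real (Suc k) < h0" using h0 nat_approx_posE by blast
  define h where "h = 1 / real (Suc k)"
  have h: "0 < h" "h \<le> h0" using k by (auto simp: h_def)
  obtain q where q: "1 / real (Suc q) < \<eta>" using \<eta> nat_approx_posE by blast
  \<comment> \<open>By Markov's inequality the mass beyond \<open>X = J0 * h\<close> is then at most
    \<open>e\<close>; the maximum with 1 permits division by \<open>J0\<close>.\<close>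
  obtain J0 :: nat where "max 1 (M1 / (h * e)) \<le> real J0" using real_arch_simple by blast
  then have J0: "1 \<le> J0" "M1 \<le> e * (real J0 * h)"
    using h e by (auto simp: pos_divide_le_eq mult_ac)
  define X where "X = real J0 * h"
  have X: "0 < X" "M1 / X \<le> e" using J0 h by (auto simp: X_def pos_divide_le_eq)
  obtain P :: nat where P: "T * real (Suc q) < real P" using reals_Archimedean2 by blast
  have ev: "\<exists>N. \<forall>m\<ge>N. \<forall>n\<ge>N. \<bar>cell_mass i (\<phi> m) - cell_mass i (\<phi> n)\<bar> < e / real J0" for i
    using convergent_Cauchy[OF conv[of i]] e J0 unfolding Cauchy_def dist_real_def by simp
  obtain N0 where N0: "\<And>i m n. m \<ge> N0 i \<Longrightarrow> n \<ge> N0 i \<Longrightarrow> \<bar>cell_mass i (\<phi> m) - cell_mass i (\<phi> n)\<bar> < e / real J0"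
    using ev by metis
  define I where "I = (\<lambda>(p, j). to_nat (p, q, k, j)) ` ({..<P} \<times> {..<J0})"
  have "finite I" by (simp add: I_def)
  define N where "N = Max (insert N1 (insert N2 (N0 ` I)))"
  have N: "N1 \<le> N" "N2 \<le> N" "\<And>i. i \<in> I \<Longrightarrow> N0 i \<le> N"
    unfolding N_def using \<open>finite I\<close> by (intro Max_ge; simp)+
  have tail: "(\<integral>\<^sup>+x. indicator {X<..} x * ennreal (F n t x) \<partial>lborel) \<le> ennreal e" for n t
    by (rule tail_le_moment[OF F_density X(1) F_moment M1 X(2)])
  have grid: "L1_dist (F (\<phi> m) s) (F (\<phi> n) s) \<le> ennreal (7 * e)"
    if mn: "m \<ge> N" "n \<ge> N" and s: "s = real p / real (Suc q)" "p < P" "s \<le> T" for m n p s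
  proof -
    let ?f = "F (\<phi> m) s" and ?g = "F (\<phi> n) s"
    let ?u = "\<lambda>x. ?f x - ?g x"
    have ge: "N \<le> \<phi> m" "N \<le> \<phi> n" using mn seq_suble[OF \<phi>] by (auto intro: order.trans)
    have s': "s \<in> {0..T}" using s by simp
    have sh: "shift_dist r ?u \<le> ennreal (2 * e)" if "0 \<le> r" "r \<le> h" for r
    proof -
      have "shift_dist r ?u \<le> shift_dist r ?f + shift_dist r ?g"
        by (rule shift_dist_diff) measurable
      also have "\<dots> \<le> ennreal e + ennreal e"
        using that h ge N s' by (intro add_mono N1) auto
      finally show ?thesis using e by (simp only: mult_2 ennreal_plus)
    qed
    have cells: "(\<Sum>j<J0. \<bar>LBINT x:cell h j. ?u x\<bar>) \<le> e"
    proof -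
      have "\<bar>LBINT x:cell h j. ?u x\<bar> \<le> e / real J0" if "j < J0" for j
      proof -
        have "to_nat (p, q, k, j) \<in> I" using that s unfolding I_def by force
        then have "N0 (to_nat (p, q, k, j)) \<le> N" by (rule N)
        then have "\<bar>cell_mass (to_nat (p, q, k, j)) (\<phi> m) - cell_mass (to_nat (p, q, k, j)) (\<phi> n)\<bar> < e / real J0"
          using mn by (intro N0) auto
        moreover have "(LBINT x:cell h j. ?u x) = (LBINT x:cell h j. ?f x) - (LBINT x:cell h j. ?g x)"
          by (intro set_integral_diff F_set_integrable cell_measurable)
        ultimately show ?thesis
          by (simp add: cell_mass_def s(1) h_def)
      qed
      then have "(\<Sum>j<J0. \<bar>LBINT x:cell h j. ?u x\<bar>) \<le> (\<Sum>j<J0. e / real J0)" by (intro sum_mono) auto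
      also have "\<dots> = e" using J0 by simp
      finally show ?thesis .
    qed
    have "L1_dist ?f ?g \<le> (\<integral>\<^sup>+x. indicator {0<..X} x * ennreal \<bar>?u x\<bar>
        + (indicator {X<..} x * ennreal (?f x) + indicator {X<..} x * ennreal (?g x)) \<partial>lborel)"
      unfolding L1_dist_def
    proof (rule nn_integral_mono)
      fix x
      show "ennreal \<bar>?u x\<bar> \<le> indicator {0<..X} x * ennreal \<bar>?u x\<bar>
        + (indicator {X<..} x * ennreal (?f x) + indicator {X<..} x * ennreal (?g x))"
      proof (cases "X < x")
        case True
        have "ennreal \<bar>?u x\<bar> \<le> ennreal (?f x + ?g x)"
          using density_fun_nonneg[OF F_density, of "\<phi> m" s x] density_fun_nonneg[OF F_density, of "\<phi> n" s x]
          by (intro ennreal_leI) auto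
        then show ?thesis using True density_fun_nonneg[OF F_density] by simp
      next
        case False
        then show ?thesis
          using density_fun_zero[OF F_density, of x] by (cases "0 < x") auto
      qed
    qed
    also have "\<dots> = (\<integral>\<^sup>+x. indicator {0<..X} x * ennreal \<bar>?u x\<bar> \<partial>lborel)
        + ((\<integral>\<^sup>+x. indicator {X<..} x * ennreal (?f x) \<partial>lborel) + (\<integral>\<^sup>+x. indicator {X<..} x * ennreal (?g x) \<partial>lborel))"
      by (simp add: nn_integral_add)
    also have "\<dots> \<le> (ennreal e + 2 * ennreal (2 * e)) + (ennreal e + ennreal e)"
    proof (intro add_mono tail)
      have "(\<integral>\<^sup>+x. indicator {0<..X} x * ennreal \<bar>?u x\<bar> \<partial>lborel)
          \<le> ennreal (\<Sum>j<J0. \<bar>LBINT x:cell h j. ?u x\<bar>) + 2 * ennreal (2 * e)"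
        unfolding X_def by (rule cell_estimate[OF _ h(1) sh]) (auto intro: F_integrable)
      also have "\<dots> \<le> ennreal e + 2 * ennreal (2 * e)"
        using cells by (intro add_mono ennreal_leI) auto
      finally show "(\<integral>\<^sup>+x. indicator {0<..X} x * ennreal \<bar>?u x\<bar> \<partial>lborel) \<le> ennreal e + 2 * ennreal (2 * e)" .
    qed
    also have "\<dots> = ennreal (7 * e)"
      using e by (simp add: ennreal_plus[symmetric] ennreal_mult'[symmetric] ennreal_numeral[symmetric] del: ennreal_plus ennreal_numeral)
    finally show ?thesis .
  qed
  have "L1_dist (F (\<phi> m) t) (F (\<phi> n) t) \<le> ennreal \<epsilon>"
    if mn: "m \<ge> N" "n \<ge> N" and t: "t \<in> {0..T}" for m n t
  proof -
    have ge: "N \<le> \<phi> m" "N \<le> \<phi> n" using mn seq_suble[OF \<phi>] by (auto intro: order.trans)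
    \<comment> \<open>Rounding down keeps the grid time inside \<open>[0, T]\<close> and its
      numerator below \<open>P\<close>, hence the relevant indices in the finite set
      \<open>I\<close>.\<close>
    define p where "p = nat \<lfloor>t * real (Suc q)\<rfloor>"
    define s where "s = real p / real (Suc q)"
    have tq: "0 \<le> t * real (Suc q)" using t by simp
    then have p: "real p \<le> t * real (Suc q)" "t * real (Suc q) < real p + 1"
      unfolding p_def by (auto simp: of_nat_nat)
    have st: "s \<le> t" "t - s \<le> 1 / real (Suc q)"
    proof -
      show "s \<le> t" unfolding s_def using p(1) by (subst pos_divide_le_eq) auto
      have "t \<le> (real p + 1) / real (Suc q)" using p(2) by (subst pos_le_divide_eq) auto
      then show "t - s \<le> 1 / real (Suc q)" by (simp add: s_def add_divide_distrib)
    qed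
    have "t * real (Suc q) \<le> T * real (Suc q)" using t by (intro mult_right_mono) auto
    then have "p < P" using p P by linarith
    have s0: "s \<in> {0..T}" using st t by (auto simp: s_def)
    have near: "\<bar>t - s\<bar> \<le> \<eta>" "\<bar>s - t\<bar> \<le> \<eta>" using st q by auto
    have "L1_dist (F (\<phi> m) t) (F (\<phi> n) t)
       \<le> L1_dist (F (\<phi> m) t) (F (\<phi> m) s) + (L1_dist (F (\<phi> m) s) (F (\<phi> n) s) + L1_dist (F (\<phi> n) s) (F (\<phi> n) t))"
      by (rule order.trans[OF L1_dist_triangle[where g = "F (\<phi> m) s"] add_left_mono[OF L1_dist_triangle]]) measurable
    also have "\<dots> \<le> ennreal e + (ennreal (7 * e) + ennreal e)"
      using ge N t s0 near \<open>p < P\<close> s_def mn st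
      by (intro add_mono N2 grid[of _ _ _ p]) auto
    also have "\<dots> = ennreal \<epsilon>"
      using e by (simp add: ennreal_plus[symmetric] e_def del: ennreal_plus)
    finally show ?thesis .
  qed
  then show ?thesis by blast
qed

text \<open>Uniform Cauchy estimates on every \<open>[0, n]\<close> let one subsequence serve all
  times, so the limit exists at every \<open>t \<ge> 0\<close> and not just at almost every one; the
  geometric rate yields pointwise convergence as well.\<close>

theorem convergent_subsequence:
  obtains \<phi> f where "strict_mono \<phi>" "case_prod f \<in> borel_measurable (borel \<Otimes>\<^sub>M borel)"
    "\<And>t. density_fun (f t)"
    "\<And>n t. 0 \<le> t \<Longrightarrow> t \<le> real n \<Longrightarrow> L1_dist (F (\<phi> n) t) (f t) \<le> ennreal ((1 / 2) ^ n)"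
    "\<And>t. 0 \<le> t \<Longrightarrow> AE x in lborel. (\<lambda>n. F (\<phi> n) t x) \<longlonglongrightarrow> f t x"
proof -
  have "\<bar>cell_mass i n\<bar> \<le> M" for i n
    unfolding cell_mass_def by (auto split: prod.split intro!: F_integral_bound)
  then obtain \<phi> where \<phi>: "strict_mono \<phi>" "\<And>i. convergent (\<lambda>n. cell_mass i (\<phi> n))"
    using diagonal_convergent_subsequence by blast
  have "\<forall>n::nat. \<exists>N. \<forall>m\<ge>N. \<forall>m'\<ge>N. \<forall>t\<in>{0..real n}. L1_dist (F (\<phi> m) t) (F (\<phi> m') t) \<le> ennreal ((1 / 2) ^ n)"
    by (intro allI uniform_cauchy \<phi>) auto
  then obtain N where N: "\<And>n m m' t. m \<ge> N n \<Longrightarrow> m' \<ge> N n \<Longrightarrow> t \<in> {0..real n}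
      \<Longrightarrow> L1_dist (F (\<phi> m) t) (F (\<phi> m') t) \<le> ennreal ((1 / 2) ^ n)"
    by metis
  \<comment> \<open>The sum of all thresholds up to \<open>n\<close> keeps every later index beyond
    \<open>N n\<close>; the summand \<open>n\<close> makes the sequence strictly increasing.\<close>
  define \<psi> where "\<psi> n = n + (\<Sum>i\<le>n. N i)" for n
  have \<psi>: "strict_mono \<psi>" by (rule strict_monoI_Suc) (simp add: \<psi>_def)
  have \<psi>_ge: "N n \<le> \<psi> m" if "n \<le> m" for n m
  proof -
    have "N n \<le> (\<Sum>i\<le>m. N i)" using that by (intro member_le_sum) auto
    then show ?thesis by (simp add: \<psi>_def)
  qed
  define G where "G n = F (\<phi> (\<psi> n))" for n
  have [measurable]: "case_prod (G n) \<in> borel_measurable (borel \<Otimes>\<^sub>M borel)" for n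
    by (simp add: G_def F_meas)
  have [measurable]: "G n t \<in> borel_measurable borel" for n t by (simp add: G_def)
  have G_dist: "L1_dist (G n t) (G m t) \<le> ennreal ((1 / 2) ^ n)" if "0 \<le> t" "t \<le> real n" "n \<le> m" for n m t
    unfolding G_def using that by (intro N \<psi>_ge) auto
  \<comment> \<open>\<open>lim\<close> is arbitrary where the sequence diverges. The maximum with 0
    and the restriction to \<open>x > 0\<close> make \<open>f t\<close> a density at every point,
    and the pointwise formula keeps it jointly measurable.\<close>
  define f where "f t x = (if 0 < x then max 0 (lim (\<lambda>n. G n t x)) else 0)" for t x
  have f_meas[measurable]: "case_prod f \<in> borel_measurable (borel \<Otimes>\<^sub>M borel)"
    unfolding f_def by measurable
  have f_density: "density_fun (f t)" for t
  proof -
    have "f t \<in> borel_measurable borel" unfolding f_def by measurable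
    then show ?thesis by (auto simp: density_fun_def f_def)
  qed
  have AE: "AE x in lborel. (\<lambda>n. G n t x) \<longlonglongrightarrow> f t x" if t: "0 \<le> t" for t
  proof -
    have "AE x in lborel. convergent (\<lambda>n. G n t x)"
      by (rule L1_AE_convergent[where N = "nat \<lceil>t\<rceil>"]) (use t in \<open>auto intro!: G_dist simp: nat_ceiling_le_eq\<close>)
    then show ?thesis
    proof eventually_elim
      case (elim x)
      then have l: "(\<lambda>n. G n t x) \<longlonglongrightarrow> lim (\<lambda>n. G n t x)" by (simp add: convergent_LIMSEQ_iff)
      have nn: "0 \<le> G n t x" for n unfolding G_def by (rule density_fun_nonneg[OF F_density])
      show ?case
      proof (cases "0 < x")
        case True
        then show ?thesis using l LIMSEQ_le_const[OF l, of 0] nn by (simp add: f_def max_def)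
      next
        case False
        then have "G n t x = 0" for n unfolding G_def by (intro density_fun_zero[OF F_density]) simp
        then show ?thesis using False by (simp add: f_def)
      qed
    qed
  qed
  have dist: "L1_dist (G n t) (f t) \<le> ennreal ((1 / 2) ^ n)" if t: "0 \<le> t" "t \<le> real n" for n t
  proof -
    have [measurable]: "f t \<in> borel_measurable borel" by (rule density_fun_measurable[OF f_density])
    have "L1_dist (G n t) (f t) = (\<integral>\<^sup>+x. liminf (\<lambda>m. ennreal \<bar>G n t x - G m t x\<bar>) \<partial>lborel)"
      unfolding L1_dist_def
    proof (rule nn_integral_cong_AE, use AE[OF t(1)] in eventually_elim)
      case (elim x)
      have "(\<lambda>m. ennreal \<bar>G n t x - G m t x\<bar>) \<longlonglongrightarrow> ennreal \<bar>G n t x - f t x\<bar>"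
        by (intro tendsto_ennrealI tendsto_intros elim)
      then show ?case by (intro lim_imp_Liminf[symmetric]) auto
    qed
    also have "\<dots> \<le> liminf (\<lambda>m. L1_dist (G n t) (G m t))"
      unfolding L1_dist_def by (rule nn_integral_liminf) measurable
    also have "\<dots> \<le> liminf (\<lambda>m. ennreal ((1 / 2) ^ n))"
      by (rule Liminf_mono, use eventually_ge_at_top[of n] in eventually_elim) (rule G_dist[OF t])
    also have "\<dots> = ennreal ((1 / 2) ^ n)" by (simp add: Liminf_const)
    finally show ?thesis .
  qed
  show ?thesis
    by (rule that[of "\<phi> \<circ> \<psi>" f])
       (use \<phi> \<psi> f_meas f_density dist AE in \<open>auto simp: G_def intro: strict_mono_o\<close>)
qed

end

section \<open>Continuity of translations in \<open>L\<^sup>1\<close>\<close>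

definition shift_continuous :: "(real \<Rightarrow> real) \<Rightarrow> bool" where
  "shift_continuous u \<longleftrightarrow>
    (\<forall>\<epsilon>>0. \<exists>d>0. \<forall>h. \<bar>h\<bar> \<le> d \<longrightarrow> L1_dist (\<lambda>x. u (x + h)) u \<le> ennreal \<epsilon>)"

lemma shift_continuousD:
  assumes "shift_continuous u" "0 < \<epsilon>"
  obtains d where "0 < d" "\<And>h. \<bar>h\<bar> \<le> d \<Longrightarrow> L1_dist (\<lambda>x. u (x + h)) u \<le> ennreal \<epsilon>"
  using assms unfolding shift_continuous_def by blast

text \<open>Translations preserve the distance, so \<open>u\<close> may be exchanged for its
  approximant both before and after the shift.\<close>

lemma shift_continuous_approx:
  assumes [measurable]: "u \<in> borel_measurable borel"
    and approx: "\<And>\<epsilon>. 0 < \<epsilon> \<Longrightarrow> \<exists>v. v \<in> borel_measurable borel \<and> shift_continuous v \<and> L1_dist u v \<le> ennreal \<epsilon>"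
  shows "shift_continuous u"
  unfolding shift_continuous_def
proof (intro allI impI)
  fix \<epsilon> :: real assume \<epsilon>: "0 < \<epsilon>"
  then obtain v where [measurable]: "v \<in> borel_measurable borel" and v: "shift_continuous v"
    and uv: "L1_dist u v \<le> ennreal (\<epsilon> / 3)"
    using approx[of "\<epsilon> / 3"] by auto
  obtain d where d: "0 < d" "\<And>h. \<bar>h\<bar> \<le> d \<Longrightarrow> L1_dist (\<lambda>x. v (x + h)) v \<le> ennreal (\<epsilon> / 3)"
    using shift_continuousD[OF v, of "\<epsilon> / 3"] \<epsilon> by auto
  show "\<exists>d>0. \<forall>h. \<bar>h\<bar> \<le> d \<longrightarrow> L1_dist (\<lambda>x. u (x + h)) u \<le> ennreal \<epsilon>"
  proof (intro exI[of _ d] conjI allI impI d(1))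
    fix h assume h: "\<bar>h\<bar> \<le> d"
    have "L1_dist (\<lambda>x. u (x + h)) u
      \<le> L1_dist (\<lambda>x. u (x + h)) (\<lambda>x. v (x + h)) + (L1_dist (\<lambda>x. v (x + h)) v + L1_dist v u)"
      by (rule order.trans[OF L1_dist_triangle[where g = "\<lambda>x. v (x + h)"] add_left_mono[OF L1_dist_triangle]]) measurable
    also have "L1_dist (\<lambda>x. u (x + h)) (\<lambda>x. v (x + h)) = L1_dist u v"
      unfolding L1_dist_def by (rule nn_integral_shift[of "\<lambda>x. ennreal \<bar>u x - v x\<bar>"]) measurable
    also have "L1_dist u v + (L1_dist (\<lambda>x. v (x + h)) v + L1_dist v u)
       \<le> ennreal (\<epsilon> / 3) + (ennreal (\<epsilon> / 3) + ennreal (\<epsilon> / 3))"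
      using uv by (intro add_mono d h) (auto simp: L1_dist_commute)
    also have "\<dots> = ennreal \<epsilon>" using \<epsilon> by (simp add: ennreal_plus[symmetric] del: ennreal_plus)
    finally show "L1_dist (\<lambda>x. u (x + h)) u \<le> ennreal \<epsilon>" .
  qed
qed

lemma shift_continuous_add:
  assumes [measurable]: "u \<in> borel_measurable borel" "v \<in> borel_measurable borel"
    and u: "shift_continuous u" and v: "shift_continuous v"
  shows "shift_continuous (\<lambda>x. u x + v x)"
  unfolding shift_continuous_def
proof (intro allI impI)
  fix \<epsilon> :: real assume \<epsilon>: "0 < \<epsilon>"
  obtain d where d: "0 < d" "\<And>h. \<bar>h\<bar> \<le> d \<Longrightarrow> L1_dist (\<lambda>x. u (x + h)) u \<le> ennreal (\<epsilon> / 2)"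
    using shift_continuousD[OF u, of "\<epsilon> / 2"] \<epsilon> by auto
  obtain d' where d': "0 < d'" "\<And>h. \<bar>h\<bar> \<le> d' \<Longrightarrow> L1_dist (\<lambda>x. v (x + h)) v \<le> ennreal (\<epsilon> / 2)"
    using shift_continuousD[OF v, of "\<epsilon> / 2"] \<epsilon> by auto
  show "\<exists>d>0. \<forall>h. \<bar>h\<bar> \<le> d \<longrightarrow> L1_dist (\<lambda>x. u (x + h) + v (x + h)) (\<lambda>x. u x + v x) \<le> ennreal \<epsilon>"
  proof (intro exI[of _ "min d d'"] conjI allI impI)
    fix h assume h: "\<bar>h\<bar> \<le> min d d'"
    have "L1_dist (\<lambda>x. u (x + h) + v (x + h)) (\<lambda>x. u x + v x)
      \<le> (\<integral>\<^sup>+x. ennreal \<bar>u (x + h) - u x\<bar> + ennreal \<bar>v (x + h) - v x\<bar> \<partial>lborel)"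
      unfolding L1_dist_def
      by (intro nn_integral_mono) (auto simp: ennreal_plus[symmetric] simp del: ennreal_plus intro!: ennreal_leI)
    also have "\<dots> = L1_dist (\<lambda>x. u (x + h)) u + L1_dist (\<lambda>x. v (x + h)) v"
      unfolding L1_dist_def by (rule nn_integral_add) measurable
    also have "\<dots> \<le> ennreal (\<epsilon> / 2) + ennreal (\<epsilon> / 2)" using h by (intro add_mono d d') auto
    also have "\<dots> = ennreal \<epsilon>" using \<epsilon> by (simp add: ennreal_plus[symmetric] del: ennreal_plus)
    finally show "L1_dist (\<lambda>x. u (x + h) + v (x + h)) (\<lambda>x. u x + v x) \<le> ennreal \<epsilon>" .
  qed (use d d' in auto)
qed

text \<open>A point of an open set stays in it under small shifts, so the integrand is eventually
  zero at each point, with the indicator of \<open>U\<close> as dominating function.\<close>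

lemma open_shift_limit:
  assumes U: "open U" "emeasure lborel U < \<infinity>" and h: "h \<longlonglongrightarrow> (0::real)"
  shows "(\<lambda>n. \<integral>\<^sup>+x. indicator U x * indicator (- U) (x + h n) \<partial>lborel) \<longlonglongrightarrow> 0"
proof -
  have [measurable]: "U \<in> sets borel" using U by simp
  have "(\<lambda>n. \<integral>\<^sup>+x. indicator U x * indicator (- U) (x + h n) \<partial>lborel) \<longlonglongrightarrow> (\<integral>\<^sup>+(x::real). 0 \<partial>lborel)"
  proof (rule nn_integral_dominated_convergence[where w = "indicator U :: real \<Rightarrow> ennreal" and u' = "\<lambda>x. 0"])
    show "AE x in lborel. (\<lambda>n. indicator U x * indicator (- U) (x + h n) :: ennreal) \<longlonglongrightarrow> 0"
    proof (rule AE_I2)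
      fix x :: real
      show "(\<lambda>n. indicator U x * indicator (- U) (x + h n) :: ennreal) \<longlonglongrightarrow> 0"
      proof (cases "x \<in> U")
        case True
        have "(\<lambda>n. x + h n) \<longlonglongrightarrow> x + 0" by (intro tendsto_intros h)
        then have "\<forall>\<^sub>F n in sequentially. x + h n \<in> U"
          using U(1) True by (intro topological_tendstoD) auto
        then have "\<forall>\<^sub>F n in sequentially. indicator U x * indicator (- U) (x + h n) = (0::ennreal)"
          by eventually_elim (simp add: indicator_def)
        then show ?thesis by (rule tendsto_eventually)
      qed simp
    qed
    show "(\<integral>\<^sup>+x. indicator U x \<partial>lborel) < \<infinity>" using U by simp
  qed (auto intro!: AE_I2 simp: indicator_def)
  then show ?thesis by simp
qed

lemma shift_continuous_open:
  assumes U: "open U" "emeasure lborel U < \<infinity>"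
  shows "shift_continuous (\<lambda>x. indicator U x * c)"
  unfolding shift_continuous_def
proof (intro allI impI, rule ccontr)
  fix \<epsilon> :: real
  let ?u = "\<lambda>x. indicator U x * c"
  have [measurable]: "U \<in> sets borel" using U by simp
  assume \<epsilon>: "0 < \<epsilon>" and "\<not> (\<exists>d>0. \<forall>h. \<bar>h\<bar> \<le> d \<longrightarrow> L1_dist (\<lambda>x. ?u (x + h)) ?u \<le> ennreal \<epsilon>)"
  then have "\<forall>d>0. \<exists>h. \<bar>h\<bar> \<le> d \<and> ennreal \<epsilon> < L1_dist (\<lambda>x. ?u (x + h)) ?u" by (simp add: not_le)
  then have "\<forall>n. \<exists>h. \<bar>h\<bar> \<le> 1 / real (Suc n) \<and> ennreal \<epsilon> < L1_dist (\<lambda>x. ?u (x + h)) ?u" by simp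
  then obtain h where h: "\<And>n. \<bar>h n\<bar> \<le> 1 / real (Suc n)" and
    bad: "\<And>n. ennreal \<epsilon> < L1_dist (\<lambda>x. ?u (x + h n)) ?u" by metis
  have h0: "h \<longlonglongrightarrow> 0"
    by (rule Lim_null_comparison[OF _ LIMSEQ_inverse_real_of_nat])
       (use h in \<open>auto simp: inverse_eq_divide\<close>)
  \<comment> \<open>Points where the two indicators differ either leave \<open>U\<close> or enter it
    under the shift. A translation turns the second case into the first for the opposite shift,
    whence the sign \<open>s\<close>.\<close>
  let ?A = "\<lambda>s n. \<integral>\<^sup>+x. indicator U x * indicator (- U) (x + s * h n) \<partial>lborel :: ennreal"
  have split: "L1_dist (\<lambda>x. ?u (x + h n)) ?u = ennreal \<bar>c\<bar> * (?A 1 n + ?A (-1) n)" for n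
  proof -
    have "?A (-1) n = (\<integral>\<^sup>+x. indicator U (x + h n) * indicator (- U) (x + h n + (-1) * h n) \<partial>lborel)"
      by (rule nn_integral_shift[symmetric]) measurable
    then have A: "?A (-1) n = (\<integral>\<^sup>+x. indicator U (x + h n) * indicator (- U) x \<partial>lborel)" by simp
    have "ennreal \<bar>c\<bar> * (?A 1 n + ?A (-1) n)
       = (\<integral>\<^sup>+x. ennreal \<bar>c\<bar> * (indicator U x * indicator (- U) (x + 1 * h n) + indicator U (x + h n) * indicator (- U) x) \<partial>lborel)"
      unfolding A by (subst nn_integral_cmult, measurable, subst nn_integral_add, measurable)
    also have "\<dots> = L1_dist (\<lambda>x. ?u (x + h n)) ?u"
      unfolding L1_dist_def by (intro nn_integral_cong) (auto simp: indicator_def)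
    finally show ?thesis by simp
  qed
  have "?A 1 \<longlonglongrightarrow> 0" using open_shift_limit[OF U h0] by simp
  moreover have "?A (-1) \<longlonglongrightarrow> 0"
    using open_shift_limit[OF U, of "\<lambda>n. - h n"] tendsto_minus[OF h0] by simp
  ultimately have "(\<lambda>n. ennreal \<bar>c\<bar> * (?A 1 n + ?A (-1) n)) \<longlonglongrightarrow> ennreal \<bar>c\<bar> * (0 + 0)"
    by (intro ennreal_tendsto_cmult tendsto_add) auto
  then have "(\<lambda>n. L1_dist (\<lambda>x. ?u (x + h n)) ?u) \<longlonglongrightarrow> 0" unfolding split by simp
  then have "ennreal \<epsilon> \<le> 0"
    by (rule LIMSEQ_le_const) (use bad in \<open>auto intro: less_imp_le\<close>)
  then show False using \<epsilon> by simp
qed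

text \<open>Outer regularity reduces indicators of Borel sets to open ones; sums and limits in the
  integral norm preserve the property.\<close>

lemma integrable_shift_continuous:
  assumes "integrable lborel u"
  shows "shift_continuous u"
  using assms
proof (induction rule: integrable_induct)
  case (base A c)
  have [measurable]: "A \<in> sets borel" using base by simp
  show ?case
  proof (rule shift_continuous_approx)
    fix \<epsilon> :: real assume \<epsilon>: "0 < \<epsilon>"
    have "0 < \<epsilon> / (\<bar>c\<bar> + 1)" using \<epsilon> by (intro divide_pos_pos) auto
    with outer_regular_lborel[of A] obtain U where U: "open U" "A \<subseteq> U" "emeasure lborel (U - A) < \<epsilon> / (\<bar>c\<bar> + 1)"
      by force
    have [measurable]: "U \<in> sets borel" using U by simp
    have "emeasure lborel U = emeasure lborel (A \<union> (U - A))" using U by (intro arg_cong2[where f = emeasure]) auto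
    also have "\<dots> \<le> emeasure lborel A + emeasure lborel (U - A)" by (rule emeasure_subadditive) auto
    also have "\<dots> < \<infinity>" using base U(3) by (auto intro: less_trans)
    finally have fin: "emeasure lborel U < \<infinity>" .
    have "L1_dist (\<lambda>x. indicator A x *\<^sub>R c) (\<lambda>x. indicator U x * c) = (\<integral>\<^sup>+x. ennreal \<bar>c\<bar> * indicator (U - A) x \<partial>lborel)"
      unfolding L1_dist_def using U by (intro nn_integral_cong) (auto simp: indicator_def)
    also have "\<dots> = ennreal \<bar>c\<bar> * emeasure lborel (U - A)" by (rule nn_integral_cmult_indicator) auto
    also have "\<dots> \<le> ennreal \<bar>c\<bar> * ennreal (\<epsilon> / (\<bar>c\<bar> + 1))" using U by (intro mult_left_mono) auto
    also have "\<dots> \<le> ennreal \<epsilon>"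
      using \<epsilon> by (simp add: ennreal_mult[symmetric] divide_le_eq mult.commute ennreal_leI distrib_left)
    finally show "\<exists>v. v \<in> borel_measurable borel \<and> shift_continuous v \<and> L1_dist (\<lambda>x. indicator A x *\<^sub>R c) v \<le> ennreal \<epsilon>"
      using shift_continuous_open[OF U(1) fin, of c] by (intro exI[of _ "\<lambda>x. indicator U x * c"]) auto
  qed measurable
next
  case (add f g)
  then show ?case by (intro shift_continuous_add) (auto dest: borel_measurable_integrable)
next
  case (lim f s)
  have [measurable]: "f \<in> borel_measurable borel" "s i \<in> borel_measurable borel" for i
    using lim borel_measurable_integrable by force+
  have conv: "(\<lambda>i. L1_dist f (s i)) \<longlonglongrightarrow> 0"
    unfolding L1_dist_def real_norm_def[symmetric]
  proof (rule nn_integral_dominated_convergence_norm[where w = "\<lambda>x. 2 * \<bar>f x\<bar>"])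
    have "integrable lborel (\<lambda>x. 2 * \<bar>f x\<bar>)" using lim by auto
    then show "(\<integral>\<^sup>+x. ennreal (2 * \<bar>f x\<bar>) \<partial>lborel) < \<infinity>"
      by (subst nn_integral_eq_integral) auto
  qed (use lim in auto)
  show ?case
  proof (rule shift_continuous_approx)
    fix \<epsilon> :: real assume \<epsilon>: "0 < \<epsilon>"
    then have "\<forall>\<^sub>F i in sequentially. L1_dist f (s i) < ennreal \<epsilon>"
      by (intro order_tendstoD(2)[OF conv]) simp
    then obtain i where "L1_dist f (s i) < ennreal \<epsilon>"
      using eventually_sequentially by auto
    then show "\<exists>v. v \<in> borel_measurable borel \<and> shift_continuous v \<and> L1_dist f v \<le> ennreal \<epsilon>"
      using lim by (intro exI[of _ "s i"]) (auto intro: less_imp_le)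
  qed measurable
qed

lemma shift_dist_small:
  assumes "integrable lborel u" "0 < \<epsilon>"
  obtains d where "0 < d" "\<And>h. 0 \<le> h \<Longrightarrow> h \<le> d \<Longrightarrow> shift_dist h u \<le> ennreal \<epsilon>"
proof -
  obtain d where d: "0 < d" "\<And>h. \<bar>h\<bar> \<le> d \<Longrightarrow> L1_dist (\<lambda>x. u (x + h)) u \<le> ennreal \<epsilon>"
    using shift_continuousD[OF integrable_shift_continuous[OF assms(1)] assms(2)] by blast
  have "shift_dist h u \<le> ennreal \<epsilon>" if "0 \<le> h" "h \<le> d" for h
  proof -
    have "shift_dist h u \<le> L1_dist (\<lambda>x. u (x + h)) u"
      unfolding shift_dist_def L1_dist_def by (intro nn_integral_mono ennreal_leI) (auto simp: indicator_def)
    also have "\<dots> \<le> ennreal \<epsilon>" using that by (intro d) auto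
    finally show ?thesis .
  qed
  then show ?thesis using that d by blast
qed

section \<open>The approximation scheme\<close>

text \<open>A Lipschitz cutoff and not a sharp one: the truncated kernel must stay uniformly
  continuous, because its modulus enters the translation estimate.\<close>

definition cutoff :: "nat \<Rightarrow> real \<Rightarrow> real" where
  "cutoff R a = max 0 (min 1 (real R + 1 - a))"

lemma cutoff_bounds: "0 \<le> cutoff R a" "cutoff R a \<le> 1"
  by (auto simp: cutoff_def)

lemma cutoff_eq_1: "a \<le> real R \<Longrightarrow> cutoff R a = 1"
  by (auto simp: cutoff_def)

lemma cutoff_eq_0: "real R + 1 \<le> a \<Longrightarrow> cutoff R a = 0"
  by (auto simp: cutoff_def)

lemma cutoff_mono: "R \<le> n \<Longrightarrow> cutoff R a \<le> cutoff n a"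
  by (auto simp: cutoff_def)

lemma cutoff_measurable[measurable]: "cutoff R \<in> borel_measurable borel"
  unfolding cutoff_def by measurable

lemma cutoff_continuous: "continuous_on A (cutoff R)"
  unfolding cutoff_def by (intro continuous_intros)

definition outside :: "nat \<Rightarrow> real \<Rightarrow> real \<Rightarrow> ennreal" where
  "outside R a b = max (indicator {real R<..} a) (indicator {real R<..} b)"

lemma outside_measurable[measurable]: "case_prod (outside R) \<in> borel_measurable (borel \<Otimes>\<^sub>M borel)"
  unfolding outside_def by measurable

lemma outside_eq: "outside R a b = (if a \<le> real R \<and> b \<le> real R then 0 else 1)"
  by (auto simp: outside_def indicator_def max_def)

text \<open>Kernels and densities are extended by zero to negative sizes, so that all integrals run over the real line.\<close>

locale rbk_problem =
  fixes K :: "real \<Rightarrow> real \<Rightarrow> real" and f0 :: "real \<Rightarrow> real"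
  assumes K: "kernel K"
    and K_cont: "continuous_on ({0..} \<times> {0..}) (case_prod K)"
    and K_zero: "\<And>a b. a < 0 \<Longrightarrow> K a b = 0"
    and K_sublinear: "\<And>S \<epsilon>. 0 < \<epsilon> \<Longrightarrow> \<exists>R. \<forall>y\<ge>R. \<forall>x\<in>{0..S}. K x y \<le> \<epsilon> * y"
    and f0: "density_fun f0" and f0_total: "total f0 < \<infinity>" and f0_moment: "moment f0 < \<infinity>"
begin

lemma K_measurable[measurable]: "case_prod K \<in> borel_measurable (borel \<Otimes>\<^sub>M borel)"
  by (rule kernel_measurable[OF K])

section \<open>The truncated kernels\<close>

definition \<kappa> :: "nat \<Rightarrow> real \<Rightarrow> real \<Rightarrow> real" where
  "\<kappa> R a b = K a b * cutoff R a * cutoff R b"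

lemma \<kappa>_kernel: "kernel (\<kappa> R)"
proof -
  have "case_prod (\<kappa> R) \<in> borel_measurable (borel \<Otimes>\<^sub>M borel)" unfolding \<kappa>_def by measurable
  then show ?thesis
    using kernel_nonneg[OF K] kernel_sym[OF K] by (auto simp: kernel_def \<kappa>_def cutoff_bounds mult_ac)
qed

lemma \<kappa>_measurable[measurable]: "case_prod (\<kappa> R) \<in> borel_measurable (borel \<Otimes>\<^sub>M borel)"
  by (rule kernel_measurable[OF \<kappa>_kernel])

lemma \<kappa>_le: "\<kappa> R a b \<le> K a b"
proof -
  have "K a b * (cutoff R a * cutoff R b) \<le> K a b * 1"
    by (intro mult_left_mono mult_le_one cutoff_bounds kernel_nonneg[OF K])
  then show ?thesis by (simp add: \<kappa>_def mult.assoc)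
qed

lemma \<kappa>_mono: "R \<le> n \<Longrightarrow> \<kappa> R a b \<le> \<kappa> n a b"
  unfolding \<kappa>_def by (intro mult_mono cutoff_mono order.refl cutoff_bounds mult_nonneg_nonneg kernel_nonneg[OF K])

lemma \<kappa>_eq: "a \<le> real R \<Longrightarrow> b \<le> real R \<Longrightarrow> \<kappa> R a b = K a b"
  by (simp add: \<kappa>_def cutoff_eq_1)

lemma \<kappa>_zero: "real R + 1 \<le> a \<or> real R + 1 \<le> b \<or> a < 0 \<or> b < 0 \<Longrightarrow> \<kappa> R a b = 0"
  using K_zero[of a b] K_zero[of b a] kernel_sym[OF K, of a b] by (auto simp: \<kappa>_def cutoff_eq_0)

lemma \<kappa>_bounded: "\<exists>C. \<forall>a b. \<kappa> R a b \<le> C"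
proof -
  let ?S = "{0..real R + 1} \<times> {0..real R + 1}"
  have "continuous_on ?S (case_prod K)" by (rule continuous_on_subset[OF K_cont]) auto
  then have "compact (case_prod K ` ?S)" by (intro compact_continuous_image compact_Times) auto
  then obtain B where B: "\<And>x. x \<in> case_prod K ` ?S \<Longrightarrow> norm x \<le> B"
    using compact_imp_bounded bounded_iff by metis
  have "\<kappa> R a b \<le> max 0 B" for a b
  proof (cases "(a, b) \<in> ?S")
    case True
    then have "K a b \<in> case_prod K ` ?S" by (auto intro!: image_eqI[of _ _ "(a, b)"])
    then have "K a b \<le> B" using B[of "K a b"] by auto
    then show ?thesis using \<kappa>_le[of R a b] by simp
  next
    case False
    then have "\<kappa> R a b = 0" by (intro \<kappa>_zero) auto
    then show ?thesis by simp
  qed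
  then show ?thesis by blast
qed

definition cap :: "nat \<Rightarrow> real" where "cap R = (SOME C. \<forall>a b. \<kappa> R a b \<le> C)"

lemma \<kappa>_le_cap: "\<kappa> R a b \<le> cap R"
  unfolding cap_def using someI_ex[OF \<kappa>_bounded[of R]] by blast

lemma cap_nonneg: "0 \<le> cap R"
  using \<kappa>_le_cap[of R 0 0] kernel_nonneg[OF \<kappa>_kernel, of R 0 0] by simp

lemma \<kappa>_modulus:
  assumes \<epsilon>: "0 < \<epsilon>"
  obtains d where "0 < d" "\<And>h a b. 0 \<le> h \<Longrightarrow> h \<le> d \<Longrightarrow> 0 \<le> a \<Longrightarrow> 0 \<le> b \<Longrightarrow> \<bar>\<kappa> R (a + h) b - \<kappa> R a b\<bar> \<le> \<epsilon>"
proof -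
  \<comment> \<open>The margin 2 leaves room for \<open>a + h\<close> with \<open>h \<le> 1\<close>;
    once \<open>a\<close> or \<open>b\<close> reaches \<open>R + 1\<close>, both kernel values are
    zero.\<close>
  let ?S = "{0..real R + 2} \<times> {0..real R + 2}"
  have "continuous_on ?S (\<lambda>p. (case_prod K) p * cutoff R (fst p) * cutoff R (snd p))"
    by (intro continuous_on_mult continuous_on_subset[OF K_cont]
        continuous_on_compose2[OF cutoff_continuous[of UNIV]] continuous_on_fst continuous_on_snd continuous_on_id) auto
  then have "continuous_on ?S (\<lambda>p. \<kappa> R (fst p) (snd p))"
    by (rule continuous_on_cong[THEN iffD1, rotated 2]) (auto simp: \<kappa>_def)
  then have "uniformly_continuous_on ?S (\<lambda>p. \<kappa> R (fst p) (snd p))"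
    by (intro compact_uniformly_continuous compact_Times) auto
  then obtain d where d: "0 < d"
    "\<And>p q. p \<in> ?S \<Longrightarrow> q \<in> ?S \<Longrightarrow> dist q p < d \<Longrightarrow> dist (\<kappa> R (fst q) (snd q)) (\<kappa> R (fst p) (snd p)) < \<epsilon>"
    using \<epsilon> unfolding uniformly_continuous_on_def by metis
  have "\<bar>\<kappa> R (a + h) b - \<kappa> R a b\<bar> \<le> \<epsilon>" if "0 \<le> h" "h \<le> min 1 (d / 2)" "0 \<le> a" "0 \<le> b" for h a b
  proof (cases "a < real R + 1 \<and> b < real R + 1")
    case True
    have "dist (a + h, b) (a, b) < d" using that d by (simp add: dist_Pair_Pair dist_real_def)
    then show ?thesis using d(2)[of "(a, b)" "(a + h, b)"] True that by (simp add: dist_real_def)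
  next
    case False
    then have "\<kappa> R (a + h) b = 0" "\<kappa> R a b = 0" using that by (auto intro!: \<kappa>_zero)
    then show ?thesis using \<epsilon> by simp
  qed
  moreover have "0 < min 1 (d / 2)" using d by simp
  ultimately show ?thesis using that by blast
qed

section \<open>Step size and Euler iterates\<close>

definition M0 :: real where "M0 = enn2real (total f0)"
definition M1 :: real where "M1 = enn2real (moment f0)"

lemma M_nonneg: "0 \<le> M0" "0 \<le> M1" by (simp_all add: M0_def M1_def)

lemma M_eq: "total f0 = ennreal M0" "moment f0 = ennreal M1"
  using f0_total f0_moment by (simp_all add: M0_def M1_def less_top)

text \<open>The factor \<open>cap n + 1\<close> bounds the kernel: a step of this size keeps the iterates
  nonnegative, and the collisions during a single step number at most \<open>1 / (n + 1)\<close>.\<close>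

definition \<delta> :: "nat \<Rightarrow> real" where
  "\<delta> n = 1 / (real (n + 1) * ((cap n + 1) * (M0 + 1)\<^sup>2))"

lemma \<delta>_pos: "0 < \<delta> n"
  unfolding \<delta>_def using cap_nonneg[of n] M_nonneg by (intro divide_pos_pos mult_pos_pos) auto

text \<open>The three bounds serve positivity of the iterates, the error of an unfinished step, and
  the mesh tending to zero. Adding 1 to both \<open>cap n\<close> and \<open>M0\<close> lets a
  single denominator dominate all three.\<close>

lemma \<delta>_small: "\<delta> n * (cap n * M0) \<le> 1" "\<delta> n * (cap n * M0\<^sup>2) \<le> 1 / real (n + 1)" "\<delta> n \<le> 1 / real (n + 1)"
proof -
  let ?D = "(cap n + 1) * (M0 + 1)\<^sup>2"
  have D: "1 \<le> ?D" using cap_nonneg[of n] M_nonneg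
    using mult_mono[of 1 "cap n + 1" 1 "(M0 + 1)\<^sup>2"] by simp
  have *: "\<delta> n * x \<le> 1 / real (n + 1)" if "x \<le> ?D" for x
  proof -
    have "\<delta> n * x = (x / ?D) / real (n + 1)" unfolding \<delta>_def by simp
    also have "\<dots> \<le> 1 / real (n + 1)" using that D by (intro divide_right_mono) (auto simp: divide_le_eq_1)
    finally show ?thesis .
  qed
  have q: "M0\<^sup>2 \<le> (M0 + 1)\<^sup>2" "M0 \<le> (M0 + 1)\<^sup>2"
    using M_nonneg by (auto simp: power2_eq_square algebra_simps)
  have "cap n * M0 \<le> ?D" "cap n * M0\<^sup>2 \<le> ?D"
    using q cap_nonneg[of n] M_nonneg by (intro mult_mono; simp)+
  from *[OF this(1)] *[OF this(2)] *[OF D]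
  show "\<delta> n * (cap n * M0) \<le> 1" "\<delta> n * (cap n * M0\<^sup>2) \<le> 1 / real (n + 1)" "\<delta> n \<le> 1 / real (n + 1)"
    by (auto elim!: order.trans)
qed

definition iter :: "nat \<Rightarrow> nat \<Rightarrow> real \<Rightarrow> real" where
  "iter n k = ((euler (\<delta> n) (\<kappa> n)) ^^ k) f0"

lemma iter_simps: "iter n 0 = f0" "iter n (Suc k) = euler (\<delta> n) (\<kappa> n) (iter n k)"
  by (simp_all add: iter_def)

lemma moment_eq:
  assumes "density_fun f"
  shows "moment f = (\<integral>\<^sup>+x. ennreal x * ennreal (f x) \<partial>lborel)"
  unfolding moment_def using density_fun_nonneg[OF assms] by (simp add: ennreal_mult'')

lemma step_small:
  assumes "total u \<le> ennreal M0"
  shows "\<delta> n * cap n * enn2real (total u) \<le> 1"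
proof -
  have "enn2real (total u) \<le> M0" using assms M_nonneg by (intro enn2real_leI) auto
  then have "\<delta> n * cap n * enn2real (total u) \<le> \<delta> n * cap n * M0"
    using \<delta>_pos[of n] cap_nonneg[of n] by (intro mult_left_mono) auto
  then show ?thesis using \<delta>_small(1)[of n] by (simp add: mult.assoc)
qed

text \<open>The induction has to be joint: the bound on the number of particles in one iterate
  supplies the smallness condition that keeps the next iterate a density.\<close>

lemma iter_invariant:
  "density_fun (iter n k) \<and> total (iter n k) \<le> ennreal M0 \<and> moment (iter n k) \<le> ennreal M1"
proof (induction k)
  case 0
  then show ?case by (simp add: iter_simps f0 M_eq)
next
  case (Suc k)
  let ?f = "iter n k"
  have inv: "density_fun ?f" "total ?f \<le> ennreal M0" "moment ?f \<le> ennreal M1" using Suc by auto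
  interpret euler_step "\<kappa> n" "cap n" "\<delta> n" ?f
    using inv \<delta>_pos[of n] by unfold_locales (auto simp: \<kappa>_kernel \<kappa>_le_cap less_imp_le intro: le_less_trans)
  have e: "density_fun (euler (\<delta> n) (\<kappa> n) ?f)" by (rule density_fun_euler[OF step_small[OF inv(2)]])
  have "total (euler (\<delta> n) (\<kappa> n) ?f) \<le> total ?f"
    using euler_monotone[OF e, of "\<lambda>_. 1"] total_f unfolding total_def
    by (auto dest: order.trans[OF add_increasing2[OF zero_le order.refl]])
  moreover have "moment (euler (\<delta> n) (\<kappa> n) ?f) \<le> moment ?f"
    using euler_monotone[OF e, of ennreal] inv(3) unfolding moment_eq[OF e] moment_eq[OF inv(1)]
    by (auto dest: order.trans[OF add_increasing2[OF zero_le order.refl]] le_less_trans[OF _ ennreal_less_top] simp: ennreal_leI)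
  ultimately show ?case using inv e by (auto simp: iter_simps)
qed

lemma iter_density: "density_fun (iter n k)"
  and iter_total: "total (iter n k) \<le> ennreal M0"
  and iter_moment: "moment (iter n k) \<le> ennreal M1"
  using iter_invariant by auto

lemma iter_measurable[measurable]: "iter n k \<in> borel_measurable borel"
  by (rule density_fun_measurable[OF iter_density])

lemma iter_step: "euler_step (\<kappa> n) (cap n) (\<delta> n) (iter n k)"
  using \<delta>_pos[of n] iter_total[of n k]
  by unfold_locales (auto simp: \<kappa>_kernel \<kappa>_le_cap less_imp_le iter_density intro: le_less_trans)

lemma iter_small: "\<delta> n * cap n * enn2real (total (iter n k)) \<le> 1"
  by (rule step_small[OF iter_total])

section \<open>Collisions inside and outside a square\<close>

lemma collisions_\<kappa>_le:
  assumes "density_fun f" "total f \<le> ennreal M0"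
  shows "collisions (\<lambda>a b. 1) (\<kappa> R) f \<le> ennreal (cap R * M0\<^sup>2)"
proof -
  have "collisions (\<lambda>a b. 1) (\<kappa> R) f \<le> ennreal (cap R) * total f * total f"
    using collisions_le[OF assms(1), of "\<lambda>_. 1" "\<kappa> R" "cap R"] by (simp add: \<kappa>_le_cap cap_nonneg total_def)
  also have "\<dots> \<le> ennreal (cap R) * ennreal M0 * ennreal M0" by (intro mult_mono assms order.refl) auto
  also have "\<dots> = ennreal (cap R * M0\<^sup>2)"
    using cap_nonneg M_nonneg by (simp add: ennreal_mult power2_eq_square mult.assoc)
  finally show ?thesis .
qed

lemma \<kappa>_split_le:
  assumes f: "density_fun f" and R: "R \<le> n"
  shows "collisions (\<lambda>a b. 1) (\<lambda>a b. \<kappa> n a b - \<kappa> R a b) f \<le> collisions (outside R) (\<kappa> n) f"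
proof (rule collisions_mono[OF _ f])
  fix a b :: real
  show "1 * ennreal ((\<kappa> n a b - \<kappa> R a b) * f a * f b) \<le> outside R a b * ennreal (\<kappa> n a b * f a * f b)"
  proof (cases "a \<le> real R \<and> b \<le> real R")
    case True
    then have "\<kappa> n a b = \<kappa> R a b" using R by (simp add: \<kappa>_eq)
    then show ?thesis by simp
  next
    case False
    have "(\<kappa> n a b - \<kappa> R a b) * f a * f b \<le> \<kappa> n a b * f a * f b"
      using kernel_nonneg[OF \<kappa>_kernel] density_fun_nonneg[OF f] by (intro mult_right_mono) auto
    then show ?thesis using False by (auto simp: outside_eq intro: ennreal_leI)
  qed
qed

lemma collisions_inner_outer:
  assumes k[measurable]: "kernel k" and f: "density_fun f"
    and inner: "\<And>a b. a \<le> real R \<Longrightarrow> b \<le> real R \<Longrightarrow> k a b = \<kappa> R a b"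
  shows "collisions (\<lambda>a b. 1) k f \<le> collisions (\<lambda>a b. 1) (\<kappa> R) f + collisions (outside R) k f"
proof -
  note [measurable] = density_fun_measurable[OF f]
  have "collisions (\<lambda>a b. 1) k f \<le> (\<integral>\<^sup>+a. (\<integral>\<^sup>+b. 1 * ennreal (\<kappa> R a b * f a * f b) + outside R a b * ennreal (k a b * f a * f b) \<partial>lborel) \<partial>lborel)"
    unfolding collisions_def
    by (intro nn_integral_mono) (auto simp: outside_eq inner add_increasing2)
  also have "\<dots> = (\<integral>\<^sup>+a. (\<integral>\<^sup>+b. 1 * ennreal (\<kappa> R a b * f a * f b) \<partial>lborel)
      + (\<integral>\<^sup>+b. outside R a b * ennreal (k a b * f a * f b) \<partial>lborel) \<partial>lborel)"
    by (intro nn_integral_cong nn_integral_add) measurable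
  also have "\<dots> = collisions (\<lambda>a b. 1) (\<kappa> R) f + collisions (outside R) k f"
    unfolding collisions_def by (rule nn_integral_add) measurable
  finally show ?thesis .
qed

text \<open>A Riemann sum in time. Its smallness, uniform in \<open>n\<close>, takes the place of a
  bound on the collision rate at a fixed time.\<close>

definition tail_collisions :: "nat \<Rightarrow> nat \<Rightarrow> nat \<Rightarrow> ennreal" where
  "tail_collisions n R m = ennreal (\<delta> n) * (\<Sum>k<m. collisions (outside R) (\<kappa> n) (iter n k))"

text \<open>Each collision whose smaller member exceeds \<open>S\<close> uses up at least one
  particle beyond \<open>S\<close>, and no collision increases their number; summing over the steps
  telescopes.\<close>

lemma large_collisions:
  "(\<integral>\<^sup>+x. indicator {S<..} x * ennreal (iter n m x) \<partial>lborel)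
   + ennreal (\<delta> n) * (\<Sum>k<m. collisions (\<lambda>a b. indicator {S<..} b * indicator {0<..} (a - b)) (\<kappa> n) (iter n k))
   \<le> (\<integral>\<^sup>+x. indicator {S<..} x * ennreal (f0 x) \<partial>lborel)"
proof (induction m)
  case 0
  then show ?case by (simp add: iter_simps)
next
  case (Suc m)
  let ?I = "\<lambda>f. \<integral>\<^sup>+x. indicator {S<..} x * ennreal (f x) \<partial>lborel"
  let ?c = "\<lambda>k. collisions (\<lambda>a b. indicator {S<..} b * indicator {0<..} (a - b)) (\<kappa> n) (iter n k)"
  interpret euler_step "\<kappa> n" "cap n" "\<delta> n" "iter n m" by (rule iter_step)
  have "?I (iter n m) \<le> total (iter n m)"
    unfolding total_def by (intro nn_integral_mono) (auto simp: indicator_def)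
  then have "?I (iter n m) < \<infinity>" using total_f by (rule le_less_trans)
  then have "?I (iter n (Suc m)) + ennreal (\<delta> n) * ?c m \<le> ?I (iter n m)"
    using euler_monotone[of "indicator {S<..}"] iter_density[of n "Suc m"]
    by (auto simp: iter_simps indicator_def)
  then have "?I (iter n (Suc m)) + ennreal (\<delta> n) * ?c m + ennreal (\<delta> n) * (\<Sum>k<m. ?c k)
     \<le> ?I (iter n m) + ennreal (\<delta> n) * (\<Sum>k<m. ?c k)"
    by (rule add_right_mono)
  also have "\<dots> \<le> ?I f0" by (rule Suc.IH)
  finally show ?case by (simp add: distrib_left ac_simps)
qed

text \<open>Let \<open>a > R\<close> be the larger member. If its partner has
  \<open>b \<le> S\<close>, sublinear growth bounds the kernel by \<open>\<epsilon> * a\<close> and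
  the double integral by \<open>\<epsilon>\<close> times moment times total; if
  \<open>b > S\<close>, the pair belongs to the second term. The factor 2 covers both orders of the
  pair.\<close>

lemma outside_collisions_le:
  assumes f: "density_fun f" and fM: "total f \<le> ennreal M0" "moment f \<le> ennreal M1" and \<epsilon>: "0 \<le> \<epsilon>"
    and far: "\<And>a b. real R < a \<Longrightarrow> 0 \<le> b \<Longrightarrow> b \<le> S \<Longrightarrow> K b a \<le> \<epsilon> * a"
  shows "collisions (outside R) (\<kappa> n) f
    \<le> 2 * (ennreal (\<epsilon> * M1 * M0) + collisions (\<lambda>a b. indicator {S<..} b * indicator {0<..} (a - b)) (\<kappa> n) f)"
proof -
  note [measurable] = density_fun_measurable[OF f]
  note f_nn = density_fun_nonneg[OF f]
  let ?\<psi> = "\<lambda>a b. indicator {S<..} b * indicator {0<..} (a - b) :: ennreal"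
  have "collisions (outside R) (\<kappa> n) f
     = collisions (\<lambda>a b. (outside R a b + outside R b a) * indicator {0<..} (a - b)) (\<kappa> n) f"
    by (rule collisions_diagonal[OF \<kappa>_kernel f]) measurable
  also have "\<dots> \<le> (\<integral>\<^sup>+a. \<integral>\<^sup>+b. 2 * (ennreal \<epsilon> * ennreal (a * f a) * ennreal (f b) + ?\<psi> a b * ennreal (\<kappa> n a b * f a * f b)) \<partial>lborel \<partial>lborel)"
    unfolding collisions_def
  proof (intro nn_integral_mono)
    fix a b :: real
    let ?k = "ennreal (\<kappa> n a b * f a * f b)"
    show "(outside R a b + outside R b a) * indicator {0<..} (a - b) * ?k
       \<le> 2 * (ennreal \<epsilon> * ennreal (a * f a) * ennreal (f b) + ?\<psi> a b * ?k)"
    proof (cases "0 < b \<and> b < a \<and> real R < a")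
      case False
      then have "b \<le> 0 \<or> a \<le> b \<or> a \<le> real R \<and> b \<le> real R" by auto
      then show ?thesis
        using density_fun_zero[OF f, of b] by (auto simp: outside_eq indicator_def)
    next
      case True
      have two: "(outside R a b + outside R b a) * indicator {0<..} (a - b) = (2::ennreal)"
        using True by (simp add: outside_eq)
      have "?k \<le> ennreal \<epsilon> * ennreal (a * f a) * ennreal (f b) + ?\<psi> a b * ?k"
      proof (cases "b \<le> S")
        case True
        have "\<kappa> n a b \<le> \<epsilon> * a"
          using far[of a b] \<open>0 < b \<and> b < a \<and> real R < a\<close> True \<kappa>_le[of n a b] kernel_sym[OF K, of a b] by simp
        then have "\<kappa> n a b * f a * f b \<le> \<epsilon> * a * f a * f b" by (intro mult_right_mono f_nn)
        then have "?k \<le> ennreal (\<epsilon> * a * f a * f b)" by (rule ennreal_leI)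
        also have "\<dots> = ennreal \<epsilon> * ennreal (a * f a) * ennreal (f b)"
          using \<epsilon> f_nn \<open>0 < b \<and> b < a \<and> real R < a\<close> by (simp add: ennreal_mult mult.assoc)
        finally show ?thesis by (rule add_increasing2[OF zero_le])
      next
        case False
        then show ?thesis using True by simp
      qed
      then show ?thesis unfolding two by (rule mult_left_mono) simp
    qed
  qed
  also have "\<dots> = (\<integral>\<^sup>+a. 2 * (ennreal \<epsilon> * ennreal (a * f a) * total f + (\<integral>\<^sup>+b. ?\<psi> a b * ennreal (\<kappa> n a b * f a * f b) \<partial>lborel)) \<partial>lborel)"
    unfolding total_def
    by (intro nn_integral_cong, subst nn_integral_cmult, measurable, subst nn_integral_add, measurable, subst nn_integral_cmult, measurable)
  also have "\<dots> = 2 * ((ennreal \<epsilon> * moment f) * total f + collisions ?\<psi> (\<kappa> n) f)"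
    unfolding collisions_def moment_def
    by (subst nn_integral_cmult, measurable, subst nn_integral_add, measurable, subst nn_integral_multc, measurable,
        subst nn_integral_cmult, measurable)
  also have "\<dots> \<le> 2 * ((ennreal \<epsilon> * ennreal M1) * ennreal M0 + collisions ?\<psi> (\<kappa> n) f)"
    by (intro mult_left_mono add_mono mult_mono fM order.refl) auto
  also have "(ennreal \<epsilon> * ennreal M1) * ennreal M0 = ennreal (\<epsilon> * M1 * M0)"
    using \<epsilon> M_nonneg by (simp add: ennreal_mult)
  finally show ?thesis .
qed

lemma tail_collisions_small:
  assumes T: "0 \<le> T" and \<epsilon>: "0 < \<epsilon>"
  obtains R where "\<And>n m. \<delta> n * real m \<le> T \<Longrightarrow> tail_collisions n R m \<le> ennreal \<epsilon>"
proof -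
  \<comment> \<open>\<open>S\<close> is fixed by the tail of \<open>f0\<close> through Markov's
    inequality, before \<open>e\<close> and \<open>R\<close>. None of the three depends on
    \<open>n\<close>, so the bound is uniform along the scheme.\<close>
  define S where "S = 4 * (M1 + 1) / \<epsilon>"
  have S: "0 < S" using \<epsilon> M_nonneg unfolding S_def by (intro divide_pos_pos) auto
  have S_tail: "(\<integral>\<^sup>+x. indicator {S<..} x * ennreal (f0 x) \<partial>lborel) \<le> ennreal (\<epsilon> / 4)"
  proof (rule tail_le_moment[OF f0 S])
    show "M1 / S \<le> \<epsilon> / 4" unfolding S_def using \<epsilon> M_nonneg by (simp add: field_simps)
  qed (use M_eq M_nonneg in auto)
  \<comment> \<open>Each kind of pair, with small or with large partner, may spend
    \<open>\<epsilon> / 4\<close>, doubled by the two orders. The added 1 avoids division by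
    zero.\<close>
  define e where "e = \<epsilon> / (4 * (T * M1 * M0 + 1))"
  have TM: "0 \<le> T * M1 * M0" using T M_nonneg by simp
  have e: "0 < e" "T * (e * M1 * M0) \<le> \<epsilon> / 4"
  proof -
    show "0 < e" unfolding e_def using \<epsilon> TM by (intro divide_pos_pos) auto
    have "T * (e * M1 * M0) = (T * M1 * M0) / (T * M1 * M0 + 1) * (\<epsilon> / 4)"
      unfolding e_def by (simp add: algebra_simps)
    also have "\<dots> \<le> 1 * (\<epsilon> / 4)"
      using \<epsilon> TM by (intro mult_right_mono) (auto simp: divide_le_eq_1)
    finally show "T * (e * M1 * M0) \<le> \<epsilon> / 4" by simp
  qed
  obtain R0 where R0: "\<And>y x. y \<ge> R0 \<Longrightarrow> x \<in> {0..S} \<Longrightarrow> K x y \<le> e * y"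
    using K_sublinear[OF e(1), of S] by blast
  obtain R :: nat where R: "R0 \<le> real R" using real_arch_simple by blast
  have "tail_collisions n R m \<le> ennreal \<epsilon>" if Tm: "\<delta> n * real m \<le> T" for n m
  proof -
    let ?c = "\<lambda>k. collisions (\<lambda>a b. indicator {S<..} b * indicator {0<..} (a - b)) (\<kappa> n) (iter n k)"
    have eM: "0 \<le> e * M1 * M0" using e M_nonneg by simp
    have "tail_collisions n R m \<le> ennreal (\<delta> n) * (\<Sum>k<m. 2 * (ennreal (e * M1 * M0) + ?c k))"
      unfolding tail_collisions_def
      using R R0 e by (intro mult_left_mono sum_mono outside_collisions_le iter_density iter_total iter_moment) auto
    also have "\<dots> = 2 * (ennreal (\<delta> n * real m * (e * M1 * M0)) + ennreal (\<delta> n) * (\<Sum>k<m. ?c k))"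
    proof -
      have "(\<Sum>k<m. 2 * (ennreal (e * M1 * M0) + ?c k)) = 2 * (of_nat m * ennreal (e * M1 * M0) + (\<Sum>k<m. ?c k))"
        by (simp only: sum_distrib_left[symmetric] sum.distrib sum_constant card_lessThan)
      moreover have "ennreal (\<delta> n * real m * (e * M1 * M0)) = ennreal (\<delta> n) * (of_nat m * ennreal (e * M1 * M0))"
        using \<delta>_pos[of n] eM by (simp add: ennreal_mult ennreal_of_nat_eq_real_of_nat mult.assoc)
      ultimately show ?thesis by (simp add: distrib_left mult_ac)
    qed
    also have "\<dots> \<le> 2 * (ennreal (\<epsilon> / 4) + ennreal (\<epsilon> / 4))"
    proof (intro mult_left_mono add_mono ennreal_leI)
      have "\<delta> n * real m * (e * M1 * M0) \<le> T * (e * M1 * M0)" using Tm eM by (rule mult_right_mono)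
      then show "\<delta> n * real m * (e * M1 * M0) \<le> \<epsilon> / 4" using e by linarith
      have "ennreal (\<delta> n) * (\<Sum>k<m. ?c k) \<le> (\<integral>\<^sup>+x. indicator {S<..} x * ennreal (f0 x) \<partial>lborel)"
        by (rule order.trans[OF add_increasing[OF zero_le order.refl] large_collisions])
      then show "ennreal (\<delta> n) * (\<Sum>k<m. ?c k) \<le> ennreal (\<epsilon> / 4)" using S_tail by (rule order.trans)
    qed simp
    also have "\<dots> = ennreal \<epsilon>"
      using \<epsilon> by (simp add: ennreal_plus[symmetric] ennreal_mult'[symmetric] ennreal_numeral[symmetric] del: ennreal_plus ennreal_numeral)
    finally show ?thesis .
  qed
  then show ?thesis using that by blast
qed

text \<open>The increments from \<open>euler_shift\<close> are added without a growth factor, so the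
  bound is linear in the elapsed time \<open>\<delta> n * m\<close>, and its constants belong to the
  fixed level \<open>R\<close> and not to \<open>n\<close>.\<close>

lemma iter_shift:
  assumes R: "R \<le> n" and h: "0 \<le> h"
    and mod: "\<And>a b. 0 \<le> a \<Longrightarrow> 0 \<le> b \<Longrightarrow> \<bar>\<kappa> R (a + h) b - \<kappa> R a b\<bar> \<le> \<epsilon>"
  shows "shift_dist h (iter n m) \<le> shift_dist h f0 + ennreal (\<delta> n * real m * (2 * \<epsilon> * M0\<^sup>2)) + 4 * tail_collisions n R m"
proof (induction m)
  case 0
  then show ?case by (simp add: iter_simps tail_collisions_def)
next
  case (Suc m)
  interpret euler_step "\<kappa> n" "cap n" "\<delta> n" "iter n m" by (rule iter_step)
  have \<epsilon>: "0 \<le> \<epsilon>" using mod[of 0 0] by simp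
  have "shift_dist h (iter n (Suc m)) \<le> shift_dist h (iter n m) + ennreal (\<delta> n) *
     (ennreal (2 * \<epsilon>) * total (iter n m) * total (iter n m) + 4 * collisions (\<lambda>a b. 1) (\<lambda>a b. \<kappa> n a b - \<kappa> R a b) (iter n m))"
    unfolding iter_simps by (rule euler_shift[OF iter_small \<kappa>_kernel \<kappa>_mono[OF R] h mod])
  also have "\<dots> \<le> shift_dist h (iter n m) + ennreal (\<delta> n) *
     (ennreal (2 * \<epsilon>) * ennreal M0 * ennreal M0 + 4 * collisions (outside R) (\<kappa> n) (iter n m))"
    by (intro add_left_mono mult_left_mono add_mono mult_mono iter_total \<kappa>_split_le R iter_density order.refl) auto
  also have "ennreal (2 * \<epsilon>) * ennreal M0 * ennreal M0 = ennreal (2 * \<epsilon> * M0\<^sup>2)"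
    using \<epsilon> M_nonneg by (simp add: ennreal_mult[symmetric] power2_eq_square mult.assoc)
  also have "shift_dist h (iter n m) + ennreal (\<delta> n) * (ennreal (2 * \<epsilon> * M0\<^sup>2) + 4 * collisions (outside R) (\<kappa> n) (iter n m))
    \<le> (shift_dist h f0 + ennreal (\<delta> n * real m * (2 * \<epsilon> * M0\<^sup>2)) + 4 * tail_collisions n R m)
      + ennreal (\<delta> n) * (ennreal (2 * \<epsilon> * M0\<^sup>2) + 4 * collisions (outside R) (\<kappa> n) (iter n m))"
    by (rule add_right_mono[OF Suc.IH])
  also have "\<dots> = shift_dist h f0 + (ennreal (\<delta> n * real m * (2 * \<epsilon> * M0\<^sup>2)) + ennreal (\<delta> n * (2 * \<epsilon> * M0\<^sup>2))) + 4 * tail_collisions n R (Suc m)"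
    using \<epsilon> \<delta>_pos[of n] by (simp add: tail_collisions_def ennreal_mult distrib_left ac_simps)
  also have "ennreal (\<delta> n * real m * (2 * \<epsilon> * M0\<^sup>2)) + ennreal (\<delta> n * (2 * \<epsilon> * M0\<^sup>2)) = ennreal (\<delta> n * real (Suc m) * (2 * \<epsilon> * M0\<^sup>2))"
    using \<epsilon> \<delta>_pos[of n] by (subst ennreal_plus[symmetric]) (auto simp: algebra_simps intro!: mult_nonneg_nonneg)
  finally show ?case .
qed

text \<open>Inside the square the collision rate is bounded in terms of \<open>cap R\<close>, which
  gives Lipschitz dependence on time; collisions outside are paid for by
  \<open>tail_collisions\<close>.\<close>

lemma iter_distance:
  assumes R: "R \<le> n"
  shows "L1_dist (iter n m) (iter n (m + j)) \<le> ennreal (\<delta> n * real j * (2 * (cap R * M0\<^sup>2))) + 2 * tail_collisions n R (m + j)"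
proof -
  have CM: "0 \<le> cap R * M0\<^sup>2" using cap_nonneg by simp
  have "L1_dist (iter n m) (iter n (m + j)) \<le> ennreal (\<delta> n * real j * (2 * (cap R * M0\<^sup>2)))
    + 2 * (ennreal (\<delta> n) * (\<Sum>k\<in>{m..<m + j}. collisions (outside R) (\<kappa> n) (iter n k)))"
  proof (induction j)
    case 0
    then show ?case by (simp add: L1_dist_def)
  next
    case (Suc j)
    interpret euler_step "\<kappa> n" "cap n" "\<delta> n" "iter n (m + j)" by (rule iter_step)
    let ?c = "collisions (outside R) (\<kappa> n) (iter n (m + j))"
    let ?s = "\<Sum>k\<in>{m..<m + j}. collisions (outside R) (\<kappa> n) (iter n k)"
    have "L1_dist (iter n m) (iter n (m + Suc j)) \<le> L1_dist (iter n m) (iter n (m + j)) + L1_dist (iter n (m + j)) (iter n (m + Suc j))"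
      by (rule L1_dist_triangle) measurable
    also have "L1_dist (iter n (m + j)) (iter n (m + Suc j)) \<le> ennreal (2 * \<delta> n) * (ennreal (cap R * M0\<^sup>2) + ?c)"
    proof -
      have "L1_dist (iter n (m + j)) (iter n (m + Suc j)) \<le> ennreal (2 * \<delta> n) * collisions (\<lambda>a b. 1) (\<kappa> n) (iter n (m + j))"
        using euler_distance unfolding L1_dist_def by (simp add: iter_simps abs_minus_commute)
      also have "\<dots> \<le> ennreal (2 * \<delta> n) * (collisions (\<lambda>a b. 1) (\<kappa> R) (iter n (m + j)) + ?c)"
        using R by (intro mult_left_mono collisions_inner_outer iter_density \<kappa>_kernel) (auto simp: \<kappa>_eq)
      also have "\<dots> \<le> ennreal (2 * \<delta> n) * (ennreal (cap R * M0\<^sup>2) + ?c)"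
        by (intro mult_left_mono add_right_mono collisions_\<kappa>_le iter_density iter_total) auto
      finally show ?thesis .
    qed
    also note Suc.IH
    also have "ennreal (\<delta> n * real j * (2 * (cap R * M0\<^sup>2))) + 2 * (ennreal (\<delta> n) * ?s) + ennreal (2 * \<delta> n) * (ennreal (cap R * M0\<^sup>2) + ?c)
      = (ennreal (\<delta> n * real j * (2 * (cap R * M0\<^sup>2))) + ennreal (\<delta> n * (2 * (cap R * M0\<^sup>2)))) + 2 * (ennreal (\<delta> n) * (?s + ?c))"
    proof -
      have "ennreal (2 * \<delta> n) = 2 * ennreal (\<delta> n)"
        using \<delta>_pos[of n] by (simp add: ennreal_mult')
      moreover have "ennreal (\<delta> n * (2 * (cap R * M0\<^sup>2))) = 2 * (ennreal (\<delta> n) * ennreal (cap R * M0\<^sup>2))"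
        using \<delta>_pos[of n] CM by (simp add: ennreal_mult[symmetric] ennreal_mult'[symmetric] ennreal_numeral[symmetric] mult_ac cap_nonneg del: ennreal_numeral)
      ultimately show ?thesis by (simp add: distrib_left mult_ac add_ac)
    qed
    also have "ennreal (\<delta> n * real j * (2 * (cap R * M0\<^sup>2))) + ennreal (\<delta> n * (2 * (cap R * M0\<^sup>2))) = ennreal (\<delta> n * real (Suc j) * (2 * (cap R * M0\<^sup>2)))"
      using \<delta>_pos[of n] cap_nonneg[of R]
      by (subst ennreal_plus[symmetric]) (auto simp: algebra_simps intro!: mult_nonneg_nonneg)
    finally show ?case by (simp add: add_right_mono add_left_mono)
  qed
  also have "\<dots> \<le> ennreal (\<delta> n * real j * (2 * (cap R * M0\<^sup>2))) + 2 * tail_collisions n R (m + j)"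
    unfolding tail_collisions_def by (intro add_left_mono mult_left_mono sum_mono2) auto
  finally show ?thesis .
qed

section \<open>Piecewise constant interpolation in time\<close>

definition steps :: "nat \<Rightarrow> real \<Rightarrow> nat" where
  "steps n t = nat \<lfloor>t / \<delta> n\<rfloor>"

definition F :: "nat \<Rightarrow> real \<Rightarrow> real \<Rightarrow> real" where
  "F n t = iter n (steps n t)"

lemma steps_bounds:
  assumes "0 \<le> t"
  shows "\<delta> n * real (steps n t) \<le> t" "t < \<delta> n * real (steps n t) + \<delta> n"
proof -
  have "0 \<le> t / \<delta> n" using assms \<delta>_pos[of n] by simp
  then have "real (steps n t) \<le> t / \<delta> n" "t / \<delta> n < real (steps n t) + 1"
    by (auto simp: steps_def)
  then show "\<delta> n * real (steps n t) \<le> t" "t < \<delta> n * real (steps n t) + \<delta> n"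
    using \<delta>_pos[of n] by (auto simp: pos_le_divide_eq pos_divide_less_eq algebra_simps)
qed

lemma steps_mono: "s \<le> t \<Longrightarrow> steps n s \<le> steps n t"
  unfolding steps_def using \<delta>_pos[of n] by (intro nat_mono floor_mono divide_right_mono) auto

lemma F_shift:
  assumes \<epsilon>: "0 < \<epsilon>"
  shows "\<exists>h0>0. \<exists>N. \<forall>n\<ge>N. \<forall>t\<in>{0..T}. \<forall>h\<in>{0..h0}. shift_dist h (F n t) \<le> ennreal \<epsilon>"
proof -
  define T' where "T' = max T 0"
  have T': "0 \<le> T'" by (simp add: T'_def)
  \<comment> \<open>\<open>R\<close> comes first; the modulus of continuity of
    \<open>\<kappa> R\<close> then decides which shifts are admissible. The shares
    \<open>1/4 + 1/4 + 4/16\<close> leave a quarter of \<open>\<epsilon>\<close> unspent.\<close>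
  obtain R where R: "\<And>n m. \<delta> n * real m \<le> T' \<Longrightarrow> tail_collisions n R m \<le> ennreal (\<epsilon> / 16)"
    using tail_collisions_small[OF T', of "\<epsilon> / 16"] \<epsilon> by auto
  define e where "e = \<epsilon> / (4 * (2 * T' * M0\<^sup>2 + 1))"
  have TM: "0 \<le> 2 * T' * M0\<^sup>2" using T' by simp
  have e: "0 < e" unfolding e_def using \<epsilon> TM by (intro divide_pos_pos) auto
  have eT: "T' * (2 * e * M0\<^sup>2) \<le> \<epsilon> / 4"
  proof -
    have "T' * (2 * e * M0\<^sup>2) = (2 * T' * M0\<^sup>2) / (2 * T' * M0\<^sup>2 + 1) * (\<epsilon> / 4)" unfolding e_def by simp
    also have "\<dots> \<le> 1 * (\<epsilon> / 4)" using \<epsilon> TM by (intro mult_right_mono) (auto simp: divide_le_eq_1)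
    finally show ?thesis by simp
  qed
  obtain d where d: "0 < d" "\<And>h a b. 0 \<le> h \<Longrightarrow> h \<le> d \<Longrightarrow> 0 \<le> a \<Longrightarrow> 0 \<le> b \<Longrightarrow> \<bar>\<kappa> R (a + h) b - \<kappa> R a b\<bar> \<le> e"
    using \<kappa>_modulus[OF e, of R] by blast
  obtain d' where d': "0 < d'" "\<And>h. 0 \<le> h \<Longrightarrow> h \<le> d' \<Longrightarrow> shift_dist h f0 \<le> ennreal (\<epsilon> / 4)"
    using shift_dist_small[OF density_fun_integrable[OF f0 f0_total], of "\<epsilon> / 4"] \<epsilon> by auto
  have "shift_dist h (F n t) \<le> ennreal \<epsilon>" if "R \<le> n" "t \<in> {0..T}" "h \<in> {0..min d d'}" for n t h
  proof -
    have t: "\<delta> n * real (steps n t) \<le> T'" using steps_bounds(1)[of t n] that by (auto simp: T'_def)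
    have "shift_dist h (F n t) \<le> shift_dist h f0 + ennreal (\<delta> n * real (steps n t) * (2 * e * M0\<^sup>2)) + 4 * tail_collisions n R (steps n t)"
      unfolding F_def using that by (intro iter_shift d) auto
    also have "\<dots> \<le> ennreal (\<epsilon> / 4) + ennreal (\<epsilon> / 4) + 4 * ennreal (\<epsilon> / 16)"
    proof (intro add_mono mult_left_mono d' R t ennreal_leI)
      have "\<delta> n * real (steps n t) * (2 * e * M0\<^sup>2) \<le> T' * (2 * e * M0\<^sup>2)"
        using t e by (intro mult_right_mono) auto
      then show "\<delta> n * real (steps n t) * (2 * e * M0\<^sup>2) \<le> \<epsilon> / 4" using eT by simp
    qed (use that in auto)
    also have "\<dots> \<le> ennreal \<epsilon>"
      using \<epsilon> by (simp add: ennreal_plus[symmetric] ennreal_mult'[symmetric] ennreal_numeral[symmetric] ennreal_leI del: ennreal_plus ennreal_numeral)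
    finally show ?thesis .
  qed
  then show ?thesis using d d' by (intro exI[of _ "min d d'"] conjI exI[of _ R]) auto
qed

lemma F_time:
  assumes \<epsilon>: "0 < \<epsilon>"
  shows "\<exists>\<eta>>0. \<exists>N. \<forall>n\<ge>N. \<forall>s\<in>{0..T}. \<forall>t\<in>{0..T}. \<bar>s - t\<bar> \<le> \<eta> \<longrightarrow> L1_dist (F n s) (F n t) \<le> ennreal \<epsilon>"
proof -
  define T' where "T' = max T 0"
  have T': "0 \<le> T'" by (simp add: T'_def)
  obtain R where R: "\<And>n m. \<delta> n * real m \<le> T' \<Longrightarrow> tail_collisions n R m \<le> ennreal (\<epsilon> / 4)"
    using tail_collisions_small[OF T', of "\<epsilon> / 4"] \<epsilon> by auto
  define B where "B = 2 * (cap R * M0\<^sup>2) + 1"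
  have B: "0 < B" using cap_nonneg[of R] by (simp add: B_def add_nonneg_pos)
  \<comment> \<open>The time covered by the intermediate steps satisfies
    \<open>\<delta> n * j < t - s + \<delta> n\<close>, at most \<open>2 * \<eta>\<close>. With
    \<open>B\<close> this costs half of \<open>\<epsilon>\<close>; the tail, counted twice, costs
    the other half.\<close>
  define \<eta> where "\<eta> = \<epsilon> / (4 * B)"
  have \<eta>: "0 < \<eta>" using \<epsilon> B by (simp add: \<eta>_def)
  obtain N where N: "1 / real (Suc N) < \<eta>" using \<eta> nat_approx_posE by blast
  have main: "L1_dist (F n s) (F n t) \<le> ennreal \<epsilon>"
    if n: "max R N \<le> n" and st: "0 \<le> s" "s \<le> t" "t \<le> T" "t - s \<le> \<eta>" for n s t
  proof -
    define j where "j = steps n t - steps n s"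
    have j: "steps n t = steps n s + j" using steps_mono[OF st(2), of n] by (simp add: j_def)
    have "\<delta> n \<le> 1 / real (n + 1)" by (rule \<delta>_small)
    also have "\<dots> \<le> 1 / real (Suc N)" using n by (intro divide_left_mono) auto
    finally have dn: "\<delta> n < \<eta>" using N by simp
    have dj: "\<delta> n * real j \<le> 2 * \<eta>"
      using steps_bounds[of s n] steps_bounds[of t n] st dn j by (simp add: distrib_left)
    have tT: "\<delta> n * real (steps n t) \<le> T'" using steps_bounds(1)[of t n] st by (auto simp: T'_def)
    have "L1_dist (F n s) (F n t) \<le> ennreal (\<delta> n * real j * (2 * (cap R * M0\<^sup>2))) + 2 * tail_collisions n R (steps n t)"
      unfolding F_def j using n by (intro iter_distance) auto
    also have "\<dots> \<le> ennreal (2 * \<eta> * B) + 2 * ennreal (\<epsilon> / 4)"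
    proof (intro add_mono mult_left_mono R tT ennreal_leI)
      show "\<delta> n * real j * (2 * (cap R * M0\<^sup>2)) \<le> 2 * \<eta> * B"
        by (rule mult_mono[OF dj]) (use cap_nonneg[of R] \<eta> in \<open>auto simp: B_def\<close>)
    qed simp
    also have "2 * \<eta> * B = \<epsilon> / 2" using B by (simp add: \<eta>_def)
    also have "ennreal (\<epsilon> / 2) + 2 * ennreal (\<epsilon> / 4) = ennreal \<epsilon>"
      using \<epsilon> by (simp add: ennreal_plus[symmetric] ennreal_mult'[symmetric] ennreal_numeral[symmetric] del: ennreal_plus ennreal_numeral)
    finally show ?thesis .
  qed
  have "L1_dist (F n s) (F n t) \<le> ennreal \<epsilon>"
    if "n \<ge> max R N" "s \<in> {0..T}" "t \<in> {0..T}" "\<bar>s - t\<bar> \<le> \<eta>" for n s t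
  proof (cases "s \<le> t")
    case True
    then show ?thesis using that by (intro main) auto
  next
    case False
    then show ?thesis using that by (subst L1_dist_commute) (intro main, auto)
  qed
  then show ?thesis using \<eta> by (intro exI[of _ \<eta>] conjI exI[of _ "max R N"]) auto
qed

sublocale compact_family F M0 M1
proof
  show "case_prod (F n) \<in> borel_measurable (borel \<Otimes>\<^sub>M borel)" for n
  proof -
    \<comment> \<open>Time enters only through the integer \<open>steps n t\<close>, so joint
      measurability reduces to countably many Borel functions of the size.\<close>
    have "(\<lambda>p. iter n (steps n (fst p)) (snd p)) \<in> borel_measurable (borel \<Otimes>\<^sub>M borel)"
    proof (rule measurable_compose_countable)
      show "(\<lambda>p. steps n (fst p)) \<in> measurable (borel \<Otimes>\<^sub>M borel) (count_space UNIV)"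
        unfolding steps_def by measurable
    qed measurable
    then show ?thesis by (simp add: F_def split_beta')
  qed
qed (use F_shift F_time iter_total iter_moment M_nonneg in \<open>auto simp: F_def iter_density\<close>)

end

section \<open>Passage to the limit\<close>

lemma collisions_measurable[measurable]:
  assumes [measurable]: "case_prod k \<in> borel_measurable (borel \<Otimes>\<^sub>M borel)"
    "case_prod \<psi> \<in> borel_measurable (borel \<Otimes>\<^sub>M borel)" "case_prod f \<in> borel_measurable (borel \<Otimes>\<^sub>M borel)"
  shows "(\<lambda>s. collisions \<psi> k (f s)) \<in> borel_measurable borel"
  unfolding collisions_def by measurable

context rbk_problem
begin

lemma F_case_measurable[measurable]: "case_prod (F n) \<in> borel_measurable (borel \<Otimes>\<^sub>M borel)"
  by (rule F_meas)

lemma steps_integral: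
  fixes g :: "nat \<Rightarrow> ennreal"
  assumes \<tau>: "0 \<le> \<tau>"
  shows "(\<integral>\<^sup>+s. indicator {0..\<tau>} s * g (steps n s) \<partial>lborel)
    = ennreal (\<delta> n) * (\<Sum>k<steps n \<tau>. g k) + ennreal (\<tau> - \<delta> n * real (steps n \<tau>)) * g (steps n \<tau>)"
proof -
  let ?m = "steps n \<tau>"
  have [measurable]: "steps n \<in> measurable borel (count_space UNIV)"
    unfolding steps_def by measurable
  have steps_iff: "steps n s = k \<longleftrightarrow> \<delta> n * real k \<le> s \<and> s < \<delta> n * real (Suc k)" if "0 \<le> s" for s k
  proof
    assume "steps n s = k"
    then show "\<delta> n * real k \<le> s \<and> s < \<delta> n * real (Suc k)"
      using steps_bounds[OF that, of n] by (auto simp: algebra_simps)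
  next
    assume "\<delta> n * real k \<le> s \<and> s < \<delta> n * real (Suc k)"
    then have "real k \<le> s / \<delta> n" "s / \<delta> n < real k + 1"
      using \<delta>_pos[of n] by (auto simp: pos_le_divide_eq pos_divide_less_eq algebra_simps)
    then have "\<lfloor>s / \<delta> n\<rfloor> = int k" by (intro floor_unique) auto
    then show "steps n s = k" by (simp add: steps_def)
  qed
  let ?A = "\<lambda>k. {\<delta> n * real k..<\<delta> n * real (Suc k)}"
  let ?B = "{\<delta> n * real ?m..\<tau>}"
  have nn: "0 \<le> \<delta> n * real k" for k using \<delta>_pos[of n] by simp
  have point: "indicator {0..\<tau>} s * g (steps n s) = (\<Sum>k<?m. g k * indicator (?A k) s) + g ?m * indicator ?B s" for s
  proof (cases "s \<in> {0..\<tau>}")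
    case True
    have st: "steps n s \<le> ?m" using True by (intro steps_mono) auto
    have A: "indicator (?A k) s = (if k = steps n s then 1 else 0 :: ennreal)" for k
      using steps_iff[of s k] True by (auto simp: indicator_def)
    have B: "indicator ?B s = (if steps n s = ?m then 1 else 0 :: ennreal)"
      using steps_iff[of s ?m] True steps_bounds(2)[OF \<tau>, of n] by (auto simp: indicator_def algebra_simps)
    show ?thesis unfolding A B using True st by (auto simp: if_distrib cong: if_cong)
  next
    case False
    have "s \<notin> ?A k" if "k < ?m" for k
    proof
      assume s: "s \<in> ?A k"
      have "\<delta> n * real (Suc k) \<le> \<delta> n * real ?m" using that \<delta>_pos[of n] by (intro mult_left_mono) auto
      then show False using s False steps_bounds(1)[OF \<tau>, of n] nn[of k] by auto
    qed
    then have "(\<Sum>k<?m. g k * indicator (?A k) s) = 0" by (intro sum.neutral) simp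
    moreover have "s \<notin> ?B" using False nn[of ?m] by auto
    then have "indicator ?B s = (0::ennreal)" by (rule indicator_simps)
    moreover have "indicator {0..\<tau>} s = (0::ennreal)" using False by (rule indicator_simps)
    ultimately show ?thesis by (simp only: mult_zero_left mult_zero_right add_0)
  qed
  have eA: "emeasure lborel (?A k) = ennreal (\<delta> n)" for k
    using \<delta>_pos[of n] by (subst emeasure_lborel_Ico) (auto simp: algebra_simps)
  have eB: "emeasure lborel ?B = ennreal (\<tau> - \<delta> n * real ?m)"
    using steps_bounds(1)[OF \<tau>, of n] by (subst emeasure_lborel_Icc) auto
  have "(\<integral>\<^sup>+s. indicator {0..\<tau>} s * g (steps n s) \<partial>lborel)
      = (\<Sum>k<?m. g k * emeasure lborel (?A k)) + g ?m * emeasure lborel ?B"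
    unfolding point
    by (subst nn_integral_add, measurable, subst nn_integral_sum, measurable)
       (simp only: nn_integral_cmult_indicator sets_lborel atLeastLessThan_borel atLeastAtMost_borel)
  also have "\<dots> = (\<Sum>k<?m. g k * ennreal (\<delta> n)) + g ?m * ennreal (\<tau> - \<delta> n * real ?m)"
    by (simp only: eA eB)
  finally show ?thesis by (simp add: sum_distrib_left mult.commute)
qed

lemma F_tail:
  assumes T: "0 \<le> T" and \<epsilon>: "0 < \<epsilon>"
  obtains R where "\<And>n. (\<integral>\<^sup>+s. indicator {0..T} s * collisions (outside R) (\<kappa> n) (F n s) \<partial>lborel) \<le> ennreal \<epsilon>"
proof -
  \<comment> \<open>The last partial step is completed to a full one, which may overshoot
    \<open>T\<close> by \<open>\<delta> n \<le> 1\<close>.\<close>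
  obtain R where R: "\<And>n m. \<delta> n * real m \<le> T + 1 \<Longrightarrow> tail_collisions n R m \<le> ennreal \<epsilon>"
    using tail_collisions_small[of "T + 1" \<epsilon>] T \<epsilon> by auto
  have "(\<integral>\<^sup>+s. indicator {0..T} s * collisions (outside R) (\<kappa> n) (F n s) \<partial>lborel) \<le> ennreal \<epsilon>" for n
  proof -
    let ?c = "\<lambda>k. collisions (outside R) (\<kappa> n) (iter n k)"
    let ?m = "steps n T"
    have "(\<integral>\<^sup>+s. indicator {0..T} s * collisions (outside R) (\<kappa> n) (F n s) \<partial>lborel)
       = ennreal (\<delta> n) * (\<Sum>k<?m. ?c k) + ennreal (T - \<delta> n * real ?m) * ?c ?m"
      unfolding F_def by (rule steps_integral[OF T])
    also have "\<dots> \<le> ennreal (\<delta> n) * (\<Sum>k<?m. ?c k) + ennreal (\<delta> n) * ?c ?m"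
      using steps_bounds(2)[OF T, of n] by (intro add_left_mono mult_right_mono ennreal_leI) auto
    also have "\<dots> = tail_collisions n R (Suc ?m)"
      by (simp add: tail_collisions_def distrib_left)
    also have "\<dots> \<le> ennreal \<epsilon>"
    proof (rule R)
      have "\<delta> n \<le> 1 / real (n + 1)" by (rule \<delta>_small)
      also have "\<dots> \<le> 1" by simp
      finally show "\<delta> n * real (Suc ?m) \<le> T + 1"
        using steps_bounds(1)[OF T, of n] by (simp add: algebra_simps)
    qed
    finally show ?thesis .
  qed
  then show ?thesis using that by blast
qed

lemma discrete_balance:
  assumes [measurable]: "E \<in> sets borel"
  shows "(\<integral>\<^sup>+x. indicator E x * ennreal (iter n m x) \<partial>lborel)
     + ennreal (\<delta> n) * (\<Sum>k<m. collisions (\<lambda>a b. indicator E a) (\<kappa> n) (iter n k))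
    = (\<integral>\<^sup>+x. indicator E x * ennreal (f0 x) \<partial>lborel)
     + ennreal (\<delta> n) * (\<Sum>k<m. collisions (\<lambda>a b. indicator E (a - b) * indicator {0<..} (a - b)) (\<kappa> n) (iter n k))"
proof (induction m)
  case 0
  then show ?case by (simp add: iter_simps)
next
  case (Suc m)
  let ?I = "\<lambda>f. \<integral>\<^sup>+x. indicator E x * ennreal (f x) \<partial>lborel"
  let ?l = "\<lambda>k. collisions (\<lambda>a b. indicator E a) (\<kappa> n) (iter n k)"
  let ?g = "\<lambda>k. collisions (\<lambda>a b. indicator E (a - b) * indicator {0<..} (a - b)) (\<kappa> n) (iter n k)"
  interpret euler_step "\<kappa> n" "cap n" "\<delta> n" "iter n m" by (rule iter_step)
  have "?I (iter n (Suc m)) + ennreal (\<delta> n) * ?l m = ?I (iter n m) + ennreal (\<delta> n) * ?g m"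
    using euler_weak[of "indicator E"] iter_density[of n "Suc m"] by (simp add: iter_simps)
  then have "?I (iter n (Suc m)) + ennreal (\<delta> n) * (\<Sum>k<Suc m. ?l k)
     = (?I (iter n m) + ennreal (\<delta> n) * (\<Sum>k<m. ?l k)) + ennreal (\<delta> n) * ?g m"
    by (simp add: distrib_left ac_simps)
  then show ?case unfolding Suc.IH by (simp add: distrib_left ac_simps)
qed

text \<open>The discrete balance counts completed steps, whereas the time integral also contains the
  current unfinished one. Its contribution is at most
  \<open>\<delta> n * cap n * M0\<^sup>2\<close>, hence at most \<open>1 / (n + 1)\<close> by the
  choice of the step size. Two inequalities replace an equation with error because the error can
  only be added in \<open>ennreal\<close>.\<close>

lemma F_balance:
  assumes E[measurable]: "E \<in> sets borel" and \<tau>: "0 \<le> \<tau>"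
  defines "I \<equiv> \<lambda>f. \<integral>\<^sup>+x. indicator E x * ennreal (f x) \<partial>lborel"
    and "L \<equiv> \<lambda>s. collisions (\<lambda>a b. indicator E a)"
    and "G \<equiv> \<lambda>s. collisions (\<lambda>a b. indicator E (a - b) * indicator {0<..} (a - b))"
  shows "I (F n \<tau>) + (\<integral>\<^sup>+s. indicator {0..\<tau>} s * L s (\<kappa> n) (F n s) \<partial>lborel)
      \<le> I f0 + (\<integral>\<^sup>+s. indicator {0..\<tau>} s * G s (\<kappa> n) (F n s) \<partial>lborel) + ennreal (1 / real (n + 1))" (is ?A)
    and "I f0 + (\<integral>\<^sup>+s. indicator {0..\<tau>} s * G s (\<kappa> n) (F n s) \<partial>lborel)
      \<le> I (F n \<tau>) + (\<integral>\<^sup>+s. indicator {0..\<tau>} s * L s (\<kappa> n) (F n s) \<partial>lborel) + ennreal (1 / real (n + 1))" (is ?B)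
proof -
  let ?m = "steps n \<tau>"
  have small: "ennreal (\<tau> - \<delta> n * real ?m) * collisions \<psi> (\<kappa> n) (iter n ?m) \<le> ennreal (1 / real (n + 1))"
    if "\<And>a b. \<psi> a b \<le> 1" for \<psi>
  proof -
    have "collisions \<psi> (\<kappa> n) (iter n ?m) \<le> collisions (\<lambda>a b. 1) (\<kappa> n) (iter n ?m)"
      using that by (intro collisions_mono iter_density mult_right_mono) auto
    also have "\<dots> \<le> ennreal (cap n * M0\<^sup>2)" by (intro collisions_\<kappa>_le iter_density iter_total)
    finally have "ennreal (\<tau> - \<delta> n * real ?m) * collisions \<psi> (\<kappa> n) (iter n ?m) \<le> ennreal (\<delta> n) * ennreal (cap n * M0\<^sup>2)"
      using steps_bounds(2)[OF \<tau>, of n] by (intro mult_mono ennreal_leI) auto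
    also have "\<dots> = ennreal (\<delta> n * (cap n * M0\<^sup>2))"
      using \<delta>_pos[of n] cap_nonneg[of n] by (simp add: ennreal_mult)
    also have "\<dots> \<le> ennreal (1 / real (n + 1))" by (intro ennreal_leI \<delta>_small)
    finally show ?thesis .
  qed
  have L: "(\<integral>\<^sup>+s. indicator {0..\<tau>} s * L s (\<kappa> n) (F n s) \<partial>lborel)
     = ennreal (\<delta> n) * (\<Sum>k<?m. collisions (\<lambda>a b. indicator E a) (\<kappa> n) (iter n k))
       + ennreal (\<tau> - \<delta> n * real ?m) * collisions (\<lambda>a b. indicator E a) (\<kappa> n) (iter n ?m)"
    unfolding L_def F_def by (rule steps_integral[OF \<tau>])
  have G: "(\<integral>\<^sup>+s. indicator {0..\<tau>} s * G s (\<kappa> n) (F n s) \<partial>lborel)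
     = ennreal (\<delta> n) * (\<Sum>k<?m. collisions (\<lambda>a b. indicator E (a - b) * indicator {0<..} (a - b)) (\<kappa> n) (iter n k))
       + ennreal (\<tau> - \<delta> n * real ?m) * collisions (\<lambda>a b. indicator E (a - b) * indicator {0<..} (a - b)) (\<kappa> n) (iter n ?m)"
    unfolding G_def F_def by (rule steps_integral[OF \<tau>])
  note bal = discrete_balance[OF E, of n ?m, folded F_def]
  have sL: "ennreal (\<tau> - \<delta> n * real ?m) * collisions (\<lambda>a b. indicator E a) (\<kappa> n) (iter n ?m) \<le> ennreal (1 / real (n + 1))"
    by (rule small) (auto simp: indicator_def)
  have sG: "ennreal (\<tau> - \<delta> n * real ?m) * collisions (\<lambda>a b. indicator E (a - b) * indicator {0<..} (a - b)) (\<kappa> n) (iter n ?m) \<le> ennreal (1 / real (n + 1))"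
    by (rule small) (auto simp: indicator_def)
  have gen: "x + (l + p) \<le> y + (g + q) + e" if "x + l = y + g" "p \<le> e" for x l p y g q e :: ennreal
  proof -
    have "x + (l + p) = y + g + p" using that(1) by (simp add: add.assoc[symmetric])
    also have "\<dots> \<le> y + g + e" using that(2) by (rule add_left_mono)
    also have "\<dots> \<le> y + g + e + q" by simp
    finally show ?thesis by (simp add: ac_simps)
  qed
  show ?A unfolding L G I_def by (rule gen[OF bal sL])
  show ?B unfolding L G I_def by (rule gen[OF bal[symmetric] sG])
qed

end

section \<open>Bounds inherited by the limit\<close>

locale rbk_limit = rbk_problem +
  fixes \<phi> :: "nat \<Rightarrow> nat" and f :: "real \<Rightarrow> real \<Rightarrow> real"
  assumes \<phi>: "strict_mono \<phi>"
    and f_meas[measurable]: "case_prod f \<in> borel_measurable (borel \<Otimes>\<^sub>M borel)"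
    and f_density: "\<And>t. density_fun (f t)"
    and f_dist: "\<And>n t. 0 \<le> t \<Longrightarrow> t \<le> real n \<Longrightarrow> L1_dist (F (\<phi> n) t) (f t) \<le> ennreal ((1 / 2) ^ n)"
    and f_AE: "\<And>t. 0 \<le> t \<Longrightarrow> AE x in lborel. (\<lambda>n. F (\<phi> n) t x) \<longlonglongrightarrow> f t x"
begin

lemma f_measurable[measurable]: "f t \<in> borel_measurable borel"
  by (rule density_fun_measurable[OF f_density])

lemma f_nonneg: "0 \<le> f t x"
  by (rule density_fun_nonneg[OF f_density])

lemma F_nonneg: "0 \<le> F n t x"
  by (rule density_fun_nonneg[OF F_density])

lemma \<phi>_ge: "n \<le> \<phi> n"
  by (rule seq_suble[OF \<phi>])

lemma f_total: assumes t: "0 \<le> t" shows "total (f t) \<le> ennreal M0"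
proof -
  have "total (f t) = (\<integral>\<^sup>+x. liminf (\<lambda>n. ennreal (F (\<phi> n) t x)) \<partial>lborel)"
    unfolding total_def
  proof (rule nn_integral_cong_AE, use f_AE[OF t] in eventually_elim)
    case (elim x)
    have "(\<lambda>n. ennreal (F (\<phi> n) t x)) \<longlonglongrightarrow> ennreal (f t x)" by (intro tendsto_ennrealI elim)
    then show ?case by (intro lim_imp_Liminf[symmetric]) auto
  qed
  also have "\<dots> \<le> liminf (\<lambda>n. total (F (\<phi> n) t))"
    unfolding total_def by (rule nn_integral_liminf) measurable
  also have "\<dots> \<le> liminf (\<lambda>n. ennreal M0)" by (intro Liminf_mono always_eventually allI F_total)
  finally show ?thesis by (simp add: Liminf_const)
qed

lemma f_moment: assumes t: "0 \<le> t" shows "moment (f t) \<le> ennreal M1"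
proof -
  have "moment (f t) = (\<integral>\<^sup>+x. liminf (\<lambda>n. ennreal (x * F (\<phi> n) t x)) \<partial>lborel)"
    unfolding moment_def
  proof (rule nn_integral_cong_AE, use f_AE[OF t] in eventually_elim)
    case (elim x)
    have "(\<lambda>n. ennreal (x * F (\<phi> n) t x)) \<longlonglongrightarrow> ennreal (x * f t x)" by (intro tendsto_ennrealI tendsto_intros elim)
    then show ?case by (intro lim_imp_Liminf[symmetric]) auto
  qed
  also have "\<dots> \<le> liminf (\<lambda>n. moment (F (\<phi> n) t))"
    unfolding moment_def by (rule nn_integral_liminf) measurable
  also have "\<dots> \<le> liminf (\<lambda>n. ennreal M1)"
    by (intro Liminf_mono always_eventually allI F_moment)
  finally show ?thesis by (simp add: Liminf_const)
qed

text \<open>Fatou's lemma in \<open>b\<close>, in \<open>a\<close> and in \<open>s\<close>: for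
  fixed sizes the truncated kernels are eventually equal to \<open>K\<close>, so the integrands
  converge almost everywhere.\<close>

lemma f_tail:
  assumes T: "0 \<le> T"
    and R: "\<And>n. (\<integral>\<^sup>+s. indicator {0..T} s * collisions (outside R) (\<kappa> n) (F n s) \<partial>lborel) \<le> ennreal \<epsilon>"
  shows "(\<integral>\<^sup>+s. indicator {0..T} s * collisions (outside R) K (f s) \<partial>lborel) \<le> ennreal \<epsilon>"
proof -
  let ?\<Psi> = "\<lambda>n s a b. outside R a b * ennreal (\<kappa> (\<phi> n) a b * F (\<phi> n) s a * F (\<phi> n) s b)"
  have "(\<integral>\<^sup>+s. indicator {0..T} s * collisions (outside R) K (f s) \<partial>lborel)
     \<le> (\<integral>\<^sup>+s. liminf (\<lambda>n. indicator {0..T} s * collisions (outside R) (\<kappa> (\<phi> n)) (F (\<phi> n) s)) \<partial>lborel)"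
  proof (rule nn_integral_mono)
    fix s :: real
    show "indicator {0..T} s * collisions (outside R) K (f s)
      \<le> liminf (\<lambda>n. indicator {0..T} s * collisions (outside R) (\<kappa> (\<phi> n)) (F (\<phi> n) s))"
    proof (cases "s \<in> {0..T}")
      case True
      then have s: "0 \<le> s" by simp
      have "collisions (outside R) K (f s) \<le> (\<integral>\<^sup>+a. \<integral>\<^sup>+b. liminf (\<lambda>n. ?\<Psi> n s a b) \<partial>lborel \<partial>lborel)"
        unfolding collisions_def
      proof (rule nn_integral_mono_AE, use f_AE[OF s] in eventually_elim)
        case (elim a)
        note a = elim
        show ?case
        proof (rule nn_integral_mono_AE, use f_AE[OF s] in eventually_elim)
          case (elim b)
          obtain N :: nat where N: "max a b \<le> real N" using real_arch_simple by blast
          have "\<kappa> (\<phi> n) a b = K a b" if "n \<ge> N" for n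
            using N \<phi>_ge[of n] that by (intro \<kappa>_eq) linarith+
          then have "\<forall>\<^sub>F n in sequentially. \<kappa> (\<phi> n) a b = K a b"
            by (auto simp: eventually_sequentially)
          then have "(\<lambda>n. \<kappa> (\<phi> n) a b) \<longlonglongrightarrow> K a b" by (rule tendsto_eventually)
          then have "(\<lambda>n. ennreal (\<kappa> (\<phi> n) a b * F (\<phi> n) s a * F (\<phi> n) s b)) \<longlonglongrightarrow> ennreal (K a b * f s a * f s b)"
            by (intro tendsto_ennrealI tendsto_intros a elim)
          then have "(\<lambda>n. ?\<Psi> n s a b) \<longlonglongrightarrow> outside R a b * ennreal (K a b * f s a * f s b)"
            by (auto simp: outside_eq)
          then show ?case by (intro eq_refl lim_imp_Liminf[symmetric]) auto
        qed
      qed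
      also have "\<dots> \<le> (\<integral>\<^sup>+a. liminf (\<lambda>n. \<integral>\<^sup>+b. ?\<Psi> n s a b \<partial>lborel) \<partial>lborel)"
        by (intro nn_integral_mono nn_integral_liminf) measurable
      also have "\<dots> \<le> liminf (\<lambda>n. collisions (outside R) (\<kappa> (\<phi> n)) (F (\<phi> n) s))"
        unfolding collisions_def by (intro nn_integral_liminf) measurable
      finally show ?thesis using True by simp
    qed simp
  qed
  also have "\<dots> \<le> liminf (\<lambda>n. \<integral>\<^sup>+s. indicator {0..T} s * collisions (outside R) (\<kappa> (\<phi> n)) (F (\<phi> n) s) \<partial>lborel)"
    by (rule nn_integral_liminf) measurable
  also have "\<dots> \<le> liminf (\<lambda>n. ennreal \<epsilon>)" by (intro Liminf_mono always_eventually allI R)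
  finally show ?thesis by (simp add: Liminf_const)
qed

text \<open>Inside the square the bounded kernel suffices, outside it the tail estimate with the
  crude value 1. This is what later makes loss and gain finite at almost every size.\<close>

lemma f_collisions_finite:
  assumes T: "0 \<le> T"
  shows "(\<integral>\<^sup>+s. indicator {0..T} s * collisions (\<lambda>a b. 1) K (f s) \<partial>lborel) < \<infinity>"
proof -
  obtain R where R: "\<And>n. (\<integral>\<^sup>+s. indicator {0..T} s * collisions (outside R) (\<kappa> n) (F n s) \<partial>lborel) \<le> ennreal 1"
    using F_tail[OF T, of 1] by auto
  have "(\<integral>\<^sup>+s. indicator {0..T} s * collisions (\<lambda>a b. 1) K (f s) \<partial>lborel)
     \<le> (\<integral>\<^sup>+s. ennreal (cap R * M0\<^sup>2) * indicator {0..T} s + indicator {0..T} s * collisions (outside R) K (f s) \<partial>lborel)"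
  proof (rule nn_integral_mono)
    fix s :: real
    show "indicator {0..T} s * collisions (\<lambda>a b. 1) K (f s)
      \<le> ennreal (cap R * M0\<^sup>2) * indicator {0..T} s + indicator {0..T} s * collisions (outside R) K (f s)"
    proof (cases "s \<in> {0..T}")
      case True
      then have "collisions (\<lambda>a b. 1) (\<kappa> R) (f s) \<le> ennreal (cap R * M0\<^sup>2)"
        by (intro collisions_\<kappa>_le f_density f_total) auto
      then show ?thesis
        using True order.trans[OF collisions_inner_outer[OF K f_density, of R s] add_right_mono]
        by (simp add: \<kappa>_eq)
    qed simp
  qed
  also have "\<dots> = ennreal (cap R * M0\<^sup>2) * ennreal T + (\<integral>\<^sup>+s. indicator {0..T} s * collisions (outside R) K (f s) \<partial>lborel)"
    using T by (subst nn_integral_add, measurable, subst nn_integral_cmult_indicator) auto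
  also have "\<dots> \<le> ennreal (cap R * M0\<^sup>2) * ennreal T + ennreal 1"
    by (intro add_left_mono f_tail[OF T R])
  also have "\<dots> < \<infinity>" by (simp add: ennreal_mult_less_top)
  finally show ?thesis .
qed

text \<open>The distance on pairs between approximate and limiting collision densities. It controls
  collisions for every weight bounded by 1, so gain and loss converge together.\<close>

definition discrepancy :: "nat \<Rightarrow> real \<Rightarrow> ennreal" where
  "discrepancy n s = (\<integral>\<^sup>+a. \<integral>\<^sup>+b. ennreal \<bar>\<kappa> (\<phi> n) a b * F (\<phi> n) s a * F (\<phi> n) s b - K a b * f s a * f s b\<bar> \<partial>lborel \<partial>lborel)"

lemma discrepancy_measurable[measurable]: "discrepancy n \<in> borel_measurable borel"
  unfolding discrepancy_def by measurable

text \<open>From \<open>g a * g b - f a * f b = (g a - f a) * g b + f a * (g b - f b)\<close>: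
  strong convergence of one factor and the bounded total of the other suffice.\<close>

lemma product_dist:
  assumes s: "0 \<le> s" "s \<le> real n"
  shows "(\<integral>\<^sup>+a. \<integral>\<^sup>+b. ennreal (\<kappa> R a b * \<bar>F (\<phi> n) s a * F (\<phi> n) s b - f s a * f s b\<bar>) \<partial>lborel \<partial>lborel)
    \<le> ennreal (cap R * (2 * M0 * (1 / 2) ^ n))"
proof -
  let ?g = "F (\<phi> n) s" and ?f = "f s"
  let ?D = "L1_dist ?g ?f"
  have "(\<integral>\<^sup>+a. \<integral>\<^sup>+b. ennreal (\<kappa> R a b * \<bar>?g a * ?g b - ?f a * ?f b\<bar>) \<partial>lborel \<partial>lborel)
     \<le> (\<integral>\<^sup>+a. \<integral>\<^sup>+b. ennreal (cap R) * (ennreal \<bar>?g a - ?f a\<bar> * ennreal (?g b) + ennreal (?f a) * ennreal \<bar>?g b - ?f b\<bar>) \<partial>lborel \<partial>lborel)"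
  proof (intro nn_integral_mono)
    fix a b
    have "?g a * ?g b - ?f a * ?f b = (?g a - ?f a) * ?g b + ?f a * (?g b - ?f b)" by (simp add: algebra_simps)
    then have "\<bar>?g a * ?g b - ?f a * ?f b\<bar> \<le> \<bar>(?g a - ?f a) * ?g b\<bar> + \<bar>?f a * (?g b - ?f b)\<bar>"
      by (metis abs_triangle_ineq)
    then have "\<bar>?g a * ?g b - ?f a * ?f b\<bar> \<le> \<bar>?g a - ?f a\<bar> * ?g b + ?f a * \<bar>?g b - ?f b\<bar>"
      by (simp add: abs_mult F_nonneg f_nonneg)
    then have "\<kappa> R a b * \<bar>?g a * ?g b - ?f a * ?f b\<bar> \<le> cap R * (\<bar>?g a - ?f a\<bar> * ?g b + ?f a * \<bar>?g b - ?f b\<bar>)"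
      by (intro mult_mono \<kappa>_le_cap cap_nonneg) auto
    then have "ennreal (\<kappa> R a b * \<bar>?g a * ?g b - ?f a * ?f b\<bar>) \<le> ennreal (cap R * (\<bar>?g a - ?f a\<bar> * ?g b + ?f a * \<bar>?g b - ?f b\<bar>))"
      by (rule ennreal_leI)
    also have "\<dots> = ennreal (cap R) * (ennreal \<bar>?g a - ?f a\<bar> * ennreal (?g b) + ennreal (?f a) * ennreal \<bar>?g b - ?f b\<bar>)"
      by (simp add: ennreal_mult F_nonneg f_nonneg cap_nonneg)
    finally show "ennreal (\<kappa> R a b * \<bar>?g a * ?g b - ?f a * ?f b\<bar>)
      \<le> ennreal (cap R) * (ennreal \<bar>?g a - ?f a\<bar> * ennreal (?g b) + ennreal (?f a) * ennreal \<bar>?g b - ?f b\<bar>)" .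
  qed
  also have "\<dots> = (\<integral>\<^sup>+a. ennreal (cap R) * (ennreal \<bar>?g a - ?f a\<bar> * total ?g + ennreal (?f a) * ?D) \<partial>lborel)"
    unfolding total_def L1_dist_def
    by (intro nn_integral_cong, subst nn_integral_cmult, measurable, subst nn_integral_add, measurable,
        subst nn_integral_cmult, measurable, subst nn_integral_cmult, measurable)
  also have "\<dots> = ennreal (cap R) * (?D * total ?g + total ?f * ?D)"
    by (subst nn_integral_cmult, measurable, subst nn_integral_add, measurable,
        subst nn_integral_multc, measurable, subst nn_integral_multc, measurable) (simp add: L1_dist_def total_def)
  also have "\<dots> \<le> ennreal (cap R) * (ennreal ((1 / 2) ^ n) * ennreal M0 + ennreal M0 * ennreal ((1 / 2) ^ n))"
    by (intro mult_left_mono add_mono mult_mono f_dist s F_total f_total) auto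
  also have "\<dots> = ennreal (cap R * (2 * M0 * (1 / 2) ^ n))"
    using cap_nonneg[of R] M_nonneg
    by (simp add: ennreal_mult[symmetric] ennreal_plus[symmetric] mult_ac del: ennreal_plus)
  finally show ?thesis .
qed

text \<open>Since \<open>R\<close> is fixed before \<open>n\<close>, the kernel inside the square
  keeps the bound \<open>cap R\<close> and the rate \<open>(1 / 2) ^ n\<close> wins; each of the two
  collision terms outside stays below \<open>\<epsilon> / 3\<close> after integration in
  time.\<close>

lemma discrepancy_small:
  assumes T: "0 \<le> T" and \<epsilon>: "0 < \<epsilon>"
  obtains N where "\<And>n. N \<le> n \<Longrightarrow> (\<integral>\<^sup>+s. indicator {0..T} s * discrepancy n s \<partial>lborel) \<le> ennreal \<epsilon>"
proof -
  obtain R where R: "\<And>n. (\<integral>\<^sup>+s. indicator {0..T} s * collisions (outside R) (\<kappa> n) (F n s) \<partial>lborel) \<le> ennreal (\<epsilon> / 3)"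
    using F_tail[OF T, of "\<epsilon> / 3"] \<epsilon> by auto
  have "(\<lambda>n. T * (cap R * (2 * M0 * (1 / 2) ^ n))) \<longlonglongrightarrow> T * (cap R * (2 * M0 * 0))"
    by (intro tendsto_intros LIMSEQ_power_zero) auto
  then have "\<forall>\<^sub>F n in sequentially. T * (cap R * (2 * M0 * (1 / 2) ^ n)) < \<epsilon> / 3"
    using \<epsilon> by (intro order_tendstoD(2)) auto
  then obtain N1 where N1: "\<And>n. N1 \<le> n \<Longrightarrow> T * (cap R * (2 * M0 * (1 / 2) ^ n)) < \<epsilon> / 3"
    by (auto simp: eventually_sequentially)
  obtain N2 :: nat where N2: "T \<le> real N2" using real_arch_simple by blast
  have "(\<integral>\<^sup>+s. indicator {0..T} s * discrepancy n s \<partial>lborel) \<le> ennreal \<epsilon>" if n: "max R (max N1 N2) \<le> n" for n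
  proof -
    have \<phi>n: "R \<le> \<phi> n" using n \<phi>_ge[of n] by simp
    let ?e = "ennreal (cap R * (2 * M0 * (1 / 2) ^ n))"
    have split: "discrepancy n s \<le> ?e + (collisions (outside R) (\<kappa> (\<phi> n)) (F (\<phi> n) s) + collisions (outside R) K (f s))"
      if s: "s \<in> {0..T}" for s
    proof -
      let ?g = "F (\<phi> n) s" and ?f = "f s"
      let ?P = "\<lambda>a b. ennreal (\<kappa> R a b * \<bar>?g a * ?g b - ?f a * ?f b\<bar>)"
      let ?Q = "\<lambda>a b. outside R a b * ennreal (\<kappa> (\<phi> n) a b * ?g a * ?g b)"
      let ?S = "\<lambda>a b. outside R a b * ennreal (K a b * ?f a * ?f b)"
      have "discrepancy n s \<le> (\<integral>\<^sup>+a. \<integral>\<^sup>+b. ?P a b + (?Q a b + ?S a b) \<partial>lborel \<partial>lborel)"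
        unfolding discrepancy_def
      proof (intro nn_integral_mono)
        fix a b
        let ?x = "\<kappa> (\<phi> n) a b * ?g a * ?g b" and ?y = "K a b * ?f a * ?f b"
        show "ennreal \<bar>?x - ?y\<bar> \<le> ?P a b + (?Q a b + ?S a b)"
        proof (cases "a \<le> real R \<and> b \<le> real R")
          case True
          then have "\<kappa> (\<phi> n) a b = \<kappa> R a b" "K a b = \<kappa> R a b" using \<phi>n by (simp_all add: \<kappa>_eq)
          then have "\<bar>?x - ?y\<bar> = \<bar>\<kappa> R a b * (?g a * ?g b - ?f a * ?f b)\<bar>" by (simp add: right_diff_distrib mult.assoc)
          also have "\<dots> = \<kappa> R a b * \<bar>?g a * ?g b - ?f a * ?f b\<bar>"
            using kernel_nonneg[OF \<kappa>_kernel] by (simp add: abs_mult)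
          finally show ?thesis by simp
        next
          case False
          have xy: "0 \<le> ?x" "0 \<le> ?y"
            by (intro mult_nonneg_nonneg kernel_nonneg[OF \<kappa>_kernel] kernel_nonneg[OF K] F_nonneg f_nonneg)+
          then have "ennreal \<bar>?x - ?y\<bar> \<le> ennreal (?x + ?y)"
            by (intro ennreal_leI) linarith
          also have "\<dots> = ennreal ?x + ennreal ?y" using xy by (rule ennreal_plus)
          finally have "ennreal \<bar>?x - ?y\<bar> \<le> ennreal ?x + ennreal ?y" .
          then show ?thesis using False by (auto simp: outside_eq intro: add_increasing)
        qed
      qed
      also have "\<dots> = (\<integral>\<^sup>+a. (\<integral>\<^sup>+b. ?P a b \<partial>lborel) + ((\<integral>\<^sup>+b. ?Q a b \<partial>lborel) + (\<integral>\<^sup>+b. ?S a b \<partial>lborel)) \<partial>lborel)"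
        by (intro nn_integral_cong, subst nn_integral_add, measurable, subst nn_integral_add, measurable)
      also have "\<dots> = (\<integral>\<^sup>+a. \<integral>\<^sup>+b. ?P a b \<partial>lborel \<partial>lborel) + (collisions (outside R) (\<kappa> (\<phi> n)) ?g + collisions (outside R) K ?f)"
        unfolding collisions_def by (subst nn_integral_add, measurable, subst nn_integral_add, measurable)
      also have "\<dots> \<le> ?e + (collisions (outside R) (\<kappa> (\<phi> n)) ?g + collisions (outside R) K ?f)"
        using s n N2 by (intro add_right_mono product_dist) auto
      finally show ?thesis .
    qed
    have "(\<integral>\<^sup>+s. indicator {0..T} s * discrepancy n s \<partial>lborel) \<le> (\<integral>\<^sup>+s. ?e * indicator {0..T} s
        + (indicator {0..T} s * collisions (outside R) (\<kappa> (\<phi> n)) (F (\<phi> n) s) + indicator {0..T} s * collisions (outside R) K (f s)) \<partial>lborel)"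
      using split by (intro nn_integral_mono) (auto simp: indicator_def)
    also have "\<dots> = ?e * ennreal T + ((\<integral>\<^sup>+s. indicator {0..T} s * collisions (outside R) (\<kappa> (\<phi> n)) (F (\<phi> n) s) \<partial>lborel)
        + (\<integral>\<^sup>+s. indicator {0..T} s * collisions (outside R) K (f s) \<partial>lborel))"
      using T by (subst nn_integral_add, measurable, subst nn_integral_add, measurable, subst nn_integral_cmult_indicator) auto
    also have "\<dots> \<le> ennreal (\<epsilon> / 3) + (ennreal (\<epsilon> / 3) + ennreal (\<epsilon> / 3))"
    proof (intro add_mono R f_tail[OF T])
      show "?e * ennreal T \<le> ennreal (\<epsilon> / 3)"
        using N1[of n] n T cap_nonneg[of R] M_nonneg by (simp add: ennreal_mult[symmetric] ennreal_leI mult_ac less_imp_le)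
    qed
    also have "\<dots> = ennreal \<epsilon>" using \<epsilon> by (simp add: ennreal_plus[symmetric] del: ennreal_plus)
    finally show ?thesis .
  qed
  then show ?thesis using that by blast
qed

lemma collisions_discrepancy:
  assumes [measurable]: "case_prod \<psi> \<in> borel_measurable (borel \<Otimes>\<^sub>M borel)" and \<psi>: "\<And>a b. \<psi> a b \<le> 1"
  shows "collisions \<psi> (\<kappa> (\<phi> n)) (F (\<phi> n) s) \<le> collisions \<psi> K (f s) + discrepancy n s" (is ?A)
    and "collisions \<psi> K (f s) \<le> collisions \<psi> (\<kappa> (\<phi> n)) (F (\<phi> n) s) + discrepancy n s" (is ?B)
proof -
  have gen: "(\<integral>\<^sup>+a. \<integral>\<^sup>+b. \<psi> a b * ennreal (u a b) \<partial>lborel \<partial>lborel)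
      \<le> (\<integral>\<^sup>+a. \<integral>\<^sup>+b. \<psi> a b * ennreal (v a b) \<partial>lborel \<partial>lborel) + (\<integral>\<^sup>+a. \<integral>\<^sup>+b. ennreal \<bar>u a b - v a b\<bar> \<partial>lborel \<partial>lborel)"
    if [measurable]: "case_prod u \<in> borel_measurable (borel \<Otimes>\<^sub>M borel)" "case_prod v \<in> borel_measurable (borel \<Otimes>\<^sub>M borel)"
      and "\<And>a b. 0 \<le> v a b" for u v :: "real \<Rightarrow> real \<Rightarrow> real"
  proof -
    have "(\<integral>\<^sup>+a. \<integral>\<^sup>+b. \<psi> a b * ennreal (u a b) \<partial>lborel \<partial>lborel)
      \<le> (\<integral>\<^sup>+a. \<integral>\<^sup>+b. \<psi> a b * ennreal (v a b) + ennreal \<bar>u a b - v a b\<bar> \<partial>lborel \<partial>lborel)"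
    proof (intro nn_integral_mono)
      fix a b
      have "ennreal (u a b) \<le> ennreal (v a b) + ennreal \<bar>u a b - v a b\<bar>"
        using that(3)[of a b] ennreal_leI[of "u a b" "v a b + \<bar>u a b - v a b\<bar>"] by simp
      then have "\<psi> a b * ennreal (u a b) \<le> \<psi> a b * (ennreal (v a b) + ennreal \<bar>u a b - v a b\<bar>)"
        by (rule mult_left_mono) simp
      also have "\<dots> \<le> \<psi> a b * ennreal (v a b) + 1 * ennreal \<bar>u a b - v a b\<bar>"
        unfolding distrib_left by (intro add_left_mono mult_right_mono \<psi>) simp
      finally show "\<psi> a b * ennreal (u a b) \<le> \<psi> a b * ennreal (v a b) + ennreal \<bar>u a b - v a b\<bar>" by simp
    qed
    also have "\<dots> = (\<integral>\<^sup>+a. (\<integral>\<^sup>+b. \<psi> a b * ennreal (v a b) \<partial>lborel) + (\<integral>\<^sup>+b. ennreal \<bar>u a b - v a b\<bar> \<partial>lborel) \<partial>lborel)"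
      by (intro nn_integral_cong nn_integral_add) measurable
    also have "\<dots> = (\<integral>\<^sup>+a. \<integral>\<^sup>+b. \<psi> a b * ennreal (v a b) \<partial>lborel \<partial>lborel) + (\<integral>\<^sup>+a. \<integral>\<^sup>+b. ennreal \<bar>u a b - v a b\<bar> \<partial>lborel \<partial>lborel)"
      by (rule nn_integral_add) measurable
    finally show ?thesis .
  qed
  have nn: "0 \<le> K a b * f s a * f s b" "0 \<le> \<kappa> (\<phi> n) a b * F (\<phi> n) s a * F (\<phi> n) s b" for a b
    by (intro mult_nonneg_nonneg kernel_nonneg[OF \<kappa>_kernel] kernel_nonneg[OF K] F_nonneg f_nonneg)+
  show ?A unfolding collisions_def discrepancy_def by (rule gen) (measurable, rule nn)
  show ?B unfolding collisions_def discrepancy_def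
    by (subst abs_minus_commute, rule gen) (measurable, rule nn)
qed

text \<open>Equality is reached by two inequalities up to every \<open>\<epsilon>\<close>. The four
  quarters pay for the distance of the densities, the discrepancy once in each collision term, and
  the unfinished Euler step.\<close>

lemma limit_balance:
  assumes E[measurable]: "E \<in> sets borel" and \<tau>: "0 \<le> \<tau>"
  shows "(\<integral>\<^sup>+x. indicator E x * ennreal (f \<tau> x) \<partial>lborel)
      + (\<integral>\<^sup>+s. indicator {0..\<tau>} s * collisions (\<lambda>a b. indicator E a) K (f s) \<partial>lborel)
    = (\<integral>\<^sup>+x. indicator E x * ennreal (f0 x) \<partial>lborel)
      + (\<integral>\<^sup>+s. indicator {0..\<tau>} s * collisions (\<lambda>a b. indicator E (a - b) * indicator {0<..} (a - b)) K (f s) \<partial>lborel)"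
proof -
  let ?I = "\<lambda>f. \<integral>\<^sup>+x. indicator E x * ennreal (f x) \<partial>lborel"
  let ?l = "\<lambda>a b. indicator E a :: ennreal"
  let ?g = "\<lambda>a b. indicator E (a - b) * indicator {0<..} (a - b) :: ennreal"
  let ?f = "\<lambda>\<psi>. \<integral>\<^sup>+s. indicator {0..\<tau>} s * collisions \<psi> K (f s) \<partial>lborel"
  let ?F = "\<lambda>n \<psi>. \<integral>\<^sup>+s. indicator {0..\<tau>} s * collisions \<psi> (\<kappa> (\<phi> n)) (F (\<phi> n) s) \<partial>lborel"
  let ?d = "\<lambda>n. \<integral>\<^sup>+s. indicator {0..\<tau>} s * discrepancy n s \<partial>lborel"
  have I: "?I u \<le> ?I v + L1_dist u v" if "density_fun u" "density_fun v" for u v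
  proof -
    note [measurable] = density_fun_measurable[OF that(1)] density_fun_measurable[OF that(2)]
    have "?I u \<le> (\<integral>\<^sup>+x. indicator E x * ennreal (v x) + ennreal \<bar>u x - v x\<bar> \<partial>lborel)"
      using density_fun_nonneg[OF that(2)]
      by (intro nn_integral_mono) (auto simp: indicator_def ennreal_plus[symmetric] simp del: ennreal_plus intro!: ennreal_leI)
    then show ?thesis by (simp add: nn_integral_add L1_dist_def)
  qed
  have FF: "?F n \<psi> \<le> ?f \<psi> + ?d n" "?f \<psi> \<le> ?F n \<psi> + ?d n"
    if m[measurable]: "case_prod \<psi> \<in> borel_measurable (borel \<Otimes>\<^sub>M borel)" and \<psi>: "\<And>a b. \<psi> a b \<le> 1" for n \<psi>
  proof -
    have "?F n \<psi> \<le> (\<integral>\<^sup>+s. indicator {0..\<tau>} s * collisions \<psi> K (f s) + indicator {0..\<tau>} s * discrepancy n s \<partial>lborel)"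
      using collisions_discrepancy(1)[OF m \<psi>] by (intro nn_integral_mono) (auto simp: indicator_def)
    then show "?F n \<psi> \<le> ?f \<psi> + ?d n" by (subst (asm) nn_integral_add) auto
    have "?f \<psi> \<le> (\<integral>\<^sup>+s. indicator {0..\<tau>} s * collisions \<psi> (\<kappa> (\<phi> n)) (F (\<phi> n) s) + indicator {0..\<tau>} s * discrepancy n s \<partial>lborel)"
      using collisions_discrepancy(2)[OF m \<psi>] by (intro nn_integral_mono) (auto simp: indicator_def)
    then show "?f \<psi> \<le> ?F n \<psi> + ?d n" by (subst (asm) nn_integral_add) auto
  qed
  have l: "case_prod ?l \<in> borel_measurable (borel \<Otimes>\<^sub>M borel)" "\<And>a b. ?l a b \<le> 1"
    and g: "case_prod ?g \<in> borel_measurable (borel \<Otimes>\<^sub>M borel)" "\<And>a b. ?g a b \<le> 1"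
    by (measurable, simp add: indicator_def)+
  have approx: "?I (f \<tau>) + ?f ?l \<le> ?I f0 + ?f ?g + ennreal \<epsilon>" "?I f0 + ?f ?g \<le> ?I (f \<tau>) + ?f ?l + ennreal \<epsilon>"
    if \<epsilon>: "0 < \<epsilon>" for \<epsilon>
  proof -
    obtain N1 where N1: "\<And>n. N1 \<le> n \<Longrightarrow> ?d n \<le> ennreal (\<epsilon> / 4)"
      using discrepancy_small[OF \<tau>, of "\<epsilon> / 4"] \<epsilon> by auto
    obtain N2 :: nat where N2: "\<tau> \<le> real N2" using real_arch_simple by blast
    have "(\<lambda>n. (1 / 2) ^ n :: real) \<longlonglongrightarrow> 0" by (intro LIMSEQ_power_zero) auto
    then have "\<forall>\<^sub>F n in sequentially. (1 / 2) ^ n < \<epsilon> / 4" using \<epsilon> by (intro order_tendstoD(2)) auto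
    then obtain N3 where N3: "\<And>n. N3 \<le> n \<Longrightarrow> (1 / 2) ^ n < \<epsilon> / 4" by (auto simp: eventually_sequentially)
    obtain N4 where N4: "1 / real (Suc N4) < \<epsilon> / 4" using \<epsilon> nat_approx_posE[of "\<epsilon> / 4"] by auto
    define n where "n = max (max N1 N2) (max N3 N4)"
    have d: "?d n \<le> ennreal (\<epsilon> / 4)" by (rule N1) (simp add: n_def)
    have dist: "L1_dist (F (\<phi> n) \<tau>) (f \<tau>) \<le> ennreal (\<epsilon> / 4)"
    proof (rule order.trans[OF f_dist[OF \<tau>] ennreal_leI])
      show "\<tau> \<le> real n" using N2 by (simp add: n_def)
      show "(1 / 2) ^ n \<le> \<epsilon> / 4" by (rule less_imp_le[OF N3]) (simp add: n_def)
    qed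
    have step: "ennreal (1 / real (\<phi> n + 1)) \<le> ennreal (\<epsilon> / 4)"
    proof (rule ennreal_leI)
      have "1 / real (\<phi> n + 1) \<le> 1 / real (Suc N4)"
        using \<phi>_ge[of n] by (intro divide_left_mono) (auto simp: n_def)
      then show "1 / real (\<phi> n + 1) \<le> \<epsilon> / 4" using N4 by simp
    qed
    have sum: "ennreal (\<epsilon> / 4) + ennreal (\<epsilon> / 4) + ennreal (\<epsilon> / 4) + ennreal (\<epsilon> / 4) = ennreal \<epsilon>"
      using \<epsilon> by (simp add: ennreal_plus[symmetric] del: ennreal_plus)
    let ?e = "ennreal (\<epsilon> / 4)"
    have "?I (f \<tau>) + ?f ?l \<le> (?I (F (\<phi> n) \<tau>) + ?e) + (?F n ?l + ?e)"
      by (rule add_mono[OF order.trans[OF I[OF f_density F_density] add_left_mono] order.trans[OF FF(2)[OF l] add_left_mono[OF d]]])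
         (use dist in \<open>simp add: L1_dist_commute\<close>)
    also have "\<dots> = (?I (F (\<phi> n) \<tau>) + ?F n ?l) + (?e + ?e)" by (simp add: ac_simps)
    also have "\<dots> \<le> (?I f0 + ?F n ?g + ?e) + (?e + ?e)"
      by (rule add_right_mono[OF order.trans[OF F_balance(1)[OF E \<tau>] add_left_mono[OF step]]])
    also have "\<dots> \<le> (?I f0 + (?f ?g + ?e) + ?e) + (?e + ?e)"
      by (rule add_right_mono[OF add_right_mono[OF add_left_mono[OF order.trans[OF FF(1)[OF g] add_left_mono[OF d]]]]])
    also have "\<dots> = ?I f0 + ?f ?g + ennreal \<epsilon>" unfolding sum[symmetric] by (simp only: ac_simps)
    finally show "?I (f \<tau>) + ?f ?l \<le> ?I f0 + ?f ?g + ennreal \<epsilon>" .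
    have "?I f0 + ?f ?g \<le> ?I f0 + (?F n ?g + ?e)"
      by (rule add_left_mono[OF order.trans[OF FF(2)[OF g] add_left_mono[OF d]]])
    also have "\<dots> = (?I f0 + ?F n ?g) + ?e" by (simp add: ac_simps)
    also have "\<dots> \<le> (?I (F (\<phi> n) \<tau>) + ?F n ?l + ?e) + ?e"
      by (rule add_right_mono[OF order.trans[OF F_balance(2)[OF E \<tau>] add_left_mono[OF step]]])
    also have "\<dots> \<le> ((?I (f \<tau>) + ?e) + (?f ?l + ?e) + ?e) + ?e"
      by (rule add_right_mono[OF add_right_mono[OF add_mono[OF order.trans[OF I[OF F_density f_density] add_left_mono[OF dist]]
            order.trans[OF FF(1)[OF l] add_left_mono[OF d]]]]])
    also have "\<dots> = ?I (f \<tau>) + ?f ?l + ennreal \<epsilon>" unfolding sum[symmetric] by (simp only: ac_simps)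
    finally show "?I f0 + ?f ?g \<le> ?I (f \<tau>) + ?f ?l + ennreal \<epsilon>" .
  qed
  show ?thesis
    by (rule antisym; rule ennreal_le_epsilon, rule approx)
qed

section \<open>From the balance over sets to the equation at almost every size\<close>

definition loss_total :: "real \<Rightarrow> real \<Rightarrow> ennreal" where
  "loss_total \<tau> x = (\<integral>\<^sup>+s. indicator {0..\<tau>} s * loss_rate K (f s) x \<partial>lborel)"

definition gain_total :: "real \<Rightarrow> real \<Rightarrow> ennreal" where
  "gain_total \<tau> x = (\<integral>\<^sup>+s. indicator {0..\<tau>} s * gain_rate K (f s) x \<partial>lborel)"

lemma rates_measurable[measurable]:
  "(\<lambda>(s, x). loss_rate K (f s) x) \<in> borel_measurable (borel \<Otimes>\<^sub>M borel)"
  "(\<lambda>(s, x). gain_rate K (f s) x) \<in> borel_measurable (borel \<Otimes>\<^sub>M borel)"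
  unfolding loss_rate_def gain_rate_def by measurable

lemma totals_measurable[measurable]:
  "loss_total \<tau> \<in> borel_measurable borel" "gain_total \<tau> \<in> borel_measurable borel"
  unfolding loss_total_def gain_total_def by measurable

lemma loss_total_weak:
  assumes [measurable]: "E \<in> sets borel"
  shows "(\<integral>\<^sup>+x. indicator E x * loss_total \<tau> x \<partial>lborel)
    = (\<integral>\<^sup>+s. indicator {0..\<tau>} s * collisions (\<lambda>a b. indicator E a) K (f s) \<partial>lborel)"
proof -
  have "(\<integral>\<^sup>+x. indicator E x * loss_total \<tau> x \<partial>lborel)
     = (\<integral>\<^sup>+x. \<integral>\<^sup>+s. indicator {0..\<tau>} s * (indicator E x * loss_rate K (f s) x) \<partial>lborel \<partial>lborel)"
    unfolding loss_total_def
    by (intro nn_integral_cong, subst nn_integral_cmult[symmetric], measurable) (simp add: mult_ac)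
  also have "\<dots> = (\<integral>\<^sup>+s. \<integral>\<^sup>+x. indicator {0..\<tau>} s * (indicator E x * loss_rate K (f s) x) \<partial>lborel \<partial>lborel)"
    by (rule lborel_pair.Fubini') measurable
  also have "\<dots> = (\<integral>\<^sup>+s. indicator {0..\<tau>} s * collisions (\<lambda>a b. indicator E a) K (f s) \<partial>lborel)"
    by (intro nn_integral_cong) (simp add: nn_integral_cmult loss_weak[OF K f_density])
  finally show ?thesis .
qed

lemma gain_total_weak:
  assumes [measurable]: "E \<in> sets borel"
  shows "(\<integral>\<^sup>+x. indicator E x * gain_total \<tau> x \<partial>lborel)
    = (\<integral>\<^sup>+s. indicator {0..\<tau>} s * collisions (\<lambda>a b. indicator E (a - b) * indicator {0<..} (a - b)) K (f s) \<partial>lborel)"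
proof -
  have "(\<integral>\<^sup>+x. indicator E x * gain_total \<tau> x \<partial>lborel)
     = (\<integral>\<^sup>+x. \<integral>\<^sup>+s. indicator {0..\<tau>} s * (indicator E x * gain_rate K (f s) x) \<partial>lborel \<partial>lborel)"
    unfolding gain_total_def
    by (intro nn_integral_cong, subst nn_integral_cmult[symmetric], measurable) (simp add: mult_ac)
  also have "\<dots> = (\<integral>\<^sup>+s. \<integral>\<^sup>+x. indicator {0..\<tau>} s * (indicator E x * gain_rate K (f s) x) \<partial>lborel \<partial>lborel)"
    by (rule lborel_pair.Fubini') measurable
  also have "\<dots> = (\<integral>\<^sup>+s. indicator {0..\<tau>} s * collisions (\<lambda>a b. indicator E (a - b) * indicator {0<..} (a - b)) K (f s) \<partial>lborel)"
    by (intro nn_integral_cong) (simp add: nn_integral_cmult gain_weak[OF K f_density])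
  finally show ?thesis .
qed

text \<open>The balance over every Borel set says that two densities define the same measure, hence
  they agree almost everywhere. Finiteness of both totals comes from the case
  \<open>E = UNIV\<close> and the finite number of collisions over
  \<open>[0, \<tau>]\<close>.\<close>

lemma integral_equation:
  assumes \<tau>: "0 \<le> \<tau>"
  shows "AE x in lborel. loss_total \<tau> x < \<infinity> \<and> gain_total \<tau> x < \<infinity>
    \<and> ennreal (f \<tau> x) + loss_total \<tau> x = ennreal (f0 x) + gain_total \<tau> x"
proof -
  have [measurable]: "f0 \<in> borel_measurable borel" by (rule density_fun_measurable[OF f0])
  have "density lborel (\<lambda>x. ennreal (f \<tau> x) + loss_total \<tau> x) = density lborel (\<lambda>x. ennreal (f0 x) + gain_total \<tau> x)"
  proof (rule measure_eqI)
    fix E assume "E \<in> sets (density lborel (\<lambda>x. ennreal (f \<tau> x) + loss_total \<tau> x))"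
    then have E[measurable]: "E \<in> sets borel" by simp
    have "emeasure (density lborel (\<lambda>x. ennreal (f \<tau> x) + loss_total \<tau> x)) E
       = (\<integral>\<^sup>+x. indicator E x * ennreal (f \<tau> x) + indicator E x * loss_total \<tau> x \<partial>lborel)"
      by (subst emeasure_density) (auto intro!: nn_integral_cong simp: mult.commute distrib_left)
    also have "\<dots> = (\<integral>\<^sup>+x. indicator E x * ennreal (f0 x) + indicator E x * gain_total \<tau> x \<partial>lborel)"
      using limit_balance[OF E \<tau>] by (simp add: nn_integral_add loss_total_weak gain_total_weak)
    also have "\<dots> = emeasure (density lborel (\<lambda>x. ennreal (f0 x) + gain_total \<tau> x)) E"
      by (subst emeasure_density) (auto intro!: nn_integral_cong simp: mult.commute distrib_left)
    finally show "emeasure (density lborel (\<lambda>x. ennreal (f \<tau> x) + loss_total \<tau> x)) E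
       = emeasure (density lborel (\<lambda>x. ennreal (f0 x) + gain_total \<tau> x)) E" .
  qed simp
  then have eq: "AE x in lborel. ennreal (f \<tau> x) + loss_total \<tau> x = ennreal (f0 x) + gain_total \<tau> x"
    by (intro sigma_finite_measure.density_unique[OF sigma_finite_lborel]) auto
  have "(\<integral>\<^sup>+x. loss_total \<tau> x \<partial>lborel) < \<infinity>"
    using loss_total_weak[of UNIV \<tau>] f_collisions_finite[OF \<tau>] by simp
  then have "AE x in lborel. loss_total \<tau> x \<noteq> \<infinity>" by (intro nn_integral_PInf_AE) auto
  moreover have "(\<integral>\<^sup>+x. gain_total \<tau> x \<partial>lborel) < \<infinity>"
  proof -
    have "(\<integral>\<^sup>+x. gain_total \<tau> x \<partial>lborel)
       = (\<integral>\<^sup>+s. indicator {0..\<tau>} s * collisions (\<lambda>a b. 1 * indicator {0<..} (a - b)) K (f s) \<partial>lborel)"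
      using gain_total_weak[of UNIV \<tau>] by simp
    also have "\<dots> \<le> (\<integral>\<^sup>+s. indicator {0..\<tau>} s * collisions (\<lambda>a b. 1) K (f s) \<partial>lborel)"
      by (intro nn_integral_mono mult_left_mono collisions_mono[OF mult_right_mono f_density]) (auto simp: indicator_def)
    also have "\<dots> < \<infinity>" by (rule f_collisions_finite[OF \<tau>])
    finally show ?thesis .
  qed
  then have "AE x in lborel. gain_total \<tau> x \<noteq> \<infinity>" by (intro nn_integral_PInf_AE) auto
  ultimately show ?thesis using eq by eventually_elim (auto simp: less_top)
qed

end

section \<open>Existence of mild solutions\<close>

lemma nonneg_iterated_integral:
  fixes H :: "real \<Rightarrow> real \<Rightarrow> real"
  assumes [measurable]: "case_prod H \<in> borel_measurable (borel \<Otimes>\<^sub>M borel)"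
    and nn: "\<And>x y. 0 \<le> H x y"
    and fin: "(\<integral>\<^sup>+y. \<integral>\<^sup>+x. ennreal (H x y) \<partial>lborel \<partial>lborel) < \<infinity>"
  shows "integrable lborel (case_prod H)"
    and "(LBINT y. LBINT x. H x y) = enn2real (\<integral>\<^sup>+y. \<integral>\<^sup>+x. ennreal (H x y) \<partial>lborel \<partial>lborel)"
proof -
  have nn_int: "(\<integral>\<^sup>+y. \<integral>\<^sup>+x. ennreal (H x y) \<partial>lborel \<partial>lborel)
     = (\<integral>\<^sup>+p. ennreal (case_prod H p) \<partial>(lborel \<Otimes>\<^sub>M lborel))"
    using lborel_pair.nn_integral_snd[of "\<lambda>p. ennreal (case_prod H p)"] by simp
  have int: "integrable (lborel \<Otimes>\<^sub>M lborel) (case_prod H)"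
    by (rule integrableI_nonneg) (use fin nn in \<open>auto simp: nn_int[symmetric]\<close>)
  then show "integrable lborel (case_prod H)" by (simp add: lborel_prod)
  have "(LBINT y. LBINT x. H x y) = integral\<^sup>L (lborel \<Otimes>\<^sub>M lborel) (case_prod H)"
    by (rule lborel_pair.integral_snd[OF int])
  also have "\<dots> = enn2real (\<integral>\<^sup>+p. ennreal (case_prod H p) \<partial>(lborel \<Otimes>\<^sub>M lborel))"
    by (rule integral_eq_nn_integral) (use nn in auto)
  finally show "(LBINT y. LBINT x. H x y) = enn2real (\<integral>\<^sup>+y. \<integral>\<^sup>+x. ennreal (H x y) \<partial>lborel \<partial>lborel)"
    by (simp add: nn_int)
qed

text \<open>The bridge from \<open>ennreal\<close> integrals over the line to the Bochner integrals
  of \<open>mild_solution\<close>: \<open>P\<close> vanishes for \<open>\<rho> \<le> 0\<close>, and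
  closed and open time interval differ by at most two points. \<open>P'\<close> is tied to
  \<open>P\<close> only for \<open>\<rho> > 0\<close>, because the given kernel is arbitrary at
  negative sizes.\<close>

lemma nonneg_set_iterated_integral:
  fixes P P' :: "real \<Rightarrow> real \<Rightarrow> real"
  assumes [measurable]: "case_prod P \<in> borel_measurable (borel \<Otimes>\<^sub>M borel)"
    and nn: "\<And>\<rho> s. 0 \<le> P \<rho> s" and zero: "\<And>\<rho> s. \<rho> \<le> 0 \<Longrightarrow> P \<rho> s = 0"
    and P': "\<And>\<rho> s. 0 < \<rho> \<Longrightarrow> P' \<rho> s = P \<rho> s"
    and fin: "(\<integral>\<^sup>+s. indicator {0..\<tau>} s * (\<integral>\<^sup>+\<rho>. ennreal (P \<rho> s) \<partial>lborel) \<partial>lborel) < \<infinity>"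
  shows "set_integrable lborel ({0<..} \<times> {0<..<\<tau>}) (\<lambda>(\<rho>, s). P' \<rho> s)"
    and "(LBINT s:{0<..<\<tau>}. LBINT \<rho>:{0<..}. P' \<rho> s)
      = enn2real (\<integral>\<^sup>+s. indicator {0..\<tau>} s * (\<integral>\<^sup>+\<rho>. ennreal (P \<rho> s) \<partial>lborel) \<partial>lborel)"
proof -
  define H where "H \<rho> s = indicator {0<..<\<tau>} s * P \<rho> s" for \<rho> s
  have [measurable]: "case_prod H \<in> borel_measurable (borel \<Otimes>\<^sub>M borel)"
    unfolding H_def by measurable
  have H0: "0 \<le> H \<rho> s" for \<rho> s by (simp add: H_def nn)
  have X: "(\<integral>\<^sup>+s. \<integral>\<^sup>+\<rho>. ennreal (H \<rho> s) \<partial>lborel \<partial>lborel)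
      = (\<integral>\<^sup>+s. indicator {0..\<tau>} s * (\<integral>\<^sup>+\<rho>. ennreal (P \<rho> s) \<partial>lborel) \<partial>lborel)"
  proof (rule nn_integral_cong_AE)
    show "AE s in lborel. (\<integral>\<^sup>+\<rho>. ennreal (H \<rho> s) \<partial>lborel) = indicator {0..\<tau>} s * (\<integral>\<^sup>+\<rho>. ennreal (P \<rho> s) \<partial>lborel)"
      using AE_lborel_singleton[of 0] AE_lborel_singleton[of \<tau>]
      by eventually_elim (auto simp: H_def indicator_def)
  qed
  have eq: "(\<lambda>p. indicator ({0<..} \<times> {0<..<\<tau>}) p *\<^sub>R (case p of (\<rho>, s) \<Rightarrow> P' \<rho> s)) = case_prod H"
    by (auto simp: fun_eq_iff H_def indicator_def P' zero)
  show "set_integrable lborel ({0<..} \<times> {0<..<\<tau>}) (\<lambda>(\<rho>, s). P' \<rho> s)"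
    unfolding set_integrable_def eq
    by (rule nonneg_iterated_integral(1)) (use H0 fin X in auto)
  have "(LBINT s:{0<..<\<tau>}. LBINT \<rho>:{0<..}. P' \<rho> s) = (LBINT s. LBINT \<rho>. H \<rho> s)"
    unfolding set_lebesgue_integral_def
  proof (rule Bochner_Integration.integral_cong)
    fix s
    have "(LBINT \<rho>. indicator {0<..} \<rho> *\<^sub>R P' \<rho> s) = (LBINT \<rho>. P \<rho> s)"
      by (rule Bochner_Integration.integral_cong) (auto simp: indicator_def P' zero)
    then show "indicator {0<..<\<tau>} s *\<^sub>R (LBINT \<rho>. indicator {0<..} \<rho> *\<^sub>R P' \<rho> s) = (LBINT \<rho>. H \<rho> s)"
      by (simp add: H_def)
  qed simp
  also have "\<dots> = enn2real (\<integral>\<^sup>+s. \<integral>\<^sup>+\<rho>. ennreal (H \<rho> s) \<partial>lborel \<partial>lborel)"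
    by (rule nonneg_iterated_integral(2)) (use H0 fin X in auto)
  finally show "(LBINT s:{0<..<\<tau>}. LBINT \<rho>:{0<..}. P' \<rho> s)
      = enn2real (\<integral>\<^sup>+s. indicator {0..\<tau>} s * (\<integral>\<^sup>+\<rho>. ennreal (P \<rho> s) \<partial>lborel) \<partial>lborel)"
    by (simp add: X)
qed

lemma L1_norm_eq:
  assumes [measurable]: "u \<in> borel_measurable borel"
  shows "L1_norm u = enn2real (\<integral>\<^sup>+x. indicator {0<..} x * ennreal \<bar>u x\<bar> \<partial>lborel)"
proof -
  have "L1_norm u = enn2real (\<integral>\<^sup>+x. ennreal (indicator {0<..} x *\<^sub>R \<bar>u x\<bar>) \<partial>lborel)"
    unfolding L1_norm_def set_lebesgue_integral_def by (rule integral_eq_nn_integral) auto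
  also have "(\<integral>\<^sup>+x. ennreal (indicator {0<..} x *\<^sub>R \<bar>u x\<bar>) \<partial>lborel) = (\<integral>\<^sup>+x. indicator {0<..} x * ennreal \<bar>u x\<bar> \<partial>lborel)"
    by (intro nn_integral_cong) (auto simp: indicator_def)
  finally show ?thesis .
qed

lemma X01_norm_eq:
  assumes [measurable]: "u \<in> borel_measurable borel"
  shows "X01_norm u = enn2real (\<integral>\<^sup>+x. indicator {0<..} x * ennreal ((1 + x) * \<bar>u x\<bar>) \<partial>lborel)"
proof -
  have "X01_norm u = enn2real (\<integral>\<^sup>+x. ennreal (indicator {0<..} x *\<^sub>R ((1 + x) * \<bar>u x\<bar>)) \<partial>lborel)"
    unfolding X01_norm_def set_lebesgue_integral_def by (rule integral_eq_nn_integral) (auto simp: indicator_def)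
  also have "(\<integral>\<^sup>+x. ennreal (indicator {0<..} x *\<^sub>R ((1 + x) * \<bar>u x\<bar>)) \<partial>lborel) = (\<integral>\<^sup>+x. indicator {0<..} x * ennreal ((1 + x) * \<bar>u x\<bar>) \<partial>lborel)"
    by (intro nn_integral_cong) (auto simp: indicator_def)
  finally show ?thesis .
qed

lemma weighted_norm_density:
  assumes u: "density_fun u"
  shows "(\<integral>\<^sup>+x. indicator {0<..} x * ennreal ((1 + x) * \<bar>u x\<bar>) \<partial>lborel) = total u + moment u"
proof -
  note [measurable] = density_fun_measurable[OF u]
  have "(\<integral>\<^sup>+x. indicator {0<..} x * ennreal ((1 + x) * \<bar>u x\<bar>) \<partial>lborel)
     = (\<integral>\<^sup>+x. ennreal (u x) + ennreal (x * u x) \<partial>lborel)"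
  proof (rule nn_integral_cong)
    fix x
    show "indicator {0<..} x * ennreal ((1 + x) * \<bar>u x\<bar>) = ennreal (u x) + ennreal (x * u x)"
      using density_fun_zero[OF u, of x] density_fun_nonneg[OF u, of x]
      by (cases "0 < x") (auto simp: ennreal_plus[symmetric] distrib_right simp del: ennreal_plus)
  qed
  then show ?thesis by (simp add: nn_integral_add total_def moment_def)
qed

lemma X01I:
  assumes [measurable]: "u \<in> borel_measurable borel"
    and fin: "(\<integral>\<^sup>+x. indicator {0<..} x * ennreal ((1 + x) * \<bar>u x\<bar>) \<partial>lborel) < \<infinity>"
  shows "u \<in> X01"
proof -
  have "(\<integral>\<^sup>+x. ennreal (norm (indicator {0<..} x *\<^sub>R ((1 + x) * u x))) \<partial>lborel)
     = (\<integral>\<^sup>+x. indicator {0<..} x * ennreal ((1 + x) * \<bar>u x\<bar>) \<partial>lborel)"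
    by (intro nn_integral_cong) (auto simp: indicator_def abs_mult)
  then show ?thesis
    unfolding X01_def set_integrable_def using fin by (auto intro!: integrableI_bounded)
qed

lemma moment_integral:
  assumes u: "density_fun u"
  shows "(LBINT \<sigma>:{0<..}. \<sigma> * u \<sigma>) = enn2real (moment u)"
proof -
  note [measurable] = density_fun_measurable[OF u]
  have "(LBINT \<sigma>:{0<..}. \<sigma> * u \<sigma>) = enn2real (\<integral>\<^sup>+x. ennreal (indicator {0<..} x *\<^sub>R (x * u x)) \<partial>lborel)"
    unfolding set_lebesgue_integral_def
    by (rule integral_eq_nn_integral) (use density_fun_nonneg[OF u] in \<open>auto simp: indicator_def\<close>)
  also have "(\<integral>\<^sup>+x. ennreal (indicator {0<..} x *\<^sub>R (x * u x)) \<partial>lborel) = moment u"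
    unfolding moment_def using density_fun_zero[OF u] by (intro nn_integral_cong) (auto simp: indicator_def)
  finally show ?thesis .
qed

section \<open>Regularity of the limit and the mild formulation\<close>

context rbk_limit
begin

lemma f_in_X01: "0 \<le> t \<Longrightarrow> f t \<in> X01"
  by (rule X01I) (use f_total[of t] f_moment[of t] in \<open>auto simp: weighted_norm_density[OF f_density] intro: le_less_trans\<close>)

lemma f_X01_norm: "0 \<le> t \<Longrightarrow> X01_norm (f t) \<le> M0 + M1"
  unfolding X01_norm_eq[OF f_measurable] weighted_norm_density[OF f_density]
  by (rule enn2real_leI) (use f_total[of t] f_moment[of t] M_nonneg in \<open>auto intro: add_mono\<close>)

text \<open>The approximants themselves jump in time, but their moduli are uniform from some index
  on; comparison through one late approximant passes the modulus to the limit.\<close>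

lemma f_time:
  assumes \<epsilon>: "0 < \<epsilon>"
  obtains \<eta> where "0 < \<eta>" "\<And>s t. 0 \<le> s \<Longrightarrow> s \<le> T \<Longrightarrow> 0 \<le> t \<Longrightarrow> t \<le> T \<Longrightarrow> \<bar>s - t\<bar> \<le> \<eta> \<Longrightarrow> L1_dist (f s) (f t) \<le> ennreal \<epsilon>"
proof -
  obtain \<eta> N where \<eta>: "0 < \<eta>" and N: "\<And>n s t. N \<le> n \<Longrightarrow> s \<in> {0..T} \<Longrightarrow> t \<in> {0..T} \<Longrightarrow> \<bar>s - t\<bar> \<le> \<eta> \<Longrightarrow> L1_dist (F n s) (F n t) \<le> ennreal (\<epsilon> / 2)"
    using F_time[OF half_gt_zero[OF \<epsilon>], of T] by metis
  obtain N2 :: nat where N2: "T \<le> real N2" using real_arch_simple by blast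
  have "(\<lambda>n. (1 / 2) ^ n :: real) \<longlonglongrightarrow> 0" by (intro LIMSEQ_power_zero) auto
  then have "\<forall>\<^sub>F n in sequentially. (1 / 2) ^ n < \<epsilon> / 4" using \<epsilon> by (intro order_tendstoD(2)) auto
  then obtain N3 where N3: "\<And>n. N3 \<le> n \<Longrightarrow> (1 / 2) ^ n < \<epsilon> / 4" by (auto simp: eventually_sequentially)
  define n where "n = max (max N N2) N3"
  have close: "L1_dist (F (\<phi> n) t) (f t) \<le> ennreal (\<epsilon> / 4)" if "0 \<le> t" "t \<le> T" for t
  proof (rule order.trans[OF f_dist[OF that(1)] ennreal_leI])
    show "t \<le> real n" using that N2 by (simp add: n_def)
    show "(1 / 2) ^ n \<le> \<epsilon> / 4" by (rule less_imp_le[OF N3]) (simp add: n_def)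
  qed
  have "L1_dist (f s) (f t) \<le> ennreal \<epsilon>" if st: "0 \<le> s" "s \<le> T" "0 \<le> t" "t \<le> T" "\<bar>s - t\<bar> \<le> \<eta>" for s t
  proof -
    have "L1_dist (f s) (f t) \<le> L1_dist (f s) (F (\<phi> n) s) + (L1_dist (F (\<phi> n) s) (F (\<phi> n) t) + L1_dist (F (\<phi> n) t) (f t))"
      by (rule order.trans[OF L1_dist_triangle[where g = "F (\<phi> n) s"] add_left_mono[OF L1_dist_triangle]]) measurable
    also have "\<dots> \<le> ennreal (\<epsilon> / 4) + (ennreal (\<epsilon> / 2) + ennreal (\<epsilon> / 4))"
    proof (intro add_mono)
      show "L1_dist (f s) (F (\<phi> n) s) \<le> ennreal (\<epsilon> / 4)" using close[of s] st by (simp add: L1_dist_commute)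
      show "L1_dist (F (\<phi> n) s) (F (\<phi> n) t) \<le> ennreal (\<epsilon> / 2)"
        using \<phi>_ge[of n] st by (intro N) (auto simp: n_def)
      show "L1_dist (F (\<phi> n) t) (f t) \<le> ennreal (\<epsilon> / 4)" using close[of t] st by simp
    qed
    also have "\<dots> = ennreal \<epsilon>" using \<epsilon> by (simp add: ennreal_plus[symmetric] del: ennreal_plus)
    finally show ?thesis .
  qed
  then show ?thesis using that \<eta> by blast
qed

lemma f_continuous: "continuous_L1 \<infinity> f"
  unfolding continuous_L1_def
proof (intro ballI conjI)
  fix t assume "t \<in> time_interval \<infinity>"
  then have t: "0 \<le> t" by (simp add: time_interval_def)
  have "total (f t) < \<infinity>" using f_total[OF t] by (auto intro: le_less_trans)
  from density_fun_integrable[OF f_density this]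
  show "f t \<in> L1" unfolding L1_def set_integrable_def
    using integrable_mult_indicator[of "{0<..}" lborel "f t"] by simp
  show "((\<lambda>s. L1_norm (\<lambda>\<sigma>. f s \<sigma> - f t \<sigma>)) \<longlongrightarrow> 0) (at t within time_interval \<infinity>)"
  proof (rule tendstoI)
    fix e :: real assume e: "0 < e"
    obtain \<eta> where \<eta>: "0 < \<eta>" "\<And>s u. 0 \<le> s \<Longrightarrow> s \<le> t + 1 \<Longrightarrow> 0 \<le> u \<Longrightarrow> u \<le> t + 1 \<Longrightarrow> \<bar>s - u\<bar> \<le> \<eta> \<Longrightarrow> L1_dist (f s) (f u) \<le> ennreal (e / 2)"
      using f_time[of "e / 2" "t + 1"] e by auto
    have "dist (L1_norm (\<lambda>\<sigma>. f s \<sigma> - f t \<sigma>)) 0 < e" if s: "s \<in> time_interval \<infinity>" "dist s t < min \<eta> 1" for s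
    proof -
      have "(\<integral>\<^sup>+x. indicator {0<..} x * ennreal \<bar>f s x - f t x\<bar> \<partial>lborel) \<le> L1_dist (f s) (f t)"
        unfolding L1_dist_def by (intro nn_integral_mono) (auto simp: indicator_def)
      also have "\<dots> \<le> ennreal (e / 2)"
        using s t by (intro \<eta>) (auto simp: time_interval_def dist_real_def)
      finally have "L1_norm (\<lambda>\<sigma>. f s \<sigma> - f t \<sigma>) \<le> e / 2"
        using e by (subst L1_norm_eq, measurable, intro enn2real_leI) simp_all
      moreover have "0 \<le> L1_norm (\<lambda>\<sigma>. f s \<sigma> - f t \<sigma>)" by (subst L1_norm_eq) auto
      ultimately show ?thesis using e by simp
    qed
    then show "\<forall>\<^sub>F s in at t within time_interval \<infinity>. dist (L1_norm (\<lambda>\<sigma>. f s \<sigma> - f t \<sigma>)) 0 < e"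
      unfolding eventually_at using \<eta>(1) by (intro exI[of _ "min \<eta> 1"]) auto
  qed
qed

text \<open>The Euler approximations, truncated to \<open>\<sigma> < n\<close>, are simple and converge in the weighted norm:
  the weight costs a factor \<open>1 + n\<close>, which the rate \<open>(1 / 2) ^ n\<close> absorbs.\<close>

lemma f_strongly_measurable: "strongly_measurable_X01 \<infinity> f"
  unfolding strongly_measurable_X01_def
proof (intro exI conjI allI ballI)
  define g where "g n t = (\<lambda>x. if t < real n \<and> x < real n then F (\<phi> n) t x else 0)" for n t
  have [measurable]: "g n t \<in> borel_measurable borel" for n t unfolding g_def by measurable
  show "simple_function (restrict_space lborel (open_time_interval \<infinity>)) (g n)" for n
  proof -
    let ?M = "restrict_space lborel (open_time_interval \<infinity>)"
    \<comment> \<open>Values are functions of the size, so what must be finite is the number of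
      distinct densities. A positive \<open>k\<close> codes the iterate \<open>k - 1\<close>, and
      \<open>k = 0\<close> the zero function taken for \<open>t \<ge> n\<close>.\<close>
    let ?N = "\<lambda>t. if t < real n then Suc (steps (\<phi> n) t) else 0"
    have [measurable]: "steps (\<phi> n) \<in> measurable borel (count_space UNIV)"
      unfolding steps_def by measurable
    have "?N \<in> measurable lborel (count_space UNIV)" by measurable
    then have N: "?N \<in> measurable ?M (count_space UNIV)" by (rule measurable_restrict_space1)
    have "?N t \<le> Suc (steps (\<phi> n) (real n))" for t using steps_mono[of t "real n" "\<phi> n"] by simp
    then have "?N ` space ?M \<subseteq> {..Suc (steps (\<phi> n) (real n))}" by blast
    then have fin: "finite (?N ` space ?M)" by (rule finite_subset) simp
    have simp: "simple_function ?M ?N"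
      unfolding simple_function_def using fin measurable_sets[OF N] by simp
    have "g n = (\<lambda>t. (\<lambda>k x. if k = 0 \<or> real n \<le> x then 0 else iter (\<phi> n) (k - 1) x) (?N t))"
      by (auto simp: fun_eq_iff g_def F_def)
    then show ?thesis using simple_function_compose1[OF simp] by simp
  qed
  have tail_fin: "(\<integral>\<^sup>+x. indicator {0<..} x * ennreal ((1 + x) * \<bar>F n t x\<bar>) \<partial>lborel) < \<infinity>" for n t
    using F_total[of n t] F_moment[of n t] unfolding weighted_norm_density[OF F_density]
    by (auto intro: le_less_trans)
  show "g n t \<in> X01" for n t
  proof (rule X01I)
    have "(\<integral>\<^sup>+x. indicator {0<..} x * ennreal ((1 + x) * \<bar>g n t x\<bar>) \<partial>lborel)
       \<le> (\<integral>\<^sup>+x. indicator {0<..} x * ennreal ((1 + x) * \<bar>F (\<phi> n) t x\<bar>) \<partial>lborel)"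
      by (intro nn_integral_mono) (auto simp: g_def indicator_def)
    then show "(\<integral>\<^sup>+x. indicator {0<..} x * ennreal ((1 + x) * \<bar>g n t x\<bar>) \<partial>lborel) < \<infinity>"
      using tail_fin by (rule le_less_trans)
  qed measurable
  show "AE t in lborel. t \<in> open_time_interval \<infinity> \<longrightarrow> (\<lambda>n. X01_norm (\<lambda>\<sigma>. g n t \<sigma> - f t \<sigma>)) \<longlonglongrightarrow> 0"
  proof (intro AE_I2 impI)
    fix t :: real assume "t \<in> open_time_interval \<infinity>"
    then have t: "0 \<le> t" by (simp add: open_time_interval_def)
    let ?w = "\<lambda>x. indicator {0<..} x * ennreal ((1 + x) * \<bar>f t x\<bar>)"
    \<comment> \<open>From size \<open>n\<close> on the truncated approximant is zero and the error
      is \<open>f t\<close> itself; its weighted tail vanishes by dominated convergence, without a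
      rate.\<close>
    let ?r = "\<lambda>n. \<integral>\<^sup>+x. indicator {real n..} x * ?w x \<partial>lborel"
    have w_fin: "(\<integral>\<^sup>+x. ?w x \<partial>lborel) < \<infinity>"
      using f_total[OF t] f_moment[OF t] unfolding weighted_norm_density[OF f_density] by (auto intro: le_less_trans)
    have "?r \<longlonglongrightarrow> (\<integral>\<^sup>+(x::real). 0 \<partial>lborel)"
    proof (rule nn_integral_dominated_convergence[where w = ?w])
      show "AE x in lborel. (\<lambda>n. indicator {real n..} x * ?w x) \<longlonglongrightarrow> 0"
      proof (rule AE_I2, rule tendsto_eventually)
        fix x :: real
        obtain N :: nat where "x < real N" using reals_Archimedean2 by blast
        then have "indicator {real n..} x * ?w x = 0" if "N \<le> n" for n using that by (simp add: indicator_def)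
        then show "\<forall>\<^sub>F n in sequentially. indicator {real n..} x * ?w x = 0" by (auto simp: eventually_sequentially)
      qed
    qed (use w_fin in \<open>auto simp: indicator_def\<close>)
    then have r: "?r \<longlonglongrightarrow> 0" by simp
    have bound: "(\<integral>\<^sup>+x. indicator {0<..} x * ennreal ((1 + x) * \<bar>g n t x - f t x\<bar>) \<partial>lborel)
        \<le> ennreal ((1 + real n) * (1 / 2) ^ n) + ?r n" if n: "t < real n" for n
    proof -
      have "(\<integral>\<^sup>+x. indicator {0<..} x * ennreal ((1 + x) * \<bar>g n t x - f t x\<bar>) \<partial>lborel)
         \<le> (\<integral>\<^sup>+x. ennreal (1 + real n) * ennreal \<bar>F (\<phi> n) t x - f t x\<bar> + indicator {real n..} x * ?w x \<partial>lborel)"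
      proof (rule nn_integral_mono)
        fix x :: real
        show "indicator {0<..} x * ennreal ((1 + x) * \<bar>g n t x - f t x\<bar>)
           \<le> ennreal (1 + real n) * ennreal \<bar>F (\<phi> n) t x - f t x\<bar> + indicator {real n..} x * ?w x"
        proof (cases "0 < x \<and> x < real n")
          case True
          then have "(1 + x) * \<bar>F (\<phi> n) t x - f t x\<bar> \<le> (1 + real n) * \<bar>F (\<phi> n) t x - f t x\<bar>"
            by (intro mult_right_mono) auto
          then have "ennreal ((1 + x) * \<bar>F (\<phi> n) t x - f t x\<bar>) \<le> ennreal ((1 + real n) * \<bar>F (\<phi> n) t x - f t x\<bar>)"
            by (rule ennreal_leI)
          then show ?thesis using True n by (simp add: g_def ennreal_mult)
        next
          case False
          then show ?thesis by (auto simp: g_def indicator_def)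
        qed
      qed
      also have "\<dots> = ennreal (1 + real n) * L1_dist (F (\<phi> n) t) (f t) + ?r n"
        unfolding L1_dist_def by (subst nn_integral_add, measurable, subst nn_integral_cmult, measurable)
      also have "\<dots> \<le> ennreal (1 + real n) * ennreal ((1 / 2) ^ n) + ?r n"
        using n by (intro add_right_mono mult_left_mono f_dist t) auto
      also have "\<dots> = ennreal ((1 + real n) * (1 / 2) ^ n) + ?r n" by (simp add: ennreal_mult)
      finally show ?thesis .
    qed
    have "(\<lambda>n. (1 + real n) * (1 / 2) ^ n) \<longlonglongrightarrow> 0" by real_asymp
    then have "(\<lambda>n. ennreal ((1 + real n) * (1 / 2) ^ n) + ?r n) \<longlonglongrightarrow> ennreal 0 + 0"
      by (intro tendsto_add tendsto_ennrealI r)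
    then have lim: "(\<lambda>n. ennreal ((1 + real n) * (1 / 2) ^ n) + ?r n) \<longlonglongrightarrow> 0" by simp
    have "(\<lambda>n. \<integral>\<^sup>+x. indicator {0<..} x * ennreal ((1 + x) * \<bar>g n t x - f t x\<bar>) \<partial>lborel) \<longlonglongrightarrow> 0"
    proof (rule tendsto_sandwich[OF _ _ tendsto_const lim])
      obtain N :: nat where "t < real N" using reals_Archimedean2 by blast
      then show "\<forall>\<^sub>F n in sequentially. (\<integral>\<^sup>+x. indicator {0<..} x * ennreal ((1 + x) * \<bar>g n t x - f t x\<bar>) \<partial>lborel)
        \<le> ennreal ((1 + real n) * (1 / 2) ^ n) + ?r n"
        unfolding eventually_sequentially using bound by (intro exI[of _ N]) auto
    qed simp
    then have "(\<lambda>n. enn2real (\<integral>\<^sup>+x. indicator {0<..} x * ennreal ((1 + x) * \<bar>g n t x - f t x\<bar>) \<partial>lborel)) \<longlonglongrightarrow> 0"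
      using tendsto_enn2real[of _ 0] by force
    then show "(\<lambda>n. X01_norm (\<lambda>\<sigma>. g n t \<sigma> - f t \<sigma>)) \<longlonglongrightarrow> 0"
      by (subst X01_norm_eq) auto
  qed
qed

lemma f_Linfty: "Linfty_X01 \<infinity> f"
  unfolding Linfty_X01_def
  using f_strongly_measurable f_in_X01 f_X01_norm
  by (auto simp: open_time_interval_def intro!: exI[of _ "M0 + M1"])

text \<open>The construction works with representatives of kernel and datum; the mild formulation
  sees the kernel only at nonnegative sizes and the datum only up to null sets. The additive
  identity may be read in the reals because both totals are finite.\<close>

lemma f_mild_solution:
  assumes K': "\<And>a b. 0 \<le> a \<Longrightarrow> 0 \<le> b \<Longrightarrow> K' a b = K a b"
    and u0: "AE x in lborel. 0 < x \<longrightarrow> u0 x = f0 x"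
  shows "mild_solution K' u0 \<infinity> f"
  unfolding mild_solution_def
proof (intro conjI ballI f_continuous f_Linfty)
  fix \<tau> assume "\<tau> \<in> time_interval \<infinity>"
  then have \<tau>: "0 \<le> \<tau>" by (simp add: time_interval_def)
  show "f \<tau> \<in> X01_pos" using f_in_X01[OF \<tau>] f_nonneg by (simp add: X01_pos_def)
  show "AE \<sigma> in lborel. 0 < \<sigma> \<longrightarrow>
        set_integrable lborel ({0<..} \<times> {0<..<\<tau>}) (\<lambda>(\<rho>, s). RBK_loss K' f \<sigma> \<rho> s) \<and>
        set_integrable lborel ({0<..} \<times> {0<..<\<tau>}) (\<lambda>(\<rho>, s). RBK_gain K' f \<sigma> \<rho> s) \<and>
        f \<tau> \<sigma> = u0 \<sigma>
          + (LBINT s:{0<..<\<tau>}. LBINT \<rho>:{0<..}. RBK_gain K' f \<sigma> \<rho> s)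
          - (LBINT s:{0<..<\<tau>}. LBINT \<rho>:{0<..}. RBK_loss K' f \<sigma> \<rho> s)"
    using integral_equation[OF \<tau>] u0
  proof (eventually_elim, intro impI)
    case (elim \<sigma>)
    assume \<sigma>: "0 < \<sigma>"
    have fin: "loss_total \<tau> \<sigma> < \<infinity>" "gain_total \<tau> \<sigma> < \<infinity>"
      and eq: "ennreal (f \<tau> \<sigma>) + loss_total \<tau> \<sigma> = ennreal (f0 \<sigma>) + gain_total \<tau> \<sigma>"
      and u0\<sigma>: "u0 \<sigma> = f0 \<sigma>"
      using elim \<sigma> by auto
    let ?L = "\<lambda>\<rho> s. K \<sigma> \<rho> * f s \<sigma> * f s \<rho>" and ?G = "\<lambda>\<rho> s. K (\<sigma> + \<rho>) \<rho> * f s (\<sigma> + \<rho>) * f s \<rho>"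
    have lt: "loss_total \<tau> \<sigma> = (\<integral>\<^sup>+s. indicator {0..\<tau>} s * (\<integral>\<^sup>+\<rho>. ennreal (?L \<rho> s) \<partial>lborel) \<partial>lborel)"
      by (simp add: loss_total_def loss_rate_def)
    have gt: "gain_total \<tau> \<sigma> = (\<integral>\<^sup>+s. indicator {0..\<tau>} s * (\<integral>\<^sup>+\<rho>. ennreal (?G \<rho> s) \<partial>lborel) \<partial>lborel)"
      using \<sigma> by (simp add: gain_total_def gain_rate_def)
    have zero: "f s \<rho> = 0" if "\<rho> \<le> 0" for s \<rho> by (rule density_fun_zero[OF f_density that])
    have nn: "0 \<le> ?L \<rho> s" "0 \<le> ?G \<rho> s" for \<rho> s
      by (intro mult_nonneg_nonneg kernel_nonneg[OF K] f_nonneg)+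
    have L: "set_integrable lborel ({0<..} \<times> {0<..<\<tau>}) (\<lambda>(\<rho>, s). RBK_loss K' f \<sigma> \<rho> s)"
      "(LBINT s:{0<..<\<tau>}. LBINT \<rho>:{0<..}. RBK_loss K' f \<sigma> \<rho> s) = enn2real (loss_total \<tau> \<sigma>)"
      unfolding lt
      by (rule nonneg_set_iterated_integral[of ?L]; use nn zero fin lt K' \<sigma> in \<open>simp add: RBK_loss_def\<close>)+
    have G: "set_integrable lborel ({0<..} \<times> {0<..<\<tau>}) (\<lambda>(\<rho>, s). RBK_gain K' f \<sigma> \<rho> s)"
      "(LBINT s:{0<..<\<tau>}. LBINT \<rho>:{0<..}. RBK_gain K' f \<sigma> \<rho> s) = enn2real (gain_total \<tau> \<sigma>)"
      unfolding gt
      by (rule nonneg_set_iterated_integral[of ?G]; use nn zero fin gt K' \<sigma> in \<open>simp add: RBK_gain_def\<close>)+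
    have "f \<tau> \<sigma> + enn2real (loss_total \<tau> \<sigma>) = f0 \<sigma> + enn2real (gain_total \<tau> \<sigma>)"
      using arg_cong[OF eq, of enn2real] fin f_nonneg[of \<tau> \<sigma>] density_fun_nonneg[OF f0, of \<sigma>]
      by (simp add: enn2real_plus less_top)
    then show "set_integrable lborel ({0<..} \<times> {0<..<\<tau>}) (\<lambda>(\<rho>, s). RBK_loss K' f \<sigma> \<rho> s) \<and>
        set_integrable lborel ({0<..} \<times> {0<..<\<tau>}) (\<lambda>(\<rho>, s). RBK_gain K' f \<sigma> \<rho> s) \<and>
        f \<tau> \<sigma> = u0 \<sigma>
          + (LBINT s:{0<..<\<tau>}. LBINT \<rho>:{0<..}. RBK_gain K' f \<sigma> \<rho> s)
          - (LBINT s:{0<..<\<tau>}. LBINT \<rho>:{0<..}. RBK_loss K' f \<sigma> \<rho> s)"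
      using L G u0\<sigma> by simp
  qed
qed

end

theorem (in rbk_problem) mild_solution_exists:
  assumes "\<And>a b. 0 \<le> a \<Longrightarrow> 0 \<le> b \<Longrightarrow> K' a b = K a b"
    and "AE x in lborel. 0 < x \<longrightarrow> u0 x = f0 x"
  shows "\<exists>f. mild_solution K' u0 \<infinity> f \<and>
    (\<forall>\<tau>\<ge>0. (LBINT \<sigma>:{0<..}. \<sigma> * f \<tau> \<sigma>) \<le> (LBINT \<sigma>:{0<..}. \<sigma> * f0 \<sigma>))"
proof -
  obtain \<phi> f where *: "strict_mono \<phi>" "case_prod f \<in> borel_measurable (borel \<Otimes>\<^sub>M borel)"
    "\<And>t. density_fun (f t)"
    "\<And>n t. 0 \<le> t \<Longrightarrow> t \<le> real n \<Longrightarrow> L1_dist (F (\<phi> n) t) (f t) \<le> ennreal ((1 / 2) ^ n)"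
    "\<And>t. 0 \<le> t \<Longrightarrow> AE x in lborel. (\<lambda>n. F (\<phi> n) t x) \<longlonglongrightarrow> f t x"
    using convergent_subsequence by blast
  interpret rbk_limit K f0 \<phi> f by unfold_locales (use * in auto)
  have "(LBINT \<sigma>:{0<..}. \<sigma> * f \<tau> \<sigma>) \<le> (LBINT \<sigma>:{0<..}. \<sigma> * f0 \<sigma>)" if "0 \<le> \<tau>" for \<tau>
    unfolding moment_integral[OF f_density] moment_integral[OF f0]
    using f_moment[OF that] M_nonneg by (simp add: M_eq enn2real_leI)
  then show ?thesis using f_mild_solution[OF assms] by blast
qed

text \<open>A real supremum dominates its elements only over a set that is bounded above; continuity
  on a compact interval supplies this. \<open>max S 1\<close> respects the restriction to
  \<open>R \<ge> 1\<close>, and \<open>max Y 1\<close> keeps the divisor \<open>y\<close>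
  positive.\<close>

lemma sublinear_kernel:
  fixes K :: "real \<Rightarrow> real \<Rightarrow> real"
  assumes cont: "continuous_on ({0..} \<times> {0..}) (\<lambda>(x, y). K x y)"
    and lim: "\<And>R. R \<ge> 1 \<Longrightarrow> ((\<lambda>y. SUP x\<in>{0..R}. K x y / y) \<longlongrightarrow> 0) at_top"
    and \<epsilon>: "0 < \<epsilon>"
  shows "\<exists>R\<ge>0. \<forall>y\<ge>R. \<forall>x\<in>{0..S}. K x y \<le> \<epsilon> * y"
proof -
  have "\<forall>\<^sub>F y in at_top. (SUP x\<in>{0..max S 1}. K x y / y) < \<epsilon>"
    using lim[of "max S 1"] \<epsilon> by (intro order_tendstoD(2)) auto
  then obtain Y where Y: "\<And>y. Y \<le> y \<Longrightarrow> (SUP x\<in>{0..max S 1}. K x y / y) < \<epsilon>"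
    by (auto simp: eventually_at_top_linorder)
  have "K x y \<le> \<epsilon> * y" if y: "max Y 1 \<le> y" and x: "x \<in> {0..S}" for x y
  proof -
    have "continuous_on {0..max S 1} (\<lambda>x. (case (x, y) of (x, y) \<Rightarrow> K x y) / y)"
      using y by (intro continuous_intros continuous_on_compose2[OF cont]) auto
    then have "compact ((\<lambda>x. K x y / y) ` {0..max S 1})" by (intro compact_continuous_image) auto
    then have "bdd_above ((\<lambda>x. K x y / y) ` {0..max S 1})"
      by (intro bounded_imp_bdd_above compact_imp_bounded)
    then have "K x y / y \<le> (SUP x\<in>{0..max S 1}. K x y / y)" using x by (intro cSUP_upper) auto
    also have "\<dots> < \<epsilon>" using y by (intro Y) auto
    finally show ?thesis using y by (simp add: pos_divide_less_eq less_imp_le)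
  qed
  then show ?thesis by (intro exI[of _ "max Y 1"]) auto
qed

theorem theorem2p1:
  fixes K \<alpha> :: "real \<Rightarrow> real \<Rightarrow> real" and r f0 :: "real \<Rightarrow> real" and A :: real
  assumes "continuous_on {0..} r"
    and "\<And>x. 0 \<le> x \<Longrightarrow> 0 \<le> r x"
    and "continuous_on ({0..} \<times> {0..}) (\<lambda>(x, y). \<alpha> x y)"
    and "\<And>x y. 0 \<le> x \<Longrightarrow> 0 \<le> y \<Longrightarrow> 0 \<le> \<alpha> x y"
    and "\<And>x y. 0 \<le> x \<Longrightarrow> 0 \<le> y \<Longrightarrow> \<alpha> x y = \<alpha> y x"
    and "\<And>x y. 0 \<le> x \<Longrightarrow> 0 \<le> y \<Longrightarrow> 0 \<le> K x y"
    and "\<And>x y. 0 \<le> x \<Longrightarrow> 0 \<le> y \<Longrightarrow> K x y = K y x"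
    and "\<And>x y. 0 \<le> x \<Longrightarrow> 0 \<le> y \<Longrightarrow> K x y = r x * r y + \<alpha> x y"
    and "A > 0"
    and "\<And>x y. 1 \<le> x \<Longrightarrow> 1 \<le> y \<Longrightarrow> 0 \<le> \<alpha> x y \<and> \<alpha> x y \<le> A * r x * r y"
    and "\<And>R. R \<ge> 1 \<Longrightarrow> ((\<lambda>y. SUP x\<in>{0..R}. K x y / y) \<longlongrightarrow> 0) at_top"
    and "f0 \<in> X01_pos"
  shows "\<exists>f. mild_solution K f0 \<infinity> f \<and>
           (\<forall>\<tau>\<ge>0. (LBINT \<sigma>:{0<..}. \<sigma> * f \<tau> \<sigma>) \<le> (LBINT \<sigma>:{0<..}. \<sigma> * f0 \<sigma>))"
proof -
  \<comment> \<open>\<open>K\<close> inherits continuity on the quadrant from \<open>r\<close> and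
    \<open>\<alpha>\<close>; this is what makes the truncated kernels bounded and uniformly
    continuous.\<close>
  have "continuous_on ({0..} \<times> {0..}) (\<lambda>p. r (fst p) * r (snd p) + (case p of (x, y) \<Rightarrow> \<alpha> x y))"
    by (intro continuous_on_add continuous_on_mult assms(3) continuous_on_compose2[OF assms(1)]
        continuous_on_fst continuous_on_snd continuous_on_id) auto
  then have K_cont: "continuous_on ({0..} \<times> {0..}) (\<lambda>(x, y). K x y)"
    by (rule continuous_on_cong[THEN iffD1, rotated 2]) (auto simp: assms(8))
  define K0 where "K0 a b = (if 0 \<le> a \<and> 0 \<le> b then K a b else 0)" for a b
  have K0: "kernel K0"
  proof -
    have "(\<lambda>p. indicator ({0..} \<times> {0..}) p *\<^sub>R (case p of (x, y) \<Rightarrow> K x y)) \<in> borel_measurable borel"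
      by (intro borel_measurable_continuous_on_indicator K_cont borel_closed closed_Times closed_atLeast)
    also have "(\<lambda>p. indicator ({0..} \<times> {0..}) p *\<^sub>R (case p of (x, y) \<Rightarrow> K x y)) = case_prod K0"
      by (auto simp: fun_eq_iff K0_def indicator_def)
    finally have "case_prod K0 \<in> borel_measurable (borel \<Otimes>\<^sub>M borel)" by (simp add: borel_prod)
    then show ?thesis using assms(6,7) by (auto simp: kernel_def K0_def)
  qed
  \<comment> \<open>Integrability makes only the weighted product on the half line Borel, so a Borel
    representative is recovered by dividing by the weight. The maximum with 0 repairs the null set
    on which \<open>f0\<close> may be negative.\<close>
  define g0 where "g0 x = max 0 (indicator {0<..} x *\<^sub>R ((1 + x) * f0 x) / (1 + x))" for x
  have f0: "set_integrable lborel {0<..} (\<lambda>\<sigma>. (1 + \<sigma>) * f0 \<sigma>)" "AE \<sigma> in lborel. 0 < \<sigma> \<longrightarrow> 0 \<le> f0 \<sigma>"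
    using assms(12) by (auto simp: X01_pos_def X01_def)
  have [measurable]: "(\<lambda>x. indicator {0<..} x *\<^sub>R ((1 + x) * f0 x)) \<in> borel_measurable borel"
    using borel_measurable_integrable[OF f0(1)[unfolded set_integrable_def]] by simp
  have g0_pos: "g0 x = max 0 (f0 x)" if "0 < x" for x using that by (simp add: g0_def)
  have g0: "density_fun g0"
  proof -
    have "g0 \<in> borel_measurable borel" unfolding g0_def by measurable
    then show ?thesis by (auto simp: density_fun_def g0_def)
  qed
  have g0_eq: "AE x in lborel. 0 < x \<longrightarrow> f0 x = g0 x"
    using f0(2) by eventually_elim (auto simp: g0_pos)
  have fin: "total g0 + moment g0 < \<infinity>"
  proof -
    have "total g0 + moment g0 \<le> (\<integral>\<^sup>+x. ennreal (norm (indicator {0<..} x *\<^sub>R ((1 + x) * f0 x))) \<partial>lborel)"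
      unfolding weighted_norm_density[OF g0, symmetric]
      by (intro nn_integral_mono) (auto simp: indicator_def g0_pos abs_mult intro!: ennreal_leI mult_left_mono)
    also have "\<dots> < \<infinity>"
      using f0(1) unfolding set_integrable_def integrable_iff_bounded by simp
    finally show ?thesis .
  qed
  interpret rbk_problem K0 g0
  proof
    show "continuous_on ({0..} \<times> {0..}) (case_prod K0)"
      by (rule continuous_on_cong[THEN iffD1, OF refl _ K_cont]) (auto simp: K0_def)
    show "\<exists>R. \<forall>y\<ge>R. \<forall>x\<in>{0..S}. K0 x y \<le> \<epsilon> * y" if \<epsilon>: "0 < \<epsilon>" for S \<epsilon>
    proof -
      obtain R where "0 \<le> R" "\<And>y x. R \<le> y \<Longrightarrow> x \<in> {0..S} \<Longrightarrow> K x y \<le> \<epsilon> * y"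
        using sublinear_kernel[OF K_cont assms(11) \<epsilon>, of S] by blast
      then show ?thesis by (intro exI[of _ R]) (auto simp: K0_def)
    qed
  qed (use K0 g0 fin in \<open>auto simp: K0_def\<close>)
  have "(LBINT \<sigma>:{0<..}. \<sigma> * g0 \<sigma>) = (LBINT \<sigma>:{0<..}. \<sigma> * f0 \<sigma>)"
    unfolding set_lebesgue_integral_def
  proof (rule integral_cong_AE)
    \<comment> \<open>\<open>f0\<close> is arbitrary off the half line, so measurability of the
      restricted \<open>x * f0 x\<close> is again read off from the weighted product, through the
      factor \<open>x / (1 + x)\<close>.\<close>
    have "(\<lambda>x. x / (1 + x) * (indicator {0<..} x *\<^sub>R ((1 + x) * f0 x))) \<in> borel_measurable borel" by measurable
    also have "(\<lambda>x. x / (1 + x) * (indicator {0<..} x *\<^sub>R ((1 + x) * f0 x))) = (\<lambda>x. indicator {0<..} x *\<^sub>R (x * f0 x))"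
      by (auto simp: fun_eq_iff indicator_def)
    finally show "(\<lambda>x. indicator {0<..} x *\<^sub>R (x * f0 x)) \<in> borel_measurable lborel" by simp
    show "AE x in lborel. indicator {0<..} x *\<^sub>R (x * g0 x) = indicator {0<..} x *\<^sub>R (x * f0 x)"
      using g0_eq by eventually_elim (auto simp: indicator_def)
  qed (use density_fun_measurable[OF g0] in simp)
  then show ?thesis
    using mild_solution_exists[of K f0] g0_eq by (simp add: K0_def)
qed

end
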